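(* Let $n\geq2$ and $k\geq2$ be integers. Then there exists an immersed $H^2$-curve $\gamma:[0,1]\to\mathbf{R}^n$ with a point of multiplicity $k$ such that $$\bar{B}[\gamma]= \varpi^*(k-1)^2.$$ In addition, for an immersed $H^2$-curve $\gamma:[0,1]\to\mathbf{R}^n$ with a point of multiplicity $k$, this equality is attained if and only if $\gamma$ is a $(k-1)$-leafed elastica.
   Context: $H^2=W^{2,2}$, and $H^2\hookrightarrow C^1$, so a curve is immersed if $\gamma'\neq0$ everywhere. For an immersed $H^2$-curve $\gamma$ let $\partial_s:=\frac{1}{|\gamma'|}\partial_x$, $ds=|\gamma'|dx$, $\kappa:=\partial_s^2\gamma$, $L[\gamma]:=\int_\gamma ds$, $B[\gamma]:=\int_\gamma|\kappa|^2ds$, $\bar{B}[\gamma]:=L[\gamma]B[\gamma]$. A curve $\gamma$ has a point $p$ of multiplicity $k$ if $\gamma^{-1}(p)$ contains at least $k$ distinct points. For $m\in(0,1)$ let $F(x,m)=\int_0^x\frac{d\theta}{\sqrt{1-m\sin^2\theta}}$, $K(m)=F(\pi/2,m)$, $E(m)=\int_0^{\pi/2}\sqrt{1-m\sin^2\theta}\,d\theta$, $\operatorname{am}(\cdot,m):=F^{-1}(\cdot,m)$ on $\mathbf{R}$, $\operatorname{cn}(x,m):=\cos(\operatorname{am}(x,m))$. Let $m^*\in(0,1)$ be the unique parameter with $K(m^* )=2E(m^* )$, and $\varpi^*:=32(2m^*-1)E(m^* )^2$. A half-fold figure-eight elastica is an immersed curve $\gamma:[a,b]\to\mathbf{R}^n$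 that is contained in a plane and whose signed curvature in that plane, as a function of arclength $s\in[0,L]$ ($L$ its length), is up to the choice of sign $\mathrm{k}(s)=2\sqrt{m^*}\Lambda\operatorname{cn}(\Lambda s-K(m^* ),m^* )$ with $\Lambda=2K(m^* )/L$. For an integer $j\geq1$, an immersed $H^2$-curve $\gamma:[a,b]\to\mathbf{R}^n$ is a $j$-leafed elastica if there are $a=a_0<a_1<\dots<a_j=b$ such that each $\gamma|_{[a_{i-1},a_i]}$, $i=1,\dots,j$, is a half-fold figure-eight elastica and all these $j$ pieces have the same length. *)

theory Defs
  imports "HOL-Analysis.Analysis"
begin

text \<open>Throughout, a curve on \<open>[a,b]\<close> is a total function on \<open>real\<close> of which only the values on
  \<open>{a..b}\<close> matter; restricting a curve means changing \<open>a\<close> and \<open>b\<close>.\<close>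

subsection \<open>Weak derivatives and \<open>H\<^sup>2\<close> curves\<close>

definition test_function :: "real \<Rightarrow> real \<Rightarrow> (real \<Rightarrow> real) \<Rightarrow> bool" where
  "test_function a b \<phi> \<longleftrightarrow>
     (\<forall>k x. (deriv ^^ k) \<phi> differentiable (at x)) \<and>
     (\<exists>c d. a < c \<and> d < b \<and> (\<forall>x. x \<notin> {c..d} \<longrightarrow> \<phi> x = 0))"

definition locally_integrable :: "real \<Rightarrow> real \<Rightarrow> (real \<Rightarrow> 'a::euclidean_space) \<Rightarrow> bool" where
  "locally_integrable a b f \<longleftrightarrow> (\<forall>c d. a < c \<and> d < b \<longrightarrow> set_integrable lborel {c..d} f)"

definition square_integrable :: "real \<Rightarrow> real \<Rightarrow> (real \<Rightarrow> 'a::euclidean_space) \<Rightarrow> bool" where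
  "square_integrable a b f \<longleftrightarrow>
     set_borel_measurable lborel {a<..<b} f \<and>
     set_integrable lborel {a<..<b} (\<lambda>x. (norm (f x))\<^sup>2)"

definition has_weak_derivative ::
    "real \<Rightarrow> real \<Rightarrow> (real \<Rightarrow> 'a::euclidean_space) \<Rightarrow> (real \<Rightarrow> 'a) \<Rightarrow> bool" where
  "has_weak_derivative a b f g \<longleftrightarrow>
     locally_integrable a b f \<and> locally_integrable a b g \<and>
     (\<forall>\<phi>. test_function a b \<phi> \<longrightarrow>
        (LBINT x:{a<..<b}. deriv \<phi> x *\<^sub>R f x) = - (LBINT x:{a<..<b}. \<phi> x *\<^sub>R g x))"

text \<open>A representative of the weak derivative; it is determined up to null sets in \<open>{a<..<b}\<close>, and
  is used below only under integrals or almost everywhere.\<close>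

definition weak_derivative ::
    "real \<Rightarrow> real \<Rightarrow> (real \<Rightarrow> 'a::euclidean_space) \<Rightarrow> real \<Rightarrow> 'a" where
  "weak_derivative a b f = (SOME g. has_weak_derivative a b f g)"

definition W22 :: "real \<Rightarrow> real \<Rightarrow> (real \<Rightarrow> 'a::euclidean_space) \<Rightarrow> bool" where
  "W22 a b f \<longleftrightarrow> square_integrable a b f \<and>
     (\<exists>g h. has_weak_derivative a b f g \<and> square_integrable a b g \<and>
            has_weak_derivative a b g h \<and> square_integrable a b h)"

text \<open>Elements of \<open>W\<^sup>2\<^sup>,\<^sup>2(a,b)\<close> are identified with their continuous representative on \<open>[a,b]\<close>. By the
  embedding of \<open>H\<^sup>2\<close> into \<open>C\<^sup>1\<close> it has a classical derivative on \<open>[a,b]\<close> (one-sided at the end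
  points).\<close>

definition H2_curve :: "real \<Rightarrow> real \<Rightarrow> (real \<Rightarrow> 'a::euclidean_space) \<Rightarrow> bool" where
  "H2_curve a b \<gamma> \<longleftrightarrow> a < b \<and> continuous_on {a..b} \<gamma> \<and> W22 a b \<gamma>"

definition velocity :: "real \<Rightarrow> real \<Rightarrow> (real \<Rightarrow> 'a::euclidean_space) \<Rightarrow> real \<Rightarrow> 'a" where
  "velocity a b \<gamma> x = vector_derivative \<gamma> (at x within {a..b})"

definition immersed_H2_curve :: "real \<Rightarrow> real \<Rightarrow> (real \<Rightarrow> 'a::euclidean_space) \<Rightarrow> bool" where
  "immersed_H2_curve a b \<gamma> \<longleftrightarrow> H2_curve a b \<gamma> \<and> (\<forall>x\<in>{a..b}. velocity a b \<gamma> x \<noteq> 0)"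

subsection \<open>Length, curvature, bending energy\<close>

definition arclength :: "real \<Rightarrow> real \<Rightarrow> (real \<Rightarrow> 'a::euclidean_space) \<Rightarrow> real \<Rightarrow> real" where
  "arclength a b \<gamma> x = (LBINT t:{a..x}. norm (velocity a b \<gamma> t))"

definition curve_length :: "real \<Rightarrow> real \<Rightarrow> (real \<Rightarrow> 'a::euclidean_space) \<Rightarrow> real" where
  "curve_length a b \<gamma> = arclength a b \<gamma> b"

text \<open>The operator \<open>\<partial>\<^sub>s = |\<gamma>'|\<^sup>-\<^sup>1 \<partial>\<^sub>x\<close>, with \<open>\<partial>\<^sub>x\<close> the weak derivative, since \<open>\<gamma>'\<close> is in general not
  classically differentiable.\<close>

definition arclength_derivative ::
    "real \<Rightarrow> real \<Rightarrow> (real \<Rightarrow> 'a::euclidean_space) \<Rightarrow> (real \<Rightarrow> 'a) \<Rightarrow> real \<Rightarrow> 'a" where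
  "arclength_derivative a b \<gamma> f x = weak_derivative a b f x /\<^sub>R norm (velocity a b \<gamma> x)"

definition tangent :: "real \<Rightarrow> real \<Rightarrow> (real \<Rightarrow> 'a::euclidean_space) \<Rightarrow> real \<Rightarrow> 'a" where
  "tangent a b \<gamma> = arclength_derivative a b \<gamma> \<gamma>"

definition curvature :: "real \<Rightarrow> real \<Rightarrow> (real \<Rightarrow> 'a::euclidean_space) \<Rightarrow> real \<Rightarrow> 'a" where
  "curvature a b \<gamma> = arclength_derivative a b \<gamma> (tangent a b \<gamma>)"

definition bending_energy :: "real \<Rightarrow> real \<Rightarrow> (real \<Rightarrow> 'a::euclidean_space) \<Rightarrow> real" where
  "bending_energy a b \<gamma> =
     (LBINT x:{a<..<b}. (norm (curvature a b \<gamma> x))\<^sup>2 * norm (velocity a b \<gamma> x))"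

definition normalized_bending_energy :: "real \<Rightarrow> real \<Rightarrow> (real \<Rightarrow> 'a::euclidean_space) \<Rightarrow> real" where
  "normalized_bending_energy a b \<gamma> = curve_length a b \<gamma> * bending_energy a b \<gamma>"

definition has_point_of_multiplicity ::
    "real \<Rightarrow> real \<Rightarrow> (real \<Rightarrow> 'a::euclidean_space) \<Rightarrow> nat \<Rightarrow> bool" where
  "has_point_of_multiplicity a b \<gamma> k \<longleftrightarrow>
     (\<exists>p S. S \<subseteq> {x \<in> {a..b}. \<gamma> x = p} \<and> finite S \<and> card S = k)"

subsection \<open>Elliptic integrals and functions\<close>

definition ellF :: "real \<Rightarrow> real \<Rightarrow> real" where
  "ellF x m = (LBINT \<theta>=ereal 0..ereal x. 1 / sqrt (1 - m * (sin \<theta>)\<^sup>2))"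

definition ellK :: "real \<Rightarrow> real" where
  "ellK m = ellF (pi / 2) m"

definition ellE :: "real \<Rightarrow> real" where
  "ellE m = (LBINT \<theta>=ereal 0..ereal (pi / 2). sqrt (1 - m * (sin \<theta>)\<^sup>2))"

definition jacobi_am :: "real \<Rightarrow> real \<Rightarrow> real" where
  "jacobi_am x m = inv (\<lambda>y. ellF y m) x"

definition jacobi_cn :: "real \<Rightarrow> real \<Rightarrow> real" where
  "jacobi_cn x m = cos (jacobi_am x m)"

definition m_star :: real where
  "m_star = (THE m. 0 < m \<and> m < 1 \<and> ellK m = 2 * ellE m)"

definition varpi_star :: real where
  "varpi_star = 32 * (2 * m_star - 1) * (ellE m_star)\<^sup>2"

subsection \<open>Leafed elasticae\<close>

text \<open>The plane is \<open>p + span {e1, e2}\<close> with \<open>e1, e2\<close> orthonormal. The unit normal is the unit tangent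
  rotated by the right angle taking \<open>e1\<close> to \<open>e2\<close>, and the signed curvature is the component of the
  curvature vector along it.\<close>

definition signed_curvature ::
    "real \<Rightarrow> real \<Rightarrow> (real \<Rightarrow> 'a::euclidean_space) \<Rightarrow> 'a \<Rightarrow> 'a \<Rightarrow> real \<Rightarrow> real" where
  "signed_curvature a b \<gamma> e1 e2 x =
     (let T = tangent a b \<gamma> x; N = (T \<bullet> e1) *\<^sub>R e2 - (T \<bullet> e2) *\<^sub>R e1
      in curvature a b \<gamma> x \<bullet> N)"

definition figure_eight_curvature :: "real \<Rightarrow> real \<Rightarrow> real" where
  "figure_eight_curvature L s =
     (let \<Lambda> = 2 * ellK m_star / L
      in 2 * sqrt m_star * \<Lambda> * jacobi_cn (\<Lambda> * s - ellK m_star) m_star)"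

definition half_fold_figure_eight_elastica ::
    "real \<Rightarrow> real \<Rightarrow> (real \<Rightarrow> 'a::euclidean_space) \<Rightarrow> bool" where
  "half_fold_figure_eight_elastica a b \<gamma> \<longleftrightarrow>
     immersed_H2_curve a b \<gamma> \<and>
     (\<exists>p e1 e2 \<sigma>. norm e1 = 1 \<and> norm e2 = 1 \<and> e1 \<bullet> e2 = 0 \<and>
        (\<forall>x\<in>{a..b}. \<gamma> x - p \<in> span {e1, e2}) \<and>
        \<sigma> \<in> {1, -1} \<and>
        (AE x in lborel. x \<in> {a<..<b} \<longrightarrow>
           signed_curvature a b \<gamma> e1 e2 x =
             \<sigma> * figure_eight_curvature (curve_length a b \<gamma>) (arclength a b \<gamma> x)))"

definition leafed_elastica :: "nat \<Rightarrow> real \<Rightarrow> real \<Rightarrow> (real \<Rightarrow> 'a::euclidean_space) \<Rightarrow> bool" where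
  "leafed_elastica j a b \<gamma> \<longleftrightarrow>
     j \<ge> 1 \<and> immersed_H2_curve a b \<gamma> \<and>
     (\<exists>t :: nat \<Rightarrow> real. t 0 = a \<and> t j = b \<and>
        (\<forall>i<j. t i < t (Suc i) \<and> half_fold_figure_eight_elastica (t i) (t (Suc i)) \<gamma>) \<and>
        (\<forall>i<j. \<forall>l<j. curve_length (t i) (t (Suc i)) \<gamma> = curve_length (t l) (t (Suc l)) \<gamma>))"

end

theory Submission
  imports Defs
begin

text \<open>A leaf is a closed piece of curve. Let \<open>e\<close> be its unit tangent \<open>T\<close> at the midpoint of
  arclength and \<open>y = (1 - T \<bullet> e) / 2 = (sin (\<theta> / 2))\<^sup>2\<close>, where \<open>\<theta>\<close> is the angle between \<open>T\<close> and
  \<open>e\<close>. Closedness gives \<open>\<integral> T \<bullet> e ds = 0\<close>, so a multiple \<open>2 \<Lambda>\<^sup>2 (T \<bullet> e)\<close> may be added to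
  \<open>|\<kappa>|\<^sup>2\<close>, and the two halves of the leaf decouple. On a half where \<open>y\<close> has maximum \<open>m\<close>, the
  inequalities \<open>|\<kappa>|\<^sup>2 + 4 \<Lambda>\<^sup>2 (m - y) \<ge> 4 \<Lambda> |\<kappa>| sqrt (m - y)\<close> and \<open>|y'| \<le> |\<kappa>| sqrt (y (1 - y))\<close>
  bound the energy from below by \<open>8 \<Lambda> W(m) + 2 \<Lambda> (1 - 2 m) K(m\<^sup>*)\<close>, where \<open>W = E - (1 - m) K\<close>. As
  \<open>W\<close> is strictly convex with derivative \<open>K / 2\<close>, this is minimal exactly at \<open>m = m\<^sup>*\<close>, and the
  sum over both halves is then \<open>\<varpi>\<^sup>* / L\<close>. In the case of equality the first inequality becomes the
  first-order equation of the half-fold figure-eight elastica, and the second one makes each half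
  planar. The Cauchy-Schwarz inequality over the \<open>k - 1\<close> leaves between consecutive preimages of the
  multiple point gives the result for \<open>k\<close>.

  No reparametrisation by arclength is needed: the tangent of an \<open>H\<^sup>2\<close> curve is absolutely continuous in
  the given parameter, and the product and chain rules for absolutely continuous functions suffice.\<close>

section \<open>Primitives of integrable functions\<close>

text \<open>The multiplier \<open>2 \<Lambda>\<^sup>2\<close> is the one for which all terms in
  \<open>y\<close> cancel when the square is completed, leaving the constant
  \<open>2 \<Lambda>\<^sup>2 (1 - 2 m)\<close>. The scale \<open>\<Lambda> = 2 K(m_star) / L\<close>
  makes the m-derivative of the bound on a half equal to
  \<open>4 \<Lambda> (K(m) - K(m_star))\<close>. The maximum \<open>m\<close> is unknown, may differ
  between the halves, and may be 1 (reversed tangent), where the integral \<open>K\<close> diverges;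
  hence the care taken at \<open>m = 1\<close>. Since \<open>y\<close> is only absolutely continuous
  and need not be monotone, it cannot serve as a new variable. Instead a function of
  \<open>y\<close> is compared with the energy along one passage of \<open>y\<close> from 0 to
  \<open>m\<close>. In the case of equality, no energy is left before this passage and no length
  after it, so the passage fills the half. Planarity of each half still allows two unrelated normals
  \<open>N\<close> and \<open>M\<close> at the midpoint. Closedness, used a second time for the
  components orthogonal to \<open>e\<close>, gives \<open>N = - M\<close>, and the halves form one
  planar leaf.\<close>

lemma AE_zero_if_interval_integrals_zero:
  fixes u :: "real \<Rightarrow> 'a::euclidean_space"
  assumes u: "set_integrable lborel {a..b} u"
    and zero: "\<And>x y. a \<le> x \<Longrightarrow> x \<le> y \<Longrightarrow> y \<le> b \<Longrightarrow> (LBINT t:{x..y}. u t) = 0"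
  shows "AE x\<in>{a..b} in lborel. u x = 0"
proof -
  let ?v = "\<lambda>x. indicator {a..b} x *\<^sub>R u x"
  have v: "integrable lborel ?v"
    using u by (simp add: set_integrable_def)
  \<comment> \<open>The sets over which \<open>?v\<close> integrates to zero contain the closed
    intervals and are closed under complements and countable disjoint unions, so Borel induction
    reaches every Borel set. Cutting \<open>u\<close> off outside \<open>[a,b]\<close> makes it
    integrable on the line, which the complement case uses.\<close>
  have "AE x in lborel. ?v x = 0"
  proof (rule sigma_finite_measure.density_zero[OF sigma_finite_lborel v])
    fix A :: "real set"
    assume "A \<in> sets lborel"
    then have "A \<in> sets borel" by simp
    then show "(LBINT x:A. ?v x) = 0"
    proof (induction rule: borel_set_induct)
      case empty
      then show ?case by (simp add: set_lebesgue_integral_def)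
    next
      case (interval c d)
      have "(LBINT x:{c..d}. ?v x) = (LBINT x:{max a c..min b d}. u x)"
        unfolding set_lebesgue_integral_def
        by (rule Bochner_Integration.integral_cong) (auto split: split_indicator)
      also have "\<dots> = 0"
      proof (cases "max a c \<le> min b d")
        case True
        then show ?thesis by (intro zero) auto
      next
        case False
        then have "{max a c..min b d} = {}" by auto
        then show ?thesis by (simp add: set_lebesgue_integral_def)
      qed
      finally show ?case .
    next
      case (compl A)
      have i: "set_integrable lborel B ?v" if "B \<in> sets borel" for B
        unfolding set_integrable_def by (rule integrable_mult_indicator[OF _ v]) (use that in simp)
      have "(LBINT x:A \<union> -A. ?v x) = (LBINT x:A. ?v x) + (LBINT x:-A. ?v x)"
        using compl(1) by (intro set_integral_Un i) auto
      moreover have "(LBINT x:A \<union> -A. ?v x) = 0"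
      proof (cases "a \<le> b")
        case True
        have "(LBINT x:A \<union> -A. ?v x) = (LBINT x:{a..b}. u x)"
          by (simp add: set_lebesgue_integral_def)
        with zero[of a b] True show ?thesis by simp
      next
        case False
        then have "{a..b} = {}" by auto
        then show ?thesis by (simp add: set_lebesgue_integral_def)
      qed
      ultimately show ?case using compl by simp
    next
      case (union f)
      have "(LBINT x:(\<Union>i. f i). ?v x) = (\<Sum>i. (LBINT x:f i. ?v x))"
      proof (rule lebesgue_integral_countable_add)
        have "(\<Union>i. f i) \<in> sets lborel" using union(2) by auto
        then show "set_integrable lborel (\<Union>i. f i) ?v"
          unfolding set_integrable_def by (rule integrable_mult_indicator[OF _ v])
        show "f i \<in> sets lborel" for i using union(2) by simp
        show "f i \<inter> f j = {}" if "i \<noteq> j" for i j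
          using union(1) that by (simp add: disjoint_family_on_def)
      qed
      then show ?case using union by simp
    qed
  qed
  then show ?thesis
    by eventually_elim (auto simp: indicator_def)
qed

section \<open>Set integrals under linear and bilinear maps\<close>

lemma set_integral_split:
  fixes f :: "real \<Rightarrow> 'a::euclidean_space"
  assumes "set_integrable lborel {a..b} f" "a \<le> c" "c \<le> b"
  shows "(LBINT t:{a..b}. f t) = (LBINT t:{a..c}. f t) + (LBINT t:{c..b}. f t)"
proof -
  have "set_integrable lborel {a..c} f" "set_integrable lborel {c..b} f"
    using assms by (auto intro: set_integrable_subset)
  with assms show ?thesis
    by (simp add: set_borel_integral_eq_integral Henstock_Kurzweil_Integration.integral_combine)
qed

lemma set_integrable_bounded_linear:
  assumes "bounded_linear T" "set_integrable M A f"
  shows "set_integrable M A (\<lambda>x. T (f x))"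
proof -
  interpret bounded_linear T by fact
  show ?thesis
    using integrable_bounded_linear[OF assms(1), of M "\<lambda>x. indicator A x *\<^sub>R f x"] assms(2)
    by (simp add: set_integrable_def scaleR)
qed

lemma set_integral_bounded_linear:
  fixes f :: "_ \<Rightarrow> 'a::{banach, second_countable_topology}"
    and T :: "'a \<Rightarrow> 'b::{banach, second_countable_topology}"
  assumes "bounded_linear T" "set_integrable M A f"
  shows "(LINT x:A|M. T (f x)) = T (LINT x:A|M. f x)"
proof -
  interpret bounded_linear T by fact
  show ?thesis
    using integral_bounded_linear[OF assms(1), of M "\<lambda>x. indicator A x *\<^sub>R f x"] assms(2)
    by (simp add: set_integrable_def set_lebesgue_integral_def scaleR)
qed

lemma set_integral_norm_le:
  fixes f :: "_ \<Rightarrow> 'a::{banach, second_countable_topology}"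
  assumes "set_integrable M A f" "set_integrable M A g" "\<And>x. x \<in> A \<Longrightarrow> norm (f x) \<le> g x"
  shows "norm (LINT x:A|M. f x) \<le> (LINT x:A|M. g x)"
  using set_integral_norm_bound[OF assms(1)] set_integral_mono[OF set_integrable_norm[OF assms(1)] assms(2,3)]
  by linarith

lemma set_borel_measurable_continuous:
  fixes f :: "real \<Rightarrow> 'a::euclidean_space"
  assumes "continuous_on {a..b} f"
  shows "set_borel_measurable lborel {a..b} f"
  using borel_integrable_atLeastAtMost'[OF assms]
  by (simp add: set_integrable_def set_borel_measurable_def)

lemma set_integrable_imp_measurable:
  "set_integrable M A f \<Longrightarrow> set_borel_measurable M A f"
  by (simp add: set_integrable_def set_borel_measurable_def)

lemma set_borel_measurable_bilinear:
  fixes prod :: "'a::euclidean_space \<Rightarrow> 'b::euclidean_space \<Rightarrow> 'c::euclidean_space"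
  assumes "bounded_bilinear prod"
    and f: "set_borel_measurable M A f" and g: "set_borel_measurable M A g"
  shows "set_borel_measurable M A (\<lambda>x. prod (f x) (g x))"
proof -
  interpret bounded_bilinear prod by fact
  have "(\<lambda>x. prod (indicator A x *\<^sub>R f x) (indicator A x *\<^sub>R g x)) \<in> borel_measurable M"
    using f g unfolding set_borel_measurable_def
    by (rule borel_measurable_continuous_Pair)
       (intro continuous_on continuous_on_fst continuous_on_snd continuous_on_id)
  also have "(\<lambda>x. prod (indicator A x *\<^sub>R f x) (indicator A x *\<^sub>R g x)) =
      (\<lambda>x. indicator A x *\<^sub>R prod (f x) (g x))"
    by (auto simp: fun_eq_iff zero_left zero_right split: split_indicator)
  finally show ?thesis by (simp add: set_borel_measurable_def)
qed

lemma set_integrable_bilinear_continuous: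
  fixes prod :: "'a::euclidean_space \<Rightarrow> 'b::euclidean_space \<Rightarrow> 'c::euclidean_space"
    and a b :: real
  assumes "bounded_bilinear prod"
    and f: "set_integrable lborel {a..b} f" and g: "continuous_on {a..b} g"
  shows "set_integrable lborel {a..b} (\<lambda>x. prod (f x) (g x))"
proof -
  interpret bounded_bilinear prod by fact
  obtain K where K: "K > 0" "\<And>x y. norm (prod x y) \<le> norm x * norm y * K"
    using pos_bounded by blast
  have "bounded (g ` {a..b})"
    using g by (intro compact_imp_bounded compact_continuous_image compact_Icc)
  then obtain C where C: "C > 0" "\<And>x. x \<in> {a..b} \<Longrightarrow> norm (g x) \<le> C"
    unfolding bounded_pos by auto
  show ?thesis
  proof (rule set_integrable_bound)
    show "set_integrable lborel {a..b} (\<lambda>x. (C * K) *\<^sub>R f x)" using f by simp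
    show "set_borel_measurable lborel {a..b} (\<lambda>x. prod (f x) (g x))"
      by (rule set_borel_measurable_bilinear[OF assms(1) set_integrable_imp_measurable[OF f]
            set_borel_measurable_continuous[OF g]])
    have "norm (prod (f x) (g x)) \<le> norm ((C * K) *\<^sub>R f x)" if "x \<in> {a..b}" for x
    proof -
      have "norm (prod (f x) (g x)) \<le> norm (f x) * norm (g x) * K" by (rule K)
      also have "\<dots> \<le> norm (f x) * C * K" using C(2)[OF that] K(1)
        by (intro mult_right_mono mult_left_mono) auto
      finally show ?thesis using C K by (simp add: ac_simps)
    qed
    then show "AE x in lborel. x \<in> {a..b} \<longrightarrow> norm (prod (f x) (g x)) \<le> norm ((C * K) *\<^sub>R f x)"
      by auto
  qed
qed

lemma set_integrable_continuous_bilinear: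
  fixes prod :: "'a::euclidean_space \<Rightarrow> 'b::euclidean_space \<Rightarrow> 'c::euclidean_space"
    and a b :: real
  assumes "bounded_bilinear prod"
    and f: "continuous_on {a..b} f" and g: "set_integrable lborel {a..b} g"
  shows "set_integrable lborel {a..b} (\<lambda>x. prod (f x) (g x))"
  using set_integrable_bilinear_continuous[OF bounded_bilinear.flip[OF assms(1)] g f] .

text \<open>\<open>F\<close> is absolutely continuous on \<open>[a,b]\<close> with derivative \<open>f\<close> almost everywhere.\<close>

definition primitive_on ::
    "real \<Rightarrow> real \<Rightarrow> (real \<Rightarrow> 'a::euclidean_space) \<Rightarrow> (real \<Rightarrow> 'a) \<Rightarrow> bool" where
  "primitive_on a b F f \<longleftrightarrow> set_integrable lborel {a..b} f \<and>
     (\<forall>x y. a \<le> x \<longrightarrow> x \<le> y \<longrightarrow> y \<le> b \<longrightarrow> (LBINT t:{x..y}. f t) = F y - F x)"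

lemma primitive_on_integrable: "primitive_on a b F f \<Longrightarrow> set_integrable lborel {a..b} f"
  by (simp add: primitive_on_def)

lemma primitive_on_integral:
  "primitive_on a b F f \<Longrightarrow> a \<le> x \<Longrightarrow> x \<le> y \<Longrightarrow> y \<le> b \<Longrightarrow> (LBINT t:{x..y}. f t) = F y - F x"
  by (simp add: primitive_on_def)

lemma primitive_onI:
  assumes f: "set_integrable lborel {a..b} f"
    and F: "\<And>x. a \<le> x \<Longrightarrow> x \<le> b \<Longrightarrow> (LBINT t:{a..x}. f t) = F x - F a"
  shows "primitive_on a b F f"
  unfolding primitive_on_def
proof (intro conjI allI impI f)
  fix x y
  assume "a \<le> x" "x \<le> y" "y \<le> b"
  moreover have "set_integrable lborel {a..y} f"
    using \<open>y \<le> b\<close> by (intro set_integrable_subset[OF f]) auto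
  ultimately show "(LBINT t:{x..y}. f t) = F y - F x"
    using set_integral_split[of a y f x] F[of x] F[of y] by simp
qed

lemma primitive_on_subinterval:
  assumes "primitive_on a b F f" "a \<le> a'" "b' \<le> b"
  shows "primitive_on a' b' F f"
  using assms set_integrable_subset[of lborel "{a..b}" f "{a'..b'}"]
  by (auto simp: primitive_on_def)

lemma primitive_on_continuous:
  fixes F :: "real \<Rightarrow> 'a::euclidean_space"
  assumes "primitive_on a b F f"
  shows "continuous_on {a..b} F"
proof -
  have f: "set_integrable lborel {a..b} f" using assms by (simp add: primitive_on_def)
  have "continuous_on {a..b} (\<lambda>x. F a + integral {a..x} f)"
    by (intro continuous_intros indefinite_integral_continuous_1 set_borel_integral_eq_integral f)
  moreover have "F a + integral {a..x} f = F x" if "x \<in> {a..b}" for x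
  proof -
    have "set_integrable lborel {a..x} f" using that by (auto intro: set_integrable_subset[OF f])
    then show ?thesis
      using primitive_on_integral[OF assms, of a x] that by (simp add: set_borel_integral_eq_integral)
  qed
  ultimately show ?thesis by (rule continuous_on_eq) 
qed

lemma primitive_on_unique_AE:
  assumes "primitive_on a b F f" "primitive_on a b F g"
  shows "AE x\<in>{a..b} in lborel. f x = g x"
proof -
  have sub: "set_integrable lborel {x..y} f" "set_integrable lborel {x..y} g"
    if "a \<le> x" "y \<le> b" for x y
    using assms that by (auto simp: primitive_on_def intro!: set_integrable_subset[of lborel "{a..b}"])
  have "AE x\<in>{a..b} in lborel. f x - g x = 0"
  proof (rule AE_zero_if_interval_integrals_zero)
    show "set_integrable lborel {a..b} (\<lambda>x. f x - g x)"
      using assms by (auto simp: primitive_on_def)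
    show "(LBINT t:{x..y}. f t - g t) = 0" if "a \<le> x" "x \<le> y" "y \<le> b" for x y
      using assms that sub[of x y] by (simp add: primitive_on_def)
  qed
  then show ?thesis by simp
qed

text \<open>Since \<open>lborel\<close> is not complete, equality almost everywhere does not
  transfer measurability to \<open>g\<close>, so it is assumed.\<close>

lemma primitive_on_cong_AE:
  assumes F: "primitive_on a b F f" and g: "set_borel_measurable lborel {a..b} g"
    and eq: "AE x\<in>{a..b} in lborel. f x = g x"
  shows "primitive_on a b F g"
proof -
  have f: "set_integrable lborel {a..b} f" using F by (simp add: primitive_on_def)
  have g': "set_integrable lborel {a..b} g"
    by (rule set_integrable_bound[OF f g]) (use eq in auto)
  have "(LBINT t:{x..y}. g t) = F y - F x" if "a \<le> x" "x \<le> y" "y \<le> b" for x y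
  proof -
    have *: "set_integrable lborel {x..y} f" "set_integrable lborel {x..y} g"
      using that by (auto intro: set_integrable_subset[OF f] set_integrable_subset[OF g'])
    have "(LBINT t:{x..y}. f t) = (LBINT t:{x..y}. g t)"
      unfolding set_lebesgue_integral_def
    proof (rule integral_cong_AE)
      show "AE t in lborel. indicator {x..y} t *\<^sub>R f t = indicator {x..y} t *\<^sub>R g t"
        using eq by eventually_elim (use that in \<open>auto simp: indicator_def\<close>)
    qed (use * in \<open>auto simp: set_integrable_def\<close>)
    with F that show ?thesis by (simp add: primitive_on_def)
  qed
  with g' show ?thesis by (auto simp: primitive_on_def)
qed

lemma primitive_on_cong:
  assumes "primitive_on a b F f" "\<And>x. x \<in> {a..b} \<Longrightarrow> F x = G x" "\<And>x. x \<in> {a..b} \<Longrightarrow> f x = g x"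
  shows "primitive_on a b G g"
  unfolding primitive_on_def
proof (intro conjI allI impI)
  show "set_integrable lborel {a..b} g"
    using assms(1,3) set_integrable_cong[of lborel lborel "{a..b}" "{a..b}" f g]
    by (auto simp: primitive_on_def)
  fix x y
  assume "a \<le> x" "x \<le> y" "y \<le> b"
  moreover have "(LBINT t:{x..y}. g t) = (LBINT t:{x..y}. f t)"
    using assms(3) \<open>a \<le> x\<close> \<open>y \<le> b\<close> by (intro set_lebesgue_integral_cong) auto
  ultimately show "(LBINT t:{x..y}. g t) = G y - G x"
    using assms(1,2) by (simp add: primitive_on_def)
qed

lemma primitive_on_FTC:
  assumes "\<And>x. a \<le> x \<Longrightarrow> x \<le> b \<Longrightarrow> (F has_vector_derivative f x) (at x within {a..b})"
    and "continuous_on {a..b} f"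
  shows "primitive_on a b F f"
proof (rule primitive_onI)
  show "set_integrable lborel {a..b} f" by (rule borel_integrable_atLeastAtMost'[OF assms(2)])
  show "(LBINT t:{a..x}. f t) = F x - F a" if "a \<le> x" "x \<le> b" for x
    unfolding set_lebesgue_integral_def using that
    by (intro integral_FTC_atLeastAtMost continuous_on_subset[OF assms(2)])
       (auto intro: has_vector_derivative_within_subset[OF assms(1)])
qed

lemma primitive_on_has_vector_derivative:
  fixes F :: "real \<Rightarrow> 'a::euclidean_space"
  assumes F: "primitive_on a b F f" and f: "continuous_on {a..b} f" and x: "x \<in> {a..b}"
  shows "(F has_vector_derivative f x) (at x within {a..b})"
proof -
  have "((\<lambda>y. F a + integral {a..y} f) has_vector_derivative f x) (at x within {a..b})"
    using integral_has_vector_derivative[OF f, of x] x by (auto intro!: derivative_eq_intros)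
  then show ?thesis
  proof (rule has_vector_derivative_transform[rotated 2])
    fix y assume "y \<in> {a..b}"
    then show "F y = F a + integral {a..y} f"
      using primitive_on_integral[OF F, of a y]
        set_integrable_subset[OF primitive_on_integrable[OF F], of "{a..y}"]
      by (simp add: set_borel_integral_eq_integral)
  qed (use x in auto)
qed

lemma primitive_on_bounded_linear:
  assumes "primitive_on a b F f" "bounded_linear T"
  shows "primitive_on a b (\<lambda>x. T (F x)) (\<lambda>x. T (f x))"
proof -
  interpret bounded_linear T by fact
  have "set_integrable lborel {x..y} f" if "a \<le> x" "y \<le> b" for x y
    using assms(1) that by (auto simp: primitive_on_def intro: set_integrable_subset)
  then show ?thesis
    using assms by (auto simp: primitive_on_def set_integrable_bounded_linear
        set_integral_bounded_linear diff)
qed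

lemma primitive_on_add:
  assumes "primitive_on a b F f" "primitive_on a b G g"
  shows "primitive_on a b (\<lambda>x. F x + G x) (\<lambda>x. f x + g x)"
proof -
  have "set_integrable lborel {x..y} f" "set_integrable lborel {x..y} g" if "a \<le> x" "y \<le> b" for x y
    using assms that
    by (auto simp: primitive_on_def intro: set_integrable_subset[of lborel "{a..b}"])
  then show ?thesis using assms by (auto simp: primitive_on_def)
qed

lemma primitive_on_const: "primitive_on a b (\<lambda>_. c) (\<lambda>_. 0)"
  by (auto simp: primitive_on_def set_integrable_def)

lemma primitive_on_diff:
  assumes "primitive_on a b F f" "primitive_on a b G g"
  shows "primitive_on a b (\<lambda>x. F x - G x) (\<lambda>x. f x - g x)"
  using primitive_on_add[OF assms(1) primitive_on_bounded_linear[OF assms(2) bounded_linear_minus[OF bounded_linear_ident]]]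
  by simp

section \<open>Reflection, product rule and chain rule for primitives\<close>

lemma set_integrable_reflect:
  fixes f :: "real \<Rightarrow> 'a::euclidean_space"
  assumes "set_integrable lborel {a..b} f"
  shows "set_integrable lborel {-b..-a} (\<lambda>x. f (-x))"
proof -
  have "integrable lborel (\<lambda>x. indicator {a..b} (0 + (-1) * x) *\<^sub>R f (0 + (-1) * x))"
    using assms unfolding set_integrable_def by (intro lborel_integrable_real_affine) auto
  moreover have "indicator {a..b} (0 + (-1) * x) = indicat_real {-b..-a} x" for x
    by (auto simp: indicator_def)
  ultimately show ?thesis by (simp add: set_integrable_def)
qed

lemma set_integral_reflect_Icc:
  fixes f :: "real \<Rightarrow> 'a::euclidean_space"
  shows "(LBINT x:{-b..-a}. f (-x)) = (LBINT x:{a..b}. f x)"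
  by (subst (2) set_integral_reflect) (auto intro!: arg_cong2[where f = "set_lebesgue_integral lborel"])

lemma primitive_on_reflect:
  assumes "primitive_on a b F f"
  shows "primitive_on (-b) (-a) (\<lambda>x. F (-x)) (\<lambda>x. - f (-x))"
proof -
  have i: "set_integrable lborel {-b..-a} (\<lambda>x. f (-x))"
    by (rule set_integrable_reflect[OF primitive_on_integrable[OF assms]])
  have "(LBINT t:{x..y}. - f (-t)) = F (-y) - F (-x)" if "-b \<le> x" "x \<le> y" "y \<le> -a" for x y
  proof -
    have "set_integrable lborel {x..y} (\<lambda>x. f (-x))"
      using that by (intro set_integrable_subset[OF i]) auto
    then have "(LBINT t:{x..y}. - f (-t)) = - (LBINT t:{x..y}. f (-t))"
      by (rule set_integral_uminus)
    also have "(LBINT t:{x..y}. f (-t)) = (LBINT t:{-y..-x}. f t)"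
      using set_integral_reflect_Icc[of "-x" "-y" f] by simp
    also have "\<dots> = F (-x) - F (-y)"
      using assms that by (intro primitive_on_integral) auto
    finally show ?thesis by simp
  qed
  moreover have "set_integrable lborel {-b..-a} (\<lambda>x. - f (-x))"
    using set_integrable_bounded_linear[OF bounded_linear_minus[OF bounded_linear_ident] i] .
  ultimately show ?thesis by (simp add: primitive_on_def)
qed

text \<open>The error \<open>e\<close> times the integral of \<open>r\<close> is additive over
  adjacent intervals, so bisection (\<open>Bolzano\<close>) turns the estimate near each point into
  one on the whole interval; then \<open>e\<close> tends to 0.\<close>

lemma primitive_on_localI:
  fixes D :: "real \<Rightarrow> 'a::euclidean_space"
  assumes f: "set_integrable lborel {a..b} f" and r: "set_integrable lborel {a..b} r"
    and local: "\<And>x0 e. x0 \<in> {a..b} \<Longrightarrow> e > 0 \<Longrightarrow>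
      \<exists>d>0. \<forall>x y. a \<le> x \<and> x \<le> x0 \<and> x0 \<le> y \<and> y \<le> b \<and> y - x < d \<longrightarrow>
        norm (D y - D x - (LBINT t:{x..y}. f t)) \<le> e * (LBINT t:{x..y}. r t)"
  shows "primitive_on a b D f"
  unfolding primitive_on_def
proof (intro conjI allI impI f)
  fix p q
  assume pq: "a \<le> p" "p \<le> q" "q \<le> b"
  define P where "P e x y \<longleftrightarrow> (a \<le> x \<and> x \<le> y \<and> y \<le> b \<longrightarrow>
      norm (D y - D x - (LBINT t:{x..y}. f t)) \<le> e * (LBINT t:{x..y}. r t))" for e x y
  have P: "P e p q" if "e > 0" for e
    using \<open>p \<le> q\<close>
  proof (induction rule: Bolzano)
    case (trans x y z)
    show ?case
      unfolding P_def
    proof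
      assume xz: "a \<le> x \<and> x \<le> z \<and> z \<le> b"
      have "set_integrable lborel {x..z} f" "set_integrable lborel {x..z} r"
        using xz by (auto intro: set_integrable_subset[OF f] set_integrable_subset[OF r])
      then have s: "(LBINT t:{x..z}. f t) = (LBINT t:{x..y}. f t) + (LBINT t:{y..z}. f t)"
        "(LBINT t:{x..z}. r t) = (LBINT t:{x..y}. r t) + (LBINT t:{y..z}. r t)"
        using trans by (auto intro!: set_integral_split)
      have "norm (D y - D x - (LBINT t:{x..y}. f t)) \<le> e * (LBINT t:{x..y}. r t)"
        "norm (D z - D y - (LBINT t:{y..z}. f t)) \<le> e * (LBINT t:{y..z}. r t)"
        using trans xz by (auto simp: P_def)
      moreover have "D z - D x - (LBINT t:{x..z}. f t) =
          (D y - D x - (LBINT t:{x..y}. f t)) + (D z - D y - (LBINT t:{y..z}. f t))"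
        by (simp add: s)
      ultimately show "norm (D z - D x - (LBINT t:{x..z}. f t)) \<le> e * (LBINT t:{x..z}. r t)"
        unfolding s(2) by (metis add_mono distrib_left norm_triangle_le)
    qed
  next
    case (local x0)
    then obtain d where "d > 0" "\<And>x y. a \<le> x \<and> x \<le> x0 \<and> x0 \<le> y \<and> y \<le> b \<and> y - x < d \<Longrightarrow>
        norm (D y - D x - (LBINT t:{x..y}. f t)) \<le> e * (LBINT t:{x..y}. r t)"
      using assms(3)[of x0 e] \<open>e > 0\<close> pq by auto
    then show ?case by (auto simp: P_def)
  qed
  have "norm (D q - D p - (LBINT t:{p..q}. f t)) \<le> 0"
  proof (rule tendsto_lowerbound)
    show "((\<lambda>e. e * (LBINT t:{p..q}. r t)) \<longlongrightarrow> 0) (at_right 0)"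
      by (auto intro!: tendsto_eq_intros)
    show "\<forall>\<^sub>F e in at_right 0. norm (D q - D p - (LBINT t:{p..q}. f t)) \<le> e * (LBINT t:{p..q}. r t)"
      using P pq by (auto simp: P_def intro!: eventually_at_right_less[THEN eventually_mono])
  qed simp
  then show "(LBINT t:{p..q}. f t) = D q - D p" by simp
qed

text \<open>The increment of the product splits exactly into
  \<open>prod (F y - F x) (G y) + prod (F x) (G y - G x)\<close>. Writing both differences as
  integrals reproduces the claimed derivative with one factor frozen, and continuity of
  \<open>F\<close> and \<open>G\<close> bounds the cost of freezing it.\<close>

lemma primitive_on_bilinear:
  fixes prod :: "'a::euclidean_space \<Rightarrow> 'b::euclidean_space \<Rightarrow> 'c::euclidean_space"
  assumes "bounded_bilinear prod" and F: "primitive_on a b F f" and G: "primitive_on a b G g"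
  shows "primitive_on a b (\<lambda>x. prod (F x) (G x)) (\<lambda>x. prod (f x) (G x) + prod (F x) (g x))"
proof (rule primitive_on_localI)
  interpret bounded_bilinear prod by fact
  have f: "set_integrable lborel {a..b} f" and g: "set_integrable lborel {a..b} g"
    using F G by (auto simp: primitive_on_def)
  note cF = primitive_on_continuous[OF F] and cG = primitive_on_continuous[OF G]
  have i1: "set_integrable lborel {a..b} (\<lambda>x. prod (f x) (G x))"
    by (rule set_integrable_bilinear_continuous[OF assms(1) f cG])
  have i2: "set_integrable lborel {a..b} (\<lambda>x. prod (F x) (g x))"
    by (rule set_integrable_continuous_bilinear[OF assms(1) cF g])
  show "set_integrable lborel {a..b} (\<lambda>x. prod (f x) (G x) + prod (F x) (g x))"
    using i1 i2 by simp
  let ?r = "\<lambda>x. norm (f x) + norm (g x)"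
  show r: "set_integrable lborel {a..b} ?r"
    using f g by (intro set_integral_add set_integrable_norm)
  obtain K where K: "K > 0" "\<And>x y. norm (prod x y) \<le> norm x * norm y * K"
    using pos_bounded by blast
  fix x0 e :: real
  assume x0: "x0 \<in> {a..b}" and e: "e > 0"
  \<comment> \<open>Two values on a short interval around \<open>x0\<close> differ by at most
    \<open>2 * e'\<close>, and \<open>prod\<close> has the bound \<open>K\<close>; together they
    give \<open>2 * e' * K = e\<close>.\<close>
  define e' where "e' = e / (2 * K)"
  have e': "e' > 0" using e K by (simp add: e'_def)
  obtain d1 where d1: "d1 > 0" "\<And>t. t \<in> {a..b} \<Longrightarrow> dist t x0 < d1 \<Longrightarrow> dist (F t) (F x0) < e'"
    using cF x0 e' unfolding continuous_on_iff by metis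
  obtain d2 where d2: "d2 > 0" "\<And>t. t \<in> {a..b} \<Longrightarrow> dist t x0 < d2 \<Longrightarrow> dist (G t) (G x0) < e'"
    using cG x0 e' unfolding continuous_on_iff by metis
  show "\<exists>d>0. \<forall>x y. a \<le> x \<and> x \<le> x0 \<and> x0 \<le> y \<and> y \<le> b \<and> y - x < d \<longrightarrow>
        norm (prod (F y) (G y) - prod (F x) (G x) - (LBINT t:{x..y}. prod (f t) (G t) + prod (F t) (g t)))
          \<le> e * (LBINT t:{x..y}. ?r t)"
  proof (intro exI[of _ "min d1 d2"] conjI allI impI)
    fix x y
    assume xy: "a \<le> x \<and> x \<le> x0 \<and> x0 \<le> y \<and> y \<le> b \<and> y - x < min d1 d2"
    have sub: "set_integrable lborel {x..y} h" if "set_integrable lborel {a..b} h" for h :: "real \<Rightarrow> 'd::euclidean_space"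
      using xy by (intro set_integrable_subset[OF that]) auto
    have dF: "norm (F x - F t) \<le> 2 * e'" and dG: "norm (G y - G t) \<le> 2 * e'" if "t \<in> {x..y}" for t
    proof -
      have "dist (F x) (F x0) < e'" "dist (F t) (F x0) < e'" "dist (G y) (G x0) < e'" "dist (G t) (G x0) < e'"
        using d1(2)[of x] d1(2)[of t] d2(2)[of y] d2(2)[of t] xy that by (auto simp: dist_real_def)
      then show "norm (F x - F t) \<le> 2 * e'" "norm (G y - G t) \<le> 2 * e'"
        using dist_triangle2[of "F x" "F t" "F x0"] dist_triangle2[of "G y" "G t" "G x0"]
        by (auto simp: dist_norm)
    qed
    have j1: "set_integrable lborel {x..y} (\<lambda>t. prod (f t) (G y))"
      by (rule set_integrable_bounded_linear[OF bounded_linear_left sub[OF f]])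
    have j2: "set_integrable lborel {x..y} (\<lambda>t. prod (F x) (g t))"
      by (rule set_integrable_bounded_linear[OF bounded_linear_right sub[OF g]])
    have "prod (F y) (G y) - prod (F x) (G x) = prod (F y - F x) (G y) + prod (F x) (G y - G x)"
      by (simp add: diff_left diff_right)
    also have "F y - F x = (LBINT t:{x..y}. f t)" using F xy by (simp add: primitive_on_def)
    also have "G y - G x = (LBINT t:{x..y}. g t)" using G xy by (simp add: primitive_on_def)
    also have "prod (LBINT t:{x..y}. f t) (G y) = (LBINT t:{x..y}. prod (f t) (G y))"
      by (rule set_integral_bounded_linear[symmetric, OF bounded_linear_left sub[OF f]])
    also have "prod (F x) (LBINT t:{x..y}. g t) = (LBINT t:{x..y}. prod (F x) (g t))"
      by (rule set_integral_bounded_linear[symmetric, OF bounded_linear_right sub[OF g]])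
    finally have "prod (F y) (G y) - prod (F x) (G x) - (LBINT t:{x..y}. prod (f t) (G t) + prod (F t) (g t)) =
      (LBINT t:{x..y}. (prod (f t) (G y) + prod (F x) (g t)) - (prod (f t) (G t) + prod (F t) (g t)))"
      using j1 j2 sub[OF i1] sub[OF i2] by simp
    also have "norm \<dots> \<le> (LBINT t:{x..y}. e * ?r t)"
    proof (rule set_integral_norm_le)
      show "set_integrable lborel {x..y} (\<lambda>t. (prod (f t) (G y) + prod (F x) (g t)) - (prod (f t) (G t) + prod (F t) (g t)))"
        using j1 j2 sub[OF i1] sub[OF i2] by simp
      show "set_integrable lborel {x..y} (\<lambda>t. e * ?r t)"
        using sub[OF r] by simp
      fix t assume t: "t \<in> {x..y}"
      have "norm ((prod (f t) (G y) + prod (F x) (g t)) - (prod (f t) (G t) + prod (F t) (g t)))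
        = norm (prod (f t) (G y - G t) + prod (F x - F t) (g t))"
        by (simp add: diff_left diff_right algebra_simps)
      also have "\<dots> \<le> norm (f t) * norm (G y - G t) * K + norm (F x - F t) * norm (g t) * K"
        by (intro norm_triangle_le add_mono K)
      also have "\<dots> \<le> norm (f t) * (2 * e') * K + (2 * e') * norm (g t) * K"
        using dF[OF t] dG[OF t] K(1)
        by (intro add_mono mult_right_mono mult_left_mono) auto
      also have "\<dots> = e * ?r t" using K by (simp add: e'_def field_simps)
      finally show "norm ((prod (f t) (G y) + prod (F x) (g t)) - (prod (f t) (G t) + prod (F t) (g t))) \<le> e * ?r t" .
    qed
    also have "\<dots> = e * (LBINT t:{x..y}. ?r t)" by simp
    finally show "norm (prod (F y) (G y) - prod (F x) (G x) - (LBINT t:{x..y}. prod (f t) (G t) + prod (F t) (g t)))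
          \<le> e * (LBINT t:{x..y}. ?r t)" .
  qed (use d1 d2 in auto)
qed

text \<open>Near \<open>x0\<close> there are three errors, each at most \<open>e / 3\<close> times
  the variation of \<open>q\<close>: the linearisation of \<open>\<Phi>\<close> at
  \<open>q x0\<close> used at either end of the interval, and the replacement of
  \<open>\<Phi>' (q t)\<close> by \<open>\<Phi>' (q x0)\<close>.\<close>

lemma primitive_on_chain:
  fixes q :: "real \<Rightarrow> real" and \<Phi> :: "real \<Rightarrow> real"
  assumes Q: "primitive_on a b q q'" and S: "q ` {a..b} \<subseteq> S"
    and der: "\<And>z. z \<in> S \<Longrightarrow> (\<Phi> has_real_derivative \<Phi>' z) (at z within S)"
    and cont: "continuous_on S \<Phi>'"
  shows "primitive_on a b (\<lambda>x. \<Phi> (q x)) (\<lambda>x. \<Phi>' (q x) * q' x)"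
proof (rule primitive_on_localI)
  have q': "set_integrable lborel {a..b} q'" using Q by (simp add: primitive_on_def)
  note cq = primitive_on_continuous[OF Q]
  have c: "continuous_on {a..b} (\<lambda>x. \<Phi>' (q x))"
    by (rule continuous_on_compose2[OF cont cq S])
  show i: "set_integrable lborel {a..b} (\<lambda>x. \<Phi>' (q x) * q' x)"
    by (rule set_integrable_continuous_bilinear[OF bounded_bilinear_mult c q'])
  show r: "set_integrable lborel {a..b} (\<lambda>x. \<bar>q' x\<bar>)"
    by (rule set_integrable_abs[OF q'])
  fix x0 e :: real
  assume x0: "x0 \<in> {a..b}" and e: "e > 0"
  have "q x0 \<in> S" using x0 S by auto
  from der[OF this] obtain d1 where d1: "d1 > 0" "\<And>z. z \<in> S \<Longrightarrow> \<bar>z - q x0\<bar> < d1 \<Longrightarrow>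
     \<bar>\<Phi> z - \<Phi> (q x0) - \<Phi>' (q x0) * (z - q x0)\<bar> \<le> e / 3 * \<bar>z - q x0\<bar>"
    unfolding has_field_derivative_def has_derivative_within_alt using e
    by (auto dest!: spec[of _ "e/3"])
  obtain d2 where d2: "d2 > 0" "\<And>t. t \<in> {a..b} \<Longrightarrow> dist t x0 < d2 \<Longrightarrow> dist (q t) (q x0) < d1"
    using cq x0 d1(1) unfolding continuous_on_iff by metis
  have "e / 3 > 0" using e by simp
  then obtain d3 where d3: "d3 > 0" "\<And>t. t \<in> {a..b} \<Longrightarrow> dist t x0 < d3 \<Longrightarrow> dist (\<Phi>' (q t)) (\<Phi>' (q x0)) < e / 3"
    using c x0 unfolding continuous_on_iff by metis
  show "\<exists>d>0. \<forall>x y. a \<le> x \<and> x \<le> x0 \<and> x0 \<le> y \<and> y \<le> b \<and> y - x < d \<longrightarrow>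
        norm (\<Phi> (q y) - \<Phi> (q x) - (LBINT t:{x..y}. \<Phi>' (q t) * q' t)) \<le> e * (LBINT t:{x..y}. \<bar>q' t\<bar>)"
  proof (intro exI[of _ "min d2 d3"] conjI allI impI)
    fix x y
    assume xy: "a \<le> x \<and> x \<le> x0 \<and> x0 \<le> y \<and> y \<le> b \<and> y - x < min d2 d3"
    have sub: "set_integrable lborel {x..y} h" if "set_integrable lborel {a..b} h" for h :: "real \<Rightarrow> real"
      using xy by (intro set_integrable_subset[OF that]) auto
    have subxy: "set_integrable lborel {s..t} h" if "set_integrable lborel {a..b} h" "a \<le> s" "t \<le> b" for h :: "real \<Rightarrow> real" and s t
      using that by (intro set_integrable_subset[OF that(1)]) auto
    have nn: "(LBINT t:{s..t}. \<bar>q' t\<bar>) \<ge> 0" for s t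
      unfolding set_lebesgue_integral_def by (intro integral_nonneg_AE) auto
    have split: "(LBINT t:{x..y}. \<bar>q' t\<bar>) = (LBINT t:{x..x0}. \<bar>q' t\<bar>) + (LBINT t:{x0..y}. \<bar>q' t\<bar>)"
      using xy by (intro set_integral_split sub r) auto
    have qd: "\<bar>q t - q s\<bar> \<le> (LBINT t:{s..t}. \<bar>q' t\<bar>)" if "a \<le> s" "s \<le> t" "t \<le> b" for s t
      using set_integral_norm_bound[OF subxy[OF q' that(1,3)]] primitive_on_integral[OF Q that] by simp
    define I where "I = (LBINT t:{x..y}. \<bar>q' t\<bar>)"
    have A: "\<bar>\<Phi> (q y) - \<Phi> (q x0) - \<Phi>' (q x0) * (q y - q x0)\<bar> \<le> e / 3 * \<bar>q y - q x0\<bar>"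
      by (rule d1(2)) (use S xy d2(2)[of y] in \<open>auto simp: dist_real_def\<close>)
    have B: "\<bar>\<Phi> (q x) - \<Phi> (q x0) - \<Phi>' (q x0) * (q x - q x0)\<bar> \<le> e / 3 * \<bar>q x - q x0\<bar>"
      by (rule d1(2)) (use S xy d2(2)[of x] in \<open>auto simp: dist_real_def\<close>)
    have "\<bar>q y - q x0\<bar> \<le> I" "\<bar>q x - q x0\<bar> \<le> I"
      using qd[of x0 y] qd[of x x0] nn[of x x0] nn[of x0 y] split xy
      by (auto simp: I_def abs_minus_commute)
    then have A': "\<bar>\<Phi> (q y) - \<Phi> (q x0) - \<Phi>' (q x0) * (q y - q x0)\<bar> \<le> e / 3 * I"
      and B': "\<bar>\<Phi> (q x) - \<Phi> (q x0) - \<Phi>' (q x0) * (q x - q x0)\<bar> \<le> e / 3 * I"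
      using order_trans[OF A mult_left_mono[of _ I "e/3"]] order_trans[OF B mult_left_mono[of _ I "e/3"]] e by auto
    have "\<Phi>' (q x0) * (q y - q x) - (LBINT t:{x..y}. \<Phi>' (q t) * q' t) =
       (LBINT t:{x..y}. \<Phi>' (q x0) * q' t - \<Phi>' (q t) * q' t)"
      using sub[OF q'] sub[OF i] xy primitive_on_integral[OF Q, of x y] by simp
    also have "\<bar>\<dots>\<bar> \<le> (LBINT t:{x..y}. e / 3 * \<bar>q' t\<bar>)"
      unfolding real_norm_def[symmetric]
    proof (rule set_integral_norm_le)
      show "set_integrable lborel {x..y} (\<lambda>t. \<Phi>' (q x0) * q' t - \<Phi>' (q t) * q' t)"
        using sub[OF q'] sub[OF i] by simp
      show "set_integrable lborel {x..y} (\<lambda>t. e / 3 * norm (q' t))"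
        using sub[OF r] by simp
      fix t assume t: "t \<in> {x..y}"
      have "dist (\<Phi>' (q t)) (\<Phi>' (q x0)) < e / 3"
        using t xy by (intro d3(2)) (auto simp: dist_real_def abs_minus_commute)
      then have "\<bar>\<Phi>' (q x0) - \<Phi>' (q t)\<bar> * \<bar>q' t\<bar> \<le> e / 3 * \<bar>q' t\<bar>"
        by (intro mult_right_mono) (auto simp: dist_real_def abs_minus_commute)
      then show "norm (\<Phi>' (q x0) * q' t - \<Phi>' (q t) * q' t) \<le> e / 3 * norm (q' t)"
        by (simp add: abs_mult[symmetric] left_diff_distrib)
    qed
    also have "\<dots> = e / 3 * I" by (simp add: I_def)
    finally have C: "\<bar>\<Phi>' (q x0) * (q y - q x) - (LBINT t:{x..y}. \<Phi>' (q t) * q' t)\<bar> \<le> e / 3 * I" .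
    have "\<Phi> (q y) - \<Phi> (q x) - (LBINT t:{x..y}. \<Phi>' (q t) * q' t) =
       (\<Phi> (q y) - \<Phi> (q x0) - \<Phi>' (q x0) * (q y - q x0)) -
       (\<Phi> (q x) - \<Phi> (q x0) - \<Phi>' (q x0) * (q x - q x0)) +
       (\<Phi>' (q x0) * (q y - q x) - (LBINT t:{x..y}. \<Phi>' (q t) * q' t))"
      by (simp add: algebra_simps)
    then show "norm (\<Phi> (q y) - \<Phi> (q x) - (LBINT t:{x..y}. \<Phi>' (q t) * q' t)) \<le> e * (LBINT t:{x..y}. \<bar>q' t\<bar>)"
      using A' B' C unfolding I_def[symmetric] real_norm_def by linarith
  qed (use d2 d3 in auto)
qed

section \<open>Weak derivatives and primitives\<close>

lemma set_integrable_Ioo_Icc: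
  fixes f :: "real \<Rightarrow> 'a::{banach, second_countable_topology}"
  shows "set_integrable lborel {a<..<b} f \<longleftrightarrow> set_integrable lborel {a..b} f"
  by (rule set_integrable_discrete_difference[where X = "{a, b}"]) auto

lemma set_integral_Ioo_Icc:
  fixes f :: "real \<Rightarrow> 'a::{banach, second_countable_topology}"
  shows "(LBINT x:{a<..<b}. f x) = (LBINT x:{a..b}. f x)"
  by (rule set_integral_discrete_difference[where X = "{a, b}"]) auto

lemma AE_Ioo_Icc:
  fixes a b :: real
  shows "(AE x\<in>{a<..<b} in lborel. P x) \<longleftrightarrow> (AE x\<in>{a..b} in lborel. P x)"
proof
  assume "AE x\<in>{a<..<b} in lborel. P x"
  with AE_lborel_singleton[of a] AE_lborel_singleton[of b] show "AE x\<in>{a..b} in lborel. P x"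
    by eventually_elim auto
qed (auto elim: eventually_mono)

lemma AE_Ioo_if_AE_Icc:
  fixes a b :: real
  assumes "\<And>c d. a < c \<Longrightarrow> d < b \<Longrightarrow> AE x\<in>{c..d} in lborel. P x"
  shows "AE x\<in>{a<..<b} in lborel. P x"
proof -
  have "AE x in lborel. \<forall>n::nat. x \<in> {a + 1 / (real n + 1)..b - 1 / (real n + 1)} \<longrightarrow> P x"
    unfolding AE_all_countable
    by (intro allI assms) (auto simp: field_simps)
  then show ?thesis
  proof eventually_elim
    case (elim x)
    show ?case
    proof
      assume x: "x \<in> {a<..<b}"
      then have "0 < min (x - a) (b - x)" by auto
      then obtain n where "inverse (real (Suc n)) < min (x - a) (b - x)"
        using reals_Archimedean by blast
      then have "x \<in> {a + 1 / (real n + 1)..b - 1 / (real n + 1)}"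
        by (auto simp: inverse_eq_divide add.commute)
      with elim show "P x" by blast
    qed
  qed
qed

lemma continuous_AE_eq_imp_eq:
  fixes f g :: "real \<Rightarrow> 'a::euclidean_space"
  assumes f: "continuous_on {a..b} f" and g: "continuous_on {a..b} g" and "a < b"
    and eq: "AE x\<in>{a<..<b} in lborel. f x = g x" and x: "x \<in> {a..b}"
  shows "f x = g x"
proof (rule ccontr)
  assume neq: "f x \<noteq> g x"
  have "continuous_on {a..b} (\<lambda>x. f x - g x)" using f g by (intro continuous_intros)
  then obtain d where d: "d > 0" "\<And>t. t \<in> {a..b} \<Longrightarrow> dist t x < d \<Longrightarrow> dist (f t - g t) (f x - g x) < norm (f x - g x)"
    using x neq unfolding continuous_on_iff by (metis right_minus_eq zero_less_norm_iff)
  define l r where "l = max a (x - d)" and "r = min b (x + d)"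
  have "l < r" using d(1) x \<open>a < b\<close> by (auto simp: l_def r_def)
  have ne: "f t \<noteq> g t" if "t \<in> {l<..<r}" for t
  proof -
    have "dist t x < d" "t \<in> {a..b}" using that by (auto simp: l_def r_def dist_real_def abs_less_iff)
    then have "dist (f t - g t) (f x - g x) < norm (f x - g x)" by (intro d(2))
    then show ?thesis by (auto simp: dist_norm norm_minus_commute)
  qed
  have "AE t in lborel. t \<notin> {l<..<r}"
    using eq by eventually_elim (use ne in \<open>auto simp: l_def r_def\<close>)
  then have "{l<..<r} \<in> null_sets lborel"
    by (subst (asm) AE_iff_null_sets[symmetric]) auto
  then have "emeasure lborel {l<..<r} = 0" by auto
  with \<open>l < r\<close> show False by simp
qed

section \<open>Smooth bump functions\<close>

fun times_differentiable :: "nat \<Rightarrow> (real \<Rightarrow> real) \<Rightarrow> bool" where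
  "times_differentiable 0 f \<longleftrightarrow> True"
| "times_differentiable (Suc n) f \<longleftrightarrow>
     (\<forall>x. (f has_real_derivative deriv f x) (at x)) \<and> times_differentiable n (deriv f)"

lemma times_differentiable_SucI:
  assumes "\<And>x. (f has_real_derivative f' x) (at x)" "times_differentiable n f'"
  shows "times_differentiable (Suc n) f"
proof -
  have "deriv f = f'" using assms(1) DERIV_imp_deriv by blast
  with assms show ?thesis by auto
qed

lemma times_differentiable_imp_differentiable:
  "times_differentiable (Suc n) f \<Longrightarrow> (deriv ^^ n) f differentiable at x"
proof (induction n arbitrary: f)
  case 0
  then show ?case by (auto simp: real_differentiable_def)
next
  case (Suc n)
  then show ?case by (simp add: funpow_Suc_right del: funpow.simps)
qed

lemma differentiable_imp_times_differentiable:
  "(\<And>k x. (deriv ^^ k) f differentiable at x) \<Longrightarrow> times_differentiable n f"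
proof (induction n arbitrary: f)
  case (Suc n)
  have "(deriv ^^ k) (deriv f) differentiable at x" for k x
    using Suc.prems[of "Suc k" x] by (simp add: funpow_Suc_right del: funpow.simps)
  moreover have "(f has_real_derivative deriv f x) (at x)" for x
    using Suc.prems[of 0 x] by (simp add: DERIV_deriv_iff_real_differentiable)
  ultimately show ?case using Suc.IH by auto
qed simp

lemma times_differentiable_lower: "times_differentiable (Suc n) f \<Longrightarrow> times_differentiable n f"
  by (induction n arbitrary: f) auto

lemma times_differentiable_const: "times_differentiable n (\<lambda>_. c)"
proof (induction n arbitrary: c)
  case (Suc n)
  then show ?case by (intro times_differentiable_SucI[of _ "\<lambda>_. 0"]) auto
qed simp

lemma times_differentiable_add:
  "times_differentiable n f \<Longrightarrow> times_differentiable n g \<Longrightarrow> times_differentiable n (\<lambda>x. f x + g x)"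
proof (induction n arbitrary: f g)
  case (Suc n)
  then show ?case
    by (intro times_differentiable_SucI[of _ "\<lambda>x. deriv f x + deriv g x"])
       (auto intro!: derivative_eq_intros)
qed simp

lemma times_differentiable_mult:
  "times_differentiable n f \<Longrightarrow> times_differentiable n g \<Longrightarrow> times_differentiable n (\<lambda>x. f x * g x)"
proof (induction n arbitrary: f g)
  case (Suc n)
  show ?case
  proof (rule times_differentiable_SucI)
    show "((\<lambda>x. f x * g x) has_real_derivative deriv f x * g x + f x * deriv g x) (at x)" for x
      using Suc.prems by (auto intro!: derivative_eq_intros)
    show "times_differentiable n (\<lambda>x. deriv f x * g x + f x * deriv g x)"
      using Suc.prems times_differentiable_lower[OF Suc.prems(1)] times_differentiable_lower[OF Suc.prems(2)]
      by (intro times_differentiable_add Suc.IH) auto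
  qed
qed simp

lemma times_differentiable_affine:
  "times_differentiable n f \<Longrightarrow> times_differentiable n (\<lambda>x. f (p * x + q))"
proof (induction n arbitrary: f)
  case (Suc n)
  show ?case
  proof (rule times_differentiable_SucI)
    fix x
    have "(f has_real_derivative deriv f (p * x + q)) (at (p * x + q))"
      using Suc.prems by auto
    moreover have "((\<lambda>x. p * x + q) has_real_derivative p) (at x)"
      by (auto intro!: derivative_eq_intros)
    ultimately show "((\<lambda>x. f (p * x + q)) has_real_derivative deriv f (p * x + q) * p) (at x)"
      by (rule DERIV_chain2)
    show "times_differentiable n (\<lambda>x. deriv f (p * x + q) * p)"
      using Suc.prems by (auto intro: times_differentiable_mult[OF Suc.IH times_differentiable_const])
  qed
qed simp

text \<open>The functions \<open>p (1 / x) exp (- 1 / x)\<close> with a polynomial \<open>p\<close> form a family closed under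
  differentiation.\<close>

definition flat_exp :: "real poly \<Rightarrow> real \<Rightarrow> real" where
  "flat_exp p x = (if x > 0 then poly p (1 / x) * exp (- 1 / x) else 0)"

lemma poly_times_exp_minus_tendsto_0:
  "((\<lambda>z. poly p z * exp (- z)) \<longlongrightarrow> (0::real)) at_top"
proof -
  have "((\<lambda>z. \<Sum>i\<le>degree p. coeff p i * (z ^ i / exp z)) \<longlongrightarrow> (0::real)) at_top"
    by (intro tendsto_null_sum tendsto_mult_right_zero tendsto_power_div_exp_0)
  then show ?thesis
    by (simp add: poly_altdef sum_divide_distrib exp_minus field_simps)
qed

text \<open>Away from 0 this is the chain rule: differentiating
  \<open>p (1 / x) exp (- 1 / x)\<close> gives the factor \<open>1 / x\<^sup>2\<close> times
  \<open>p - p'\<close> at \<open>1 / x\<close>, and \<open>[:0, 0, 1:]\<close> is the polynomial of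
  that factor. At 0 the right-hand difference quotient becomes, with \<open>z = 1 / x\<close>, a
  polynomial in \<open>z\<close> times \<open>exp (- z)\<close>, which tends to 0.\<close>

lemma flat_exp_has_derivative:
  "(flat_exp p has_real_derivative flat_exp ([:0, 0, 1:] * (p - pderiv p)) x) (at x)"
proof (cases x "0 :: real" rule: linorder_cases)
  case less
  have "((\<lambda>_. 0) has_real_derivative 0) (at x)" by simp
  then have "(flat_exp p has_real_derivative 0) (at x)"
    by (rule has_field_derivative_transform_within_open[where S = "{..<0}"])
       (use less in \<open>auto simp: flat_exp_def\<close>)
  with less show ?thesis by (simp add: flat_exp_def)
next
  case greater
  have "((\<lambda>x. poly p (1 / x) * exp (- 1 / x)) has_real_derivative
      poly ([:0, 0, 1:] * (p - pderiv p)) (1 / x) * exp (- 1 / x)) (at x)"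
  proof -
    have "((\<lambda>x. poly p (1 / x)) has_real_derivative poly (pderiv p) (1 / x) * (- (1 / x\<^sup>2))) (at x)"
      using greater
      by (intro DERIV_chain2[where f = "poly p"] poly_DERIV) (auto intro!: derivative_eq_intros simp: power2_eq_square)
    moreover have "((\<lambda>x. exp (- 1 / x)) has_real_derivative exp (- 1 / x) * (1 / x\<^sup>2)) (at x)"
      using greater by (auto intro!: derivative_eq_intros simp: power2_eq_square)
    ultimately have "((\<lambda>x. poly p (1 / x) * exp (- 1 / x)) has_real_derivative
        poly (pderiv p) (1 / x) * (- (1 / x\<^sup>2)) * exp (- 1 / x) + exp (- 1 / x) * (1 / x\<^sup>2) * poly p (1 / x)) (at x)"
      by (rule DERIV_mult)
    then show ?thesis
      by (rule DERIV_cong) (simp add: algebra_simps power2_eq_square)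
  qed
  then have "(flat_exp p has_real_derivative poly ([:0, 0, 1:] * (p - pderiv p)) (1 / x) * exp (- 1 / x)) (at x)"
    by (rule has_field_derivative_transform_within_open[where S = "{0<..}"])
       (use greater in \<open>auto simp: flat_exp_def\<close>)
  with greater show ?thesis by (simp add: flat_exp_def)
next
  case equal
  have "((\<lambda>y. flat_exp p y / y) \<longlongrightarrow> 0) (at 0)"
  proof (rule filterlim_split_at)
    have "\<forall>\<^sub>F y in at_left 0. 0 = flat_exp p y / y"
      by (auto simp: eventually_at_filter flat_exp_def)
    then show "((\<lambda>y. flat_exp p y / y) \<longlongrightarrow> 0) (at_left 0)"
      by (rule Lim_transform_eventually[rotated]) simp
    have "\<forall>\<^sub>F z in at_top. poly ([:0, 1:] * p) z * exp (- z) = flat_exp p (inverse z) / inverse z"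
      using eventually_gt_at_top[of "0::real"]
      by eventually_elim (auto simp: flat_exp_def field_simps)
    then have "((\<lambda>z. flat_exp p (inverse z) / inverse z) \<longlongrightarrow> 0) at_top"
      by (rule Lim_transform_eventually[OF poly_times_exp_minus_tendsto_0])
    then show "((\<lambda>y. flat_exp p y / y) \<longlongrightarrow> 0) (at_right 0)"
      by (simp add: filterlim_at_right_to_top)
  qed
  then show ?thesis
    unfolding equal has_field_derivative_iff by (simp add: flat_exp_def)
qed

lemma times_differentiable_flat_exp: "times_differentiable n (flat_exp p)"
proof (induction n arbitrary: p)
  case (Suc n)
  then show ?case by (intro times_differentiable_SucI[OF flat_exp_has_derivative])
qed simp

text \<open>On \<open>(c,d)\<close> and for \<open>n > 0\<close> this is
  \<open>exp (- 1 / (n (t - c))) * exp (- 1 / (n (d - t)))\<close>. The factor \<open>n\<close>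
  drives both exponents to 0, so the bumps approach the indicator of the interval off its end
  points. The arguments are spelled as \<open>p * t + q\<close> to fit
  \<open>times_differentiable_affine\<close>.\<close>

definition bump :: "nat \<Rightarrow> real \<Rightarrow> real \<Rightarrow> real \<Rightarrow> real" where
  "bump n c d t = flat_exp 1 (real n * t + - real n * c) * flat_exp 1 (- real n * t + real n * d)"

lemma times_differentiable_bump: "times_differentiable k (bump n c d)"
  unfolding bump_def
  by (rule times_differentiable_mult[OF times_differentiable_affine[OF times_differentiable_flat_exp]
        times_differentiable_affine[OF times_differentiable_flat_exp]])

lemma continuous_on_bump: "continuous_on S (bump n c d)"
proof -
  have "(bump n c d has_real_derivative deriv (bump n c d) x) (at x)" for x
    using times_differentiable_bump[of "Suc 0"] by auto
  then show ?thesis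
    by (intro continuous_at_imp_continuous_on) (auto intro: DERIV_isCont)
qed

lemma bump_nonneg: "0 \<le> bump n c d t"
  by (simp add: bump_def flat_exp_def)

lemma bump_le_1: "bump n c d t \<le> 1"
  by (auto simp: bump_def flat_exp_def intro!: mult_le_one)

lemma bump_eq_0: "t \<notin> {c<..<d} \<Longrightarrow> bump n c d t = 0"
  using mult_left_mono[of t c "real n"] mult_left_mono[of d t "real n"]
  by (cases "t \<le> c") (auto simp: bump_def flat_exp_def not_less)

lemma bump_tendsto: "t \<noteq> c \<Longrightarrow> t \<noteq> d \<Longrightarrow> (\<lambda>n. bump n c d t) \<longlonglongrightarrow> indicator {c..d} t"
proof -
  assume t: "t \<noteq> c" "t \<noteq> d"
  show ?thesis
  proof (cases "t \<in> {c..d}")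
    case False
    then have "bump n c d t = 0" for n by (intro bump_eq_0) auto
    with False show ?thesis by simp
  next
    case True
    then have t: "c < t" "t < d" using t by auto
    have lim: "(\<lambda>n. exp (- 1 / (real n * s))) \<longlonglongrightarrow> 1" if "s > 0" for s
    proof -
      have "(\<lambda>n. - 1 / s * (1 / real n)) \<longlonglongrightarrow> - 1 / s * 0"
        by (intro tendsto_intros lim_1_over_n)
      then have "(\<lambda>n. - 1 / (real n * s)) \<longlonglongrightarrow> 0" by (simp add: field_simps)
      from tendsto_exp[OF this] show ?thesis by simp
    qed
    have "(\<lambda>n. exp (- 1 / (real n * (t - c))) * exp (- 1 / (real n * (d - t)))) \<longlonglongrightarrow> 1 * 1"
      using t by (intro tendsto_mult lim) auto
    moreover have "\<forall>\<^sub>F n in sequentially. exp (- 1 / (real n * (t - c))) * exp (- 1 / (real n * (d - t))) = bump n c d t"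
      using eventually_gt_at_top[of 0]
    proof eventually_elim
      case (elim n)
      then have "real n * (t - c) > 0" "real n * (d - t) > 0" using t by auto
      then show ?case by (simp add: bump_def flat_exp_def algebra_simps)
    qed
    ultimately show ?thesis using True by (simp add: Lim_transform_eventually)
  qed
qed

text \<open>Dominated convergence, the bumps being bounded by 1. It converts identities known for
  test functions into identities between integrals over intervals.\<close>

lemma bump_integral_tendsto:
  fixes u :: "real \<Rightarrow> 'a::euclidean_space"
  assumes u: "set_integrable lborel {a..b} u" and cd: "{c..d} \<subseteq> {a..b}"
  shows "(\<lambda>n. LBINT t:{a..b}. bump n c d t *\<^sub>R u t) \<longlonglongrightarrow> (LBINT t:{c..d}. u t)"
proof -
  have "(\<lambda>n. LBINT t. indicator {a..b} t *\<^sub>R (bump n c d t *\<^sub>R u t)) \<longlonglongrightarrow>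
      (LBINT t. indicator {c..d} t *\<^sub>R u t)"
  proof (rule integral_dominated_convergence)
    show "(\<lambda>t. indicator {c..d} t *\<^sub>R u t) \<in> borel_measurable lborel"
      using set_integrable_subset[OF u _ cd] by (simp add: set_integrable_def)
    show "(\<lambda>t. indicator {a..b} t *\<^sub>R (bump n c d t *\<^sub>R u t)) \<in> borel_measurable lborel" for n
      using set_integrable_continuous_bilinear[OF bounded_bilinear_scaleR continuous_on_bump u]
      by (simp add: set_integrable_def)
    show "integrable lborel (\<lambda>t. norm (indicator {a..b} t *\<^sub>R u t))"
      by (rule integrable_norm[OF u[unfolded set_integrable_def]])
    show "AE t in lborel. (\<lambda>n. indicator {a..b} t *\<^sub>R (bump n c d t *\<^sub>R u t)) \<longlonglongrightarrow> indicator {c..d} t *\<^sub>R u t"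
      using AE_lborel_singleton[of c] AE_lborel_singleton[of d]
    proof eventually_elim
      case (elim t)
      then have "(\<lambda>n. indicator {a..b} t *\<^sub>R (bump n c d t *\<^sub>R u t)) \<longlonglongrightarrow>
          indicator {a..b} t *\<^sub>R (indicator {c..d} t *\<^sub>R u t)"
        by (intro tendsto_intros bump_tendsto)
      moreover have "indicator {a..b} t *\<^sub>R (indicator {c..d} t *\<^sub>R u t) = indicator {c..d} t *\<^sub>R u t"
        using cd by (auto simp: indicator_def)
      ultimately show ?case by (simp only:)
    qed
    show "AE t in lborel. norm (indicator {a..b} t *\<^sub>R (bump n c d t *\<^sub>R u t)) \<le> norm (indicator {a..b} t *\<^sub>R u t)" for n
      using bump_nonneg[of n c d] bump_le_1[of n c d] by (auto simp: mult_left_le_one_le indicator_def)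
  qed
  then show ?thesis by (simp add: set_lebesgue_integral_def)
qed

section \<open>The du Bois-Reymond lemma and uniqueness of weak derivatives\<close>

lemma test_functionI:
  assumes "\<And>n. times_differentiable n \<phi>" "a < c" "d < b" "\<And>x. x \<notin> {c..d} \<Longrightarrow> \<phi> x = 0"
  shows "test_function a b \<phi>"
  using assms times_differentiable_imp_differentiable unfolding test_function_def by blast

lemma test_function_derivative:
  assumes "test_function a b \<phi>"
  shows "(\<phi> has_real_derivative deriv \<phi> x) (at x)" "continuous_on S \<phi>" "continuous_on S (deriv \<phi>)"
proof -
  have t: "times_differentiable n \<phi>" for n
    using assms by (auto simp: test_function_def intro: differentiable_imp_times_differentiable)
  show *: "(\<phi> has_real_derivative deriv \<phi> x) (at x)" for x using t[of "Suc 0"] by auto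
  have **: "(deriv \<phi> has_real_derivative deriv (deriv \<phi>) x) (at x)" for x
    using t[of "Suc (Suc 0)"] by auto
  show "continuous_on S \<phi>" "continuous_on S (deriv \<phi>)"
    using * ** by (auto intro!: continuous_at_imp_continuous_on intro: DERIV_isCont)
qed

lemma deriv_eq_0_outside:
  assumes "\<And>x. x \<notin> {c..d} \<Longrightarrow> \<phi> x = 0" "x \<notin> {c..d}"
  shows "deriv \<phi> x = (0::real)"
proof -
  have "((\<lambda>_. 0) has_real_derivative 0) (at x)" by simp
  then have "(\<phi> has_real_derivative 0) (at x)"
    by (rule has_field_derivative_transform_within_open[where S = "- {c..d}"]) (use assms in auto)
  then show ?thesis by (rule DERIV_imp_deriv)
qed

lemma set_integral_support:
  fixes g :: "real \<Rightarrow> 'a::euclidean_space"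
  assumes "\<And>x. x \<notin> A \<Longrightarrow> \<phi> x = (0::real)" "A \<subseteq> B"
  shows "(LBINT x:B. \<phi> x *\<^sub>R g x) = (LBINT x:A. \<phi> x *\<^sub>R g x)"
  unfolding set_lebesgue_integral_def
  by (rule Bochner_Integration.integral_cong) (use assms in \<open>auto simp: indicator_def\<close>)

lemma test_function_bump: "a < c \<Longrightarrow> d < b \<Longrightarrow> test_function a b (bump n c d)"
  by (rule test_functionI[OF times_differentiable_bump]) (auto simp: bump_eq_0)

text \<open>A combination \<open>\<eta>\<close> of two bumps with total integral 0 has a compactly
  supported antiderivative, hence is the derivative of a test function and is annihilated by
  \<open>u\<close>. In the limit the bumps become indicators, so the integral of \<open>u\<close>
  over an interval is proportional to its length, and \<open>u - C\<close> has vanishing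
  integrals.\<close>

lemma du_Bois_Reymond:
  fixes u :: "real \<Rightarrow> 'a::euclidean_space"
  assumes u: "locally_integrable a b u" and "a < b"
    and zero: "\<And>\<phi>. test_function a b \<phi> \<Longrightarrow> (LBINT x:{a<..<b}. deriv \<phi> x *\<^sub>R u x) = 0"
  shows "\<exists>c. AE x\<in>{a<..<b} in lborel. u x = c"
proof -
  \<comment> \<open>A fixed reference interval; the mean of \<open>u\<close> over it is the constant
    \<open>C\<close>.\<close>
  obtain p0 q0 where pq0: "a < p0" "p0 < q0" "q0 < b"
    using \<open>a < b\<close> by (meson dense)
  have ui: "set_integrable lborel {l..r} u" if "a < l" "r < b" for l r
    using u that by (simp add: locally_integrable_def)
  define C where "C = (LBINT t:{p0..q0}. u t) /\<^sub>R (q0 - p0)"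
  have main: "(LBINT t:{p..q}. u t) = (q - p) *\<^sub>R C" if pq: "a < p" "p \<le> q" "q < b" for p q
  proof -
    define l r where "l = min p p0" and "r = max q q0"
    have lr: "a < l" "l < r" "r < b" "{p..q} \<subseteq> {l..r}" "{p0..q0} \<subseteq> {l..r}"
      using pq pq0 by (auto simp: l_def r_def)
    \<comment> \<open>The masses of the two bumps. They are written with \<open>*\<^sub>R 1\<close>
      so that \<open>bump_integral_tendsto\<close> applies to the constant function 1.\<close>
    define I1 I2 where "I1 n = (LBINT t:{l..r}. bump n p q t *\<^sub>R (1::real))"
      and "I2 n = (LBINT t:{l..r}. bump n p0 q0 t *\<^sub>R (1::real))" for n
    define \<eta> where "\<eta> n t = I2 n * bump n p q t + - I1 n * bump n p0 q0 t" for n t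
    have \<eta>: "times_differentiable k (\<eta> n)" for k n
      unfolding \<eta>_def
      by (rule times_differentiable_add[OF times_differentiable_mult[OF times_differentiable_const times_differentiable_bump]
            times_differentiable_mult[OF times_differentiable_const times_differentiable_bump]])
    have c\<eta>: "continuous_on S (\<eta> n)" for S n
      unfolding \<eta>_def by (intro continuous_intros continuous_on_bump)
    have \<eta>0: "\<eta> n t = 0" if "t \<notin> {l<..<r}" for n t
    proof -
      have "t \<notin> {p<..<q}" "t \<notin> {p0<..<q0}" using that pq pq0 by (auto simp: l_def r_def)
      then show ?thesis by (simp add: \<eta>_def bump_eq_0)
    qed
    have zero': "(LBINT t:{l..r}. \<eta> n t *\<^sub>R u t) = 0" for n
    proof -
      have "\<exists>F. \<forall>x::real. -\<infinity> < ereal x \<longrightarrow> ereal x < \<infinity> \<longrightarrow> (F has_vector_derivative \<eta> n x) (at x)"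
      proof (rule einterval_antiderivative)
        show "isCont (\<eta> n) x" for x
          using c\<eta>[of UNIV n] by (simp add: continuous_on_eq_continuous_at)
      qed simp
      then obtain F where "\<forall>x::real. -\<infinity> < ereal x \<longrightarrow> ereal x < \<infinity> \<longrightarrow> (F has_vector_derivative \<eta> n x) (at x)" ..
      then have F: "(F has_real_derivative \<eta> n x) (at x)" for x
        by (simp add: has_real_derivative_iff_has_vector_derivative)
      define \<phi> where "\<phi> x = F x - F l" for x
      have \<phi>': "(\<phi> has_real_derivative \<eta> n x) (at x)" for x
        using DERIV_diff[OF F[of x] DERIV_const] by (simp add: \<phi>_def[abs_def])
      have deriv: "deriv \<phi> = \<eta> n" by (rule ext) (rule DERIV_imp_deriv[OF \<phi>'])
      have "test_function a b \<phi>"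
      proof (rule test_functionI[where c = l and d = r])
        show "times_differentiable k \<phi>" for k
          by (rule times_differentiable_lower[OF times_differentiable_SucI[OF \<phi>' \<eta>]])
        fix x assume x: "x \<notin> {l..r}"
        \<comment> \<open>Left of \<open>l\<close> the antiderivative vanishes by its normalisation,
          right of \<open>r\<close> because \<open>\<eta> n\<close> has integral
          \<open>I2 n * I1 n - I1 n * I2 n = 0\<close>.\<close>
        have int: "(LBINT t:{l..r}. \<eta> n t) = \<phi> r - \<phi> l"
          unfolding set_lebesgue_integral_def using lr
          by (intro integral_FTC_atLeastAtMost c\<eta>)
             (simp_all add: has_field_derivative_at_within[OF \<phi>'] flip: has_real_derivative_iff_has_vector_derivative)
        have i: "set_integrable lborel {l..r} (bump n p q)" "set_integrable lborel {l..r} (bump n p0 q0)"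
          by (rule borel_integrable_atLeastAtMost'[OF continuous_on_bump])+
        then have "(LBINT t:{l..r}. \<eta> n t) = I2 n * (LBINT t:{l..r}. bump n p q t) + - I1 n * (LBINT t:{l..r}. bump n p0 q0 t)"
          by (simp add: \<eta>_def)
        then have "(LBINT t:{l..r}. \<eta> n t) = 0" by (simp add: I1_def I2_def)
        with int have r: "\<phi> r = 0" by (simp add: \<phi>_def)
        show "\<phi> x = 0"
        proof (cases "x < l")
          case True
          have "\<exists>c. \<forall>y\<in>{..l}. \<phi> y = c"
          proof (rule has_field_derivative_zero_constant)
            fix y assume "y \<in> {..l}"
            then have "\<eta> n y = 0" by (intro \<eta>0) auto
            with \<phi>'[of y] show "(\<phi> has_real_derivative 0) (at y within {..l})"
              by (simp add: has_field_derivative_at_within)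
          qed simp
          then obtain c where c: "\<forall>y\<in>{..l}. \<phi> y = c" ..
          have "\<phi> x = \<phi> l" using bspec[OF c, of x] bspec[OF c, of l] True by simp
          then show ?thesis by (simp add: \<phi>_def)
        next
          case False
          have "\<exists>c. \<forall>y\<in>{r..}. \<phi> y = c"
          proof (rule has_field_derivative_zero_constant)
            fix y assume "y \<in> {r..}"
            then have "\<eta> n y = 0" by (intro \<eta>0) auto
            with \<phi>'[of y] show "(\<phi> has_real_derivative 0) (at y within {r..})"
              by (simp add: has_field_derivative_at_within)
          qed simp
          then obtain c where c: "\<forall>y\<in>{r..}. \<phi> y = c" ..
          have "\<phi> x = \<phi> r" using bspec[OF c, of x] bspec[OF c, of r] False x by simp
          then show ?thesis by (simp add: r)
        qed
      qed (use lr in auto)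
      from zero[OF this] have "(LBINT t:{a<..<b}. \<eta> n t *\<^sub>R u t) = 0" by (simp add: deriv)
      moreover have "(LBINT t:{a<..<b}. \<eta> n t *\<^sub>R u t) = (LBINT t:{l..r}. \<eta> n t *\<^sub>R u t)"
        using \<eta>0 lr by (intro set_integral_support) auto
      ultimately show ?thesis by simp
    qed
    have "I2 n *\<^sub>R (LBINT t:{l..r}. bump n p q t *\<^sub>R u t) = I1 n *\<^sub>R (LBINT t:{l..r}. bump n p0 q0 t *\<^sub>R u t)" for n
    proof -
      have i: "set_integrable lborel {l..r} (\<lambda>t. bump n p q t *\<^sub>R u t)"
        "set_integrable lborel {l..r} (\<lambda>t. bump n p0 q0 t *\<^sub>R u t)"
        by (rule set_integrable_continuous_bilinear[OF bounded_bilinear_scaleR continuous_on_bump ui[OF lr(1,3)]])+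
      have "0 = (LBINT t:{l..r}. I2 n *\<^sub>R (bump n p q t *\<^sub>R u t) - I1 n *\<^sub>R (bump n p0 q0 t *\<^sub>R u t))"
        using zero'[of n] by (simp add: \<eta>_def scaleR_left_diff_distrib)
      also have "\<dots> = I2 n *\<^sub>R (LBINT t:{l..r}. bump n p q t *\<^sub>R u t) - I1 n *\<^sub>R (LBINT t:{l..r}. bump n p0 q0 t *\<^sub>R u t)"
        using i set_integral_diff[of lborel "{l..r}" "\<lambda>t. I2 n *\<^sub>R (bump n p q t *\<^sub>R u t)" "\<lambda>t. I1 n *\<^sub>R (bump n p0 q0 t *\<^sub>R u t)"]
        by (simp only: set_integrable_scaleR_right set_integral_scaleR_right simp_thms)
      finally show ?thesis by simp
    qed
    moreover have "(\<lambda>n. I2 n *\<^sub>R (LBINT t:{l..r}. bump n p q t *\<^sub>R u t)) \<longlonglongrightarrow> (LBINT t:{p0..q0}. 1) *\<^sub>R (LBINT t:{p..q}. u t)"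
      "(\<lambda>n. I1 n *\<^sub>R (LBINT t:{l..r}. bump n p0 q0 t *\<^sub>R u t)) \<longlonglongrightarrow> (LBINT t:{p..q}. 1) *\<^sub>R (LBINT t:{p0..q0}. u t)"
    proof -
      have one: "set_integrable lborel {l..r} (\<lambda>_. 1::real)"
        by (rule borel_integrable_atLeastAtMost') simp
      have u': "set_integrable lborel {l..r} u" using lr by (intro ui)
      show "(\<lambda>n. I2 n *\<^sub>R (LBINT t:{l..r}. bump n p q t *\<^sub>R u t)) \<longlonglongrightarrow> (LBINT t:{p0..q0}. 1) *\<^sub>R (LBINT t:{p..q}. u t)"
        unfolding I2_def by (intro tendsto_scaleR bump_integral_tendsto[OF one] bump_integral_tendsto[OF u'] lr)
      show "(\<lambda>n. I1 n *\<^sub>R (LBINT t:{l..r}. bump n p0 q0 t *\<^sub>R u t)) \<longlonglongrightarrow> (LBINT t:{p..q}. 1) *\<^sub>R (LBINT t:{p0..q0}. u t)"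
        unfolding I1_def by (intro tendsto_scaleR bump_integral_tendsto[OF one] bump_integral_tendsto[OF u'] lr)
    qed
    ultimately have "(LBINT t:{p0..q0}. 1) *\<^sub>R (LBINT t:{p..q}. u t) = (LBINT t:{p..q}. 1) *\<^sub>R (LBINT t:{p0..q0}. u t)"
      by (simp add: LIMSEQ_unique)
    then have "(q0 - p0) *\<^sub>R (LBINT t:{p..q}. u t) = (q - p) *\<^sub>R (LBINT t:{p0..q0}. u t)"
      using pq pq0 by (simp add: set_lebesgue_integral_def)
    then show ?thesis
    proof -
      assume eq: "(q0 - p0) *\<^sub>R (LBINT t:{p..q}. u t) = (q - p) *\<^sub>R (LBINT t:{p0..q0}. u t)"
      have "(LBINT t:{p..q}. u t) = inverse (q0 - p0) *\<^sub>R ((q0 - p0) *\<^sub>R (LBINT t:{p..q}. u t))"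
        using pq0 by simp
      also have "\<dots> = (q - p) *\<^sub>R C" unfolding eq by (simp add: C_def)
      finally show ?thesis .
    qed
  qed
  have "AE x\<in>{a<..<b} in lborel. u x - C = 0"
  proof (rule AE_Ioo_if_AE_Icc, rule AE_zero_if_interval_integrals_zero)
    fix c d assume "a < c" "d < b"
    then show "set_integrable lborel {c..d} (\<lambda>x. u x - C)"
      by (intro set_integral_diff ui borel_integrable_atLeastAtMost' continuous_on_const)
    fix x y assume "c \<le> x" "x \<le> y" "y \<le> d"
    with \<open>a < c\<close> \<open>d < b\<close> have "set_integrable lborel {x..y} u" "set_integrable lborel {x..y} (\<lambda>_. C)"
      by (auto intro: ui borel_integrable_atLeastAtMost'[OF continuous_on_const])
    then have "(LBINT t:{x..y}. u t - C) = (LBINT t:{x..y}. u t) - (LBINT t:{x..y}. C)" by simp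
    also have "(LBINT t:{x..y}. C) = (y - x) *\<^sub>R C"
      using \<open>x \<le> y\<close> by (simp add: set_lebesgue_integral_def)
    finally show "(LBINT t:{x..y}. u t - C) = 0"
      using main[of x y] \<open>a < c\<close> \<open>d < b\<close> \<open>c \<le> x\<close> \<open>x \<le> y\<close> \<open>y \<le> d\<close> by simp
  qed
  then show ?thesis by auto
qed

text \<open>Testing both candidates with bumps and passing to the limit shows that they have the
  same integral over every interval.\<close>

lemma weak_derivative_unique_AE:
  fixes f :: "real \<Rightarrow> 'a::euclidean_space"
  assumes "has_weak_derivative a b f g" "has_weak_derivative a b f h"
  shows "AE x\<in>{a<..<b} in lborel. g x = h x"
proof -
  have gi: "set_integrable lborel {l..r} g" and hi: "set_integrable lborel {l..r} h"
    if "a < l" "r < b" for l r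
    using assms that by (auto simp: has_weak_derivative_def locally_integrable_def)
  have main: "(LBINT t:{p..q}. g t - h t) = 0" if pq: "a < p" "p \<le> q" "q < b" for p q
  proof -
    have z: "(LBINT t:{p..q}. bump n p q t *\<^sub>R g t) = (LBINT t:{p..q}. bump n p q t *\<^sub>R h t)" for n
    proof -
      have "test_function a b (bump n p q)" using pq by (intro test_function_bump) auto
      with assms have "(LBINT t:{a<..<b}. bump n p q t *\<^sub>R g t) = (LBINT t:{a<..<b}. bump n p q t *\<^sub>R h t)"
        by (simp add: has_weak_derivative_def)
      moreover have "(LBINT t:{a<..<b}. bump n p q t *\<^sub>R k t) = (LBINT t:{p..q}. bump n p q t *\<^sub>R k t)" for k :: "real \<Rightarrow> 'a"
        using pq by (intro set_integral_support) (auto intro!: bump_eq_0)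
      ultimately show ?thesis by simp
    qed
    have "(\<lambda>n. LBINT t:{p..q}. bump n p q t *\<^sub>R g t) \<longlonglongrightarrow> (LBINT t:{p..q}. g t)"
      "(\<lambda>n. LBINT t:{p..q}. bump n p q t *\<^sub>R g t) \<longlonglongrightarrow> (LBINT t:{p..q}. h t)"
      using pq bump_integral_tendsto[OF gi, of p q p q] bump_integral_tendsto[OF hi, of p q p q]
      by (auto simp: z)
    then show ?thesis
      using LIMSEQ_unique gi[of p q] hi[of p q] pq by auto
  qed
  have "AE x\<in>{a<..<b} in lborel. g x - h x = 0"
  proof (rule AE_Ioo_if_AE_Icc, rule AE_zero_if_interval_integrals_zero)
    fix c d assume "a < c" "d < b"
    then show "set_integrable lborel {c..d} (\<lambda>x. g x - h x)" using gi hi by auto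
    show "(LBINT t:{x..y}. g t - h t) = 0" if "c \<le> x" "x \<le> y" "y \<le> d" for x y
      using main[of x y] that \<open>a < c\<close> \<open>d < b\<close> by auto
  qed
  then show ?thesis by simp
qed

text \<open>Integration by parts is the product rule for \<open>\<phi> x *\<^sub>R F x\<close>; the
  boundary terms vanish because \<open>\<phi>\<close> is supported inside
  \<open>(a,b)\<close>.\<close>

lemma primitive_on_imp_has_weak_derivative:
  fixes F :: "real \<Rightarrow> 'a::euclidean_space"
  assumes F: "primitive_on a b F f"
  shows "has_weak_derivative a b F f"
  unfolding has_weak_derivative_def locally_integrable_def
proof (intro conjI allI impI)
  show "set_integrable lborel {c..d} F" if "a < c \<and> d < b" for c d
    using that by (intro borel_integrable_atLeastAtMost' continuous_on_subset[OF primitive_on_continuous[OF F]]) auto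
  show "set_integrable lborel {c..d} f" if "a < c \<and> d < b" for c d
    using that by (intro set_integrable_subset[OF primitive_on_integrable[OF F]]) auto
  fix \<phi> assume \<phi>: "test_function a b \<phi>"
  then obtain c d where cd: "a < c" "d < b" "\<And>x. x \<notin> {c..d} \<Longrightarrow> \<phi> x = 0"
    by (auto simp: test_function_def)
  have "primitive_on a b \<phi> (deriv \<phi>)"
    by (rule primitive_on_FTC)
       (auto intro!: has_field_derivative_at_within test_function_derivative[OF \<phi>]
         simp flip: has_real_derivative_iff_has_vector_derivative)
  from primitive_on_bilinear[OF bounded_bilinear_scaleR this F]
  have *: "primitive_on a b (\<lambda>x. \<phi> x *\<^sub>R F x) (\<lambda>x. deriv \<phi> x *\<^sub>R F x + \<phi> x *\<^sub>R f x)" .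
  have i: "set_integrable lborel {a..b} (\<lambda>x. deriv \<phi> x *\<^sub>R F x)" "set_integrable lborel {a..b} (\<lambda>x. \<phi> x *\<^sub>R f x)"
    by (rule borel_integrable_atLeastAtMost'[OF continuous_on_scaleR[OF test_function_derivative(3)[OF \<phi>] primitive_on_continuous[OF F]]])
       (rule set_integrable_continuous_bilinear[OF bounded_bilinear_scaleR test_function_derivative(2)[OF \<phi>] primitive_on_integrable[OF F]])
  have "(LBINT x:{a..b}. deriv \<phi> x *\<^sub>R F x + \<phi> x *\<^sub>R f x) = 0"
  proof (cases "a \<le> b")
    case True
    then show ?thesis using primitive_on_integral[OF *, of a b] cd(1,2) cd(3)[of a] cd(3)[of b] by simp
  qed (simp add: set_lebesgue_integral_def)
  then show "(LBINT x:{a<..<b}. deriv \<phi> x *\<^sub>R F x) = - (LBINT x:{a<..<b}. \<phi> x *\<^sub>R f x)"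
    using i by (simp add: set_integral_Ioo_Icc eq_neg_iff_add_eq_0)
qed

text \<open>The indefinite integral of \<open>g\<close> has the same weak derivative as
  \<open>f\<close>, so their difference has weak derivative 0 and is constant by
  \<open>du_Bois_Reymond\<close>.\<close>

lemma has_weak_derivative_imp_primitive_on:
  fixes f :: "real \<Rightarrow> 'a::euclidean_space"
  assumes f: "has_weak_derivative a b f g" and g: "set_integrable lborel {a<..<b} g" and "a < b"
  obtains F where "primitive_on a b F g" "AE x\<in>{a<..<b} in lborel. f x = F x"
proof -
  define G where "G x = (LBINT t:{a..x}. g t)" for x
  have g': "set_integrable lborel {a..b} g" using g by (simp add: set_integrable_Ioo_Icc)
  have G: "primitive_on a b G g"
  proof (rule primitive_onI[OF g'])
    have "G a = 0"
      using set_integral_split[OF g', of a] \<open>a < b\<close> by (simp add: G_def)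
    then show "(LBINT t:{a..x}. g t) = G x - G a" for x by (simp add: G_def)
  qed
  have "has_weak_derivative a b G g" by (rule primitive_on_imp_has_weak_derivative[OF G])
  have fi: "locally_integrable a b f" using f by (simp add: has_weak_derivative_def)
  have Gi: "locally_integrable a b G"
    using \<open>has_weak_derivative a b G g\<close> by (simp add: has_weak_derivative_def)
  have "\<exists>c. AE x\<in>{a<..<b} in lborel. f x - G x = c"
  proof (rule du_Bois_Reymond[OF _ \<open>a < b\<close>])
    show "locally_integrable a b (\<lambda>x. f x - G x)"
      using fi Gi by (auto simp: locally_integrable_def)
    fix \<phi> assume \<phi>: "test_function a b \<phi>"
    then obtain c d where cd: "a < c" "d < b" "\<And>x. x \<notin> {c..d} \<Longrightarrow> \<phi> x = 0"
      by (auto simp: test_function_def)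
    have supp: "(LBINT x:{a<..<b}. deriv \<phi> x *\<^sub>R h x) = (LBINT x:{c..d}. deriv \<phi> x *\<^sub>R h x)" for h :: "real \<Rightarrow> 'a"
      using cd deriv_eq_0_outside[OF cd(3)] by (intro set_integral_support) auto
    have i: "set_integrable lborel {c..d} (\<lambda>x. deriv \<phi> x *\<^sub>R f x)" "set_integrable lborel {c..d} (\<lambda>x. deriv \<phi> x *\<^sub>R G x)"
      using fi Gi cd unfolding locally_integrable_def
      by (simp_all add: set_integrable_continuous_bilinear[OF bounded_bilinear_scaleR test_function_derivative(3)[OF \<phi>]])
    have "(LBINT x:{a<..<b}. deriv \<phi> x *\<^sub>R f x) = (LBINT x:{a<..<b}. deriv \<phi> x *\<^sub>R G x)"
      using f \<open>has_weak_derivative a b G g\<close> \<phi> by (simp add: has_weak_derivative_def)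
    then show "(LBINT x:{a<..<b}. deriv \<phi> x *\<^sub>R (f x - G x)) = 0"
      unfolding supp using i by (simp add: scaleR_right_diff_distrib)
  qed
  then obtain c where c: "AE x\<in>{a<..<b} in lborel. f x - G x = c" ..
  have "primitive_on a b (\<lambda>x. G x + c) g"
    using primitive_on_add[OF G primitive_on_const[of a b c]] by simp
  moreover have "AE x\<in>{a<..<b} in lborel. f x = G x + c"
    using c by eventually_elim (auto simp: algebra_simps)
  ultimately show ?thesis by (rule that)
qed

text \<open>This serves \<open>curvature\<close>, which differentiates the function
  \<open>tangent\<close>; that function is built from an arbitrary representative and equals the
  continuous unit tangent only almost everywhere.\<close>

lemma has_weak_derivative_cong_AE:
  fixes f F :: "real \<Rightarrow> 'a::euclidean_space"
  assumes F: "has_weak_derivative a b F g" and f: "set_borel_measurable lborel {a<..<b} f"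
    and eq: "AE x\<in>{a<..<b} in lborel. F x = f x"
  shows "has_weak_derivative a b f g"
proof -
  have li: "locally_integrable a b F" "locally_integrable a b g"
    using F by (auto simp: has_weak_derivative_def)
  have fm: "set_borel_measurable lborel {c..d} f" if "a < c" "d < b" for c d
    using that by (intro set_borel_measurable_subset[OF f]) auto
  have fi: "set_integrable lborel {c..d} f" if "a < c" "d < b" for c d
  proof (rule set_integrable_bound)
    show "set_integrable lborel {c..d} F" using li that by (simp add: locally_integrable_def)
    show "AE x in lborel. x \<in> {c..d} \<longrightarrow> norm (f x) \<le> norm (F x)"
      using eq by eventually_elim (use that in auto)
  qed (use fm that in auto)
  show ?thesis
    unfolding has_weak_derivative_def
  proof (intro conjI allI impI li)
    show "locally_integrable a b f" using fi by (simp add: locally_integrable_def)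
    fix \<phi> assume \<phi>: "test_function a b \<phi>"
    then obtain c d where cd: "a < c" "d < b" "\<And>x. x \<notin> {c..d} \<Longrightarrow> \<phi> x = 0"
      by (auto simp: test_function_def)
    have supp: "(LBINT x:{a<..<b}. deriv \<phi> x *\<^sub>R h x) = (LBINT x:{c..d}. deriv \<phi> x *\<^sub>R h x)" for h :: "real \<Rightarrow> 'a"
      using cd deriv_eq_0_outside[OF cd(3)] by (intro set_integral_support) auto
    have i: "set_integrable lborel {c..d} (\<lambda>x. deriv \<phi> x *\<^sub>R f x)" "set_integrable lborel {c..d} (\<lambda>x. deriv \<phi> x *\<^sub>R F x)"
      using fi li cd unfolding locally_integrable_def
      by (simp_all add: set_integrable_continuous_bilinear[OF bounded_bilinear_scaleR test_function_derivative(3)[OF \<phi>]])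
    have "(LBINT x:{c..d}. deriv \<phi> x *\<^sub>R f x) = (LBINT x:{c..d}. deriv \<phi> x *\<^sub>R F x)"
      unfolding set_lebesgue_integral_def
    proof (rule integral_cong_AE)
      show "AE x in lborel. indicator {c..d} x *\<^sub>R deriv \<phi> x *\<^sub>R f x = indicator {c..d} x *\<^sub>R deriv \<phi> x *\<^sub>R F x"
        using eq by eventually_elim (use cd in \<open>auto simp: indicator_def\<close>)
    qed (use i in \<open>auto simp: set_integrable_def\<close>)
    then have "(LBINT x:{a<..<b}. deriv \<phi> x *\<^sub>R f x) = (LBINT x:{a<..<b}. deriv \<phi> x *\<^sub>R F x)"
      by (simp add: supp)
    with F \<phi> show "(LBINT x:{a<..<b}. deriv \<phi> x *\<^sub>R f x) = - (LBINT x:{a<..<b}. \<phi> x *\<^sub>R g x)"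
      by (simp add: has_weak_derivative_def)
  qed
qed

lemma weak_derivative_AE:
  fixes f :: "real \<Rightarrow> 'a::euclidean_space"
  assumes "has_weak_derivative a b f g"
  shows "has_weak_derivative a b f (weak_derivative a b f)"
    and "AE x\<in>{a<..<b} in lborel. weak_derivative a b f x = g x"
proof -
  show *: "has_weak_derivative a b f (weak_derivative a b f)"
    unfolding weak_derivative_def using someI[of "has_weak_derivative a b f", OF assms] .
  show "AE x\<in>{a<..<b} in lborel. weak_derivative a b f x = g x"
    by (rule weak_derivative_unique_AE[OF * assms])
qed

section \<open>Moving frames of immersed curves\<close>

lemma set_borel_measurable_norm_square:
  fixes f :: "_ \<Rightarrow> 'a::euclidean_space"
  assumes "set_borel_measurable M A f"
  shows "set_borel_measurable M A (\<lambda>x. (norm (f x))\<^sup>2)"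
proof -
  have "(\<lambda>x. (norm (indicator A x *\<^sub>R f x))\<^sup>2) \<in> borel_measurable M"
    using assms unfolding set_borel_measurable_def
    by (intro borel_measurable_power measurable_compose[OF _ borel_measurable_norm])
  also have "(\<lambda>x. (norm (indicator A x *\<^sub>R f x))\<^sup>2) = (\<lambda>x. indicator A x *\<^sub>R (norm (f x))\<^sup>2)"
    by (auto simp: fun_eq_iff indicator_def)
  finally show ?thesis by (simp add: set_borel_measurable_def)
qed

lemma set_borel_measurable_cong_set:
  fixes f g :: "_ \<Rightarrow> 'a::real_normed_vector"
  assumes "set_borel_measurable M A f" "\<And>x. x \<in> A \<Longrightarrow> f x = g x"
  shows "set_borel_measurable M A g"
proof -
  have "(\<lambda>x. indicator A x *\<^sub>R f x) = (\<lambda>x. indicator A x *\<^sub>R g x)"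
    using assms(2) by (auto simp: fun_eq_iff indicator_def)
  with assms(1) show ?thesis by (simp add: set_borel_measurable_def)
qed

lemma set_integrable_norm_square_bound:
  fixes f :: "real \<Rightarrow> 'a::euclidean_space" and h :: "real \<Rightarrow> 'b::euclidean_space"
  assumes f: "set_borel_measurable lborel A f"
    and h: "set_integrable lborel A (\<lambda>x. (norm (h x))\<^sup>2)"
    and le: "\<And>x. x \<in> A \<Longrightarrow> norm (f x) \<le> C * norm (h x)"
  shows "set_integrable lborel A (\<lambda>x. (norm (f x))\<^sup>2)"
proof (rule set_integrable_bound)
  show "set_integrable lborel A (\<lambda>x. C\<^sup>2 * (norm (h x))\<^sup>2)" using h by simp
  have "(norm (f x))\<^sup>2 \<le> C\<^sup>2 * (norm (h x))\<^sup>2" if "x \<in> A" for x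
    using power_mono[OF le[OF that] norm_ge_zero, of 2] by (simp add: power_mult_distrib)
  then show "AE x in lborel. x \<in> A \<longrightarrow> norm ((norm (f x))\<^sup>2) \<le> norm (C\<^sup>2 * (norm (h x))\<^sup>2)"
    by auto
qed (rule set_borel_measurable_norm_square[OF f])

lemma square_integrable_imp_integrable:
  fixes f :: "real \<Rightarrow> 'a::euclidean_space"
  assumes "square_integrable a b f"
  shows "set_integrable lborel {a<..<b} f"
proof (rule set_integrable_bound)
  have "set_integrable lborel {a<..<b} (\<lambda>_. 1::real)"
    unfolding set_integrable_Ioo_Icc by (rule borel_integrable_atLeastAtMost'[OF continuous_on_const])
  then show "set_integrable lborel {a<..<b} (\<lambda>x. 1 + (norm (f x))\<^sup>2)"
    using assms by (auto simp: square_integrable_def)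
  have "norm (f x) \<le> 1 + (norm (f x))\<^sup>2" for x
  proof -
    have "0 \<le> (norm (f x) - 1)\<^sup>2" by simp
    also have "\<dots> = 1 + (norm (f x))\<^sup>2 - 2 * norm (f x)" by (simp add: power2_eq_square algebra_simps)
    finally show ?thesis using norm_ge_zero[of "f x"] by linarith
  qed
  then show "AE x in lborel. x \<in> {a<..<b} \<longrightarrow> norm (f x) \<le> norm (1 + (norm (f x))\<^sup>2)"
    by (auto intro: order_trans[OF _ abs_ge_self])
qed (use assms in \<open>simp add: square_integrable_def\<close>)

lemma square_integrable_continuous:
  fixes f :: "real \<Rightarrow> 'a::euclidean_space"
  assumes "continuous_on {a..b} f"
  shows "square_integrable a b f"
  unfolding square_integrable_def set_integrable_Ioo_Icc
proof
  show "set_borel_measurable lborel {a<..<b} f"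
    by (rule set_borel_measurable_subset[OF set_borel_measurable_continuous[OF assms]]) auto
  show "set_integrable lborel {a..b} (\<lambda>x. (norm (f x))\<^sup>2)"
    by (rule borel_integrable_atLeastAtMost'[OF continuous_on_power[OF continuous_on_norm[OF assms]]])
qed

text \<open>Exhaustion by compact intervals. It makes the representatives chosen by
  \<open>weak_derivative\<close> measurable, so that integrals over them can be compared almost
  everywhere.\<close>

lemma locally_integrable_imp_measurable:
  fixes f :: "real \<Rightarrow> 'a::euclidean_space"
  assumes "locally_integrable a b f"
  shows "set_borel_measurable lborel {a<..<b} f"
proof -
  define A where "A n = {a + 1 / (real n + 1)..b - 1 / (real n + 1)}" for n
  have "(\<lambda>x. indicator {a<..<b} x *\<^sub>R f x) \<in> borel_measurable lborel"
  proof (rule borel_measurable_LIMSEQ_metric)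
    show "(\<lambda>x. indicator (A n) x *\<^sub>R f x) \<in> borel_measurable lborel" for n
    proof -
      have "set_integrable lborel (A n) f"
        using assms by (auto simp: A_def locally_integrable_def field_simps)
      then show ?thesis by (simp add: set_integrable_def)
    qed
    fix x
    show "(\<lambda>n. indicator (A n) x *\<^sub>R f x) \<longlonglongrightarrow> indicator {a<..<b} x *\<^sub>R f x"
    proof (cases "x \<in> {a<..<b}")
      case True
      have "(\<lambda>n. 1 / (real n + 1)) \<longlonglongrightarrow> 0"
        using LIMSEQ_inverse_real_of_nat by (simp add: inverse_eq_divide add.commute)
      from tendsto_add[OF tendsto_const this, of a] tendsto_diff[OF tendsto_const this, of b]
      have "(\<lambda>n. a + 1 / (real n + 1)) \<longlonglongrightarrow> a" "(\<lambda>n. b - 1 / (real n + 1)) \<longlonglongrightarrow> b"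
        by simp_all
      then have "\<forall>\<^sub>F n in sequentially. a + 1 / (real n + 1) < x" "\<forall>\<^sub>F n in sequentially. x < b - 1 / (real n + 1)"
        using True by (auto intro: order_tendstoD)
      then have "\<forall>\<^sub>F n in sequentially. indicator {a<..<b} x *\<^sub>R f x = indicator (A n) x *\<^sub>R f x"
        by eventually_elim (use True in \<open>auto simp: A_def indicator_def\<close>)
      then show ?thesis by (rule Lim_transform_eventually[OF tendsto_const])
    next
      case False
      have "x \<notin> A n" for n
      proof -
        have "1 / (real n + 1) > 0" by simp
        with False show ?thesis unfolding A_def greaterThanLessThan_iff atLeastAtMost_iff by linarith
      qed
      with False show ?thesis by simp
    qed
  qed
  then show ?thesis by (simp add: set_borel_measurable_def)
qed

lemma velocity_eq:
  fixes \<gamma> :: "real \<Rightarrow> 'a::euclidean_space"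
  assumes "primitive_on a b \<gamma> v" "continuous_on {a..b} v" "a < b" "x \<in> {a..b}"
  shows "velocity a b \<gamma> x = v x"
  unfolding velocity_def
  using vector_derivative_within_cbox[of a b x \<gamma> "v x"] primitive_on_has_vector_derivative[OF assms(1,2,4)] assms(3,4)
  by simp

text \<open>The constant \<open>T x \<bullet> T x\<close> has both 0 and
  \<open>2 * (\<tau> x \<bullet> T x)\<close> as almost-everywhere derivative.\<close>

lemma unit_primitive_orthogonal:
  assumes "primitive_on a b T \<tau>" "\<And>x. x \<in> {a..b} \<Longrightarrow> norm (T x) = 1"
  shows "AE x\<in>{a..b} in lborel. \<tau> x \<bullet> T x = 0"
proof -
  have "primitive_on a b (\<lambda>x. T x \<bullet> T x) (\<lambda>x. \<tau> x \<bullet> T x + T x \<bullet> \<tau> x)"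
    by (rule primitive_on_bilinear[OF bounded_bilinear_inner assms(1,1)])
  moreover have "primitive_on a b (\<lambda>x. T x \<bullet> T x) (\<lambda>_. 0)"
    by (rule primitive_on_cong[OF primitive_on_const[of a b 1]])
       (auto simp: assms(2) dot_square_norm)
  ultimately have "AE x\<in>{a..b} in lborel. \<tau> x \<bullet> T x + T x \<bullet> \<tau> x = 0"
    by (rule primitive_on_unique_AE)
  then show ?thesis by eventually_elim (auto simp: inner_commute)
qed

text \<open>\<open>w\<close> is the speed, \<open>T\<close> the unit tangent and \<open>\<tau> = w \<kappa>\<close>.\<close>

definition framed_curve :: "real \<Rightarrow> real \<Rightarrow> (real \<Rightarrow> 'a::euclidean_space) \<Rightarrow> (real \<Rightarrow> real) \<Rightarrow>
    (real \<Rightarrow> real) \<Rightarrow> (real \<Rightarrow> 'a) \<Rightarrow> (real \<Rightarrow> 'a) \<Rightarrow> bool" where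
  "framed_curve a b \<gamma> w w' T \<tau> \<longleftrightarrow> a < b \<and>
     (\<forall>x\<in>{a..b}. w x > 0 \<and> norm (T x) = 1) \<and>
     primitive_on a b w w' \<and> set_integrable lborel {a..b} (\<lambda>x. (norm (w' x))\<^sup>2) \<and>
     primitive_on a b T \<tau> \<and> set_integrable lborel {a..b} (\<lambda>x. (norm (\<tau> x))\<^sup>2) \<and>
     primitive_on a b \<gamma> (\<lambda>x. w x *\<^sub>R T x)"

text \<open>Weak differentiability is turned into absolute continuity twice, for
  \<open>\<gamma>\<close> and for its velocity \<open>v\<close>. As \<open>v\<close> has no zero,
  the chain rule for \<open>sqrt\<close> and \<open>inverse\<close> on the positive reals gives
  \<open>w\<close> and \<open>1 / w\<close>, and the product rule gives \<open>T = v / w\<close>.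
  Square integrability passes from \<open>h\<close> to \<open>w'\<close> and \<open>\<tau>\<close>
  because \<open>1 / w\<close> is bounded.\<close>

lemma immersed_H2_curve_imp_framed:
  fixes \<gamma> :: "real \<Rightarrow> 'a::euclidean_space"
  assumes "immersed_H2_curve a b \<gamma>"
  obtains w w' T \<tau> where "framed_curve a b \<gamma> w w' T \<tau>"
proof -
  have "a < b" and c\<gamma>: "continuous_on {a..b} \<gamma>" and "W22 a b \<gamma>"
    using assms by (auto simp: immersed_H2_curve_def H2_curve_def)
  then obtain g h where g: "has_weak_derivative a b \<gamma> g" "square_integrable a b g"
    and h: "has_weak_derivative a b g h" "square_integrable a b h"
    by (auto simp: W22_def)
  obtain F where F: "primitive_on a b F g" "AE x\<in>{a<..<b} in lborel. \<gamma> x = F x"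
    by (rule has_weak_derivative_imp_primitive_on[OF g(1) square_integrable_imp_integrable[OF g(2)] \<open>a < b\<close>])
  have "F x = \<gamma> x" if "x \<in> {a..b}" for x
    using continuous_AE_eq_imp_eq[OF c\<gamma> primitive_on_continuous[OF F(1)] \<open>a < b\<close> F(2) that] by simp
  then have \<gamma>g: "primitive_on a b \<gamma> g" by (rule primitive_on_cong[OF F(1)]) auto
  obtain v where v: "primitive_on a b v h" "AE x\<in>{a<..<b} in lborel. g x = v x"
    by (rule has_weak_derivative_imp_primitive_on[OF h(1) square_integrable_imp_integrable[OF h(2)] \<open>a < b\<close>])
  note cv = primitive_on_continuous[OF v(1)]
  \<comment> \<open>Only with the continuous \<open>v\<close> in place of \<open>g\<close>, which is
    fixed up to null sets, can the classical \<open>velocity\<close> be computed.\<close>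
  have \<gamma>v: "primitive_on a b \<gamma> v"
    by (rule primitive_on_cong_AE[OF \<gamma>g set_borel_measurable_continuous[OF cv]])
       (use v(2) AE_Ioo_Icc[of a b "\<lambda>x. g x = v x"] in simp)
  have v0: "v x \<noteq> 0" if "x \<in> {a..b}" for x
    using assms velocity_eq[OF \<gamma>v cv \<open>a < b\<close> that] that unfolding immersed_H2_curve_def by metis
  define w where "w x = norm (v x)" for x
  define w' where "w' x = (inverse (sqrt (v x \<bullet> v x)) / 2) * (h x \<bullet> v x + v x \<bullet> h x)" for x
  have w0: "w x > 0" if "x \<in> {a..b}" for x using v0[OF that] by (simp add: w_def)
  have w: "primitive_on a b w w'"
  proof -
    have "primitive_on a b (\<lambda>x. sqrt (v x \<bullet> v x))
        (\<lambda>x. inverse (sqrt (v x \<bullet> v x)) / 2 * (h x \<bullet> v x + v x \<bullet> h x))"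
    proof (rule primitive_on_chain[OF primitive_on_bilinear[OF bounded_bilinear_inner v(1) v(1)], where S = "{0<..}"
          and \<Phi> = sqrt and \<Phi>' = "\<lambda>z. inverse (sqrt z) / 2"])
      show "(\<lambda>x. v x \<bullet> v x) ` {a..b} \<subseteq> {0<..}" using v0 by (intro image_subsetI) simp
      show "(sqrt has_real_derivative inverse (sqrt z) / 2) (at z within {0<..})" if "z \<in> {0<..}" for z
        using that by (auto intro: has_field_derivative_at_within[OF DERIV_real_sqrt])
      show "continuous_on {0<..} (\<lambda>z. inverse (sqrt z) / 2)"
        by (intro continuous_intros) auto
    qed
    then show ?thesis
      by (rule primitive_on_cong) (simp_all only: w_def w'_def norm_eq_sqrt_inner)
  qed
  define r' where "r' x = - (inverse (w x * w x)) * w' x" for x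
  have r: "primitive_on a b (\<lambda>x. inverse (w x)) r'"
    unfolding r'_def[abs_def]
  proof (rule primitive_on_chain[OF w, where S = "{0<..}" and \<Phi> = inverse and \<Phi>' = "\<lambda>z. - inverse (z * z)"])
    show "w ` {a..b} \<subseteq> {0<..}" using w0 by auto
    show "(inverse has_real_derivative - inverse (z * z)) (at z within {0<..})" if "z \<in> {0<..}" for z
      using that DERIV_inverse[of z "{0<..}"] by (simp add: power2_eq_square)
    show "continuous_on {0<..} (\<lambda>z::real. - inverse (z * z))"
      by (intro continuous_intros) auto
  qed
  define T where "T x = inverse (w x) *\<^sub>R v x" for x
  define \<tau> where "\<tau> x = r' x *\<^sub>R v x + inverse (w x) *\<^sub>R h x" for x
  have T: "primitive_on a b T \<tau>"
    using primitive_on_bilinear[OF bounded_bilinear_scaleR r v(1)] by (simp add: T_def[abs_def] \<tau>_def[abs_def])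
  have T1: "norm (T x) = 1" if "x \<in> {a..b}" for x using v0[OF that] by (simp add: T_def w_def)
  have h2: "set_integrable lborel {a..b} (\<lambda>x. (norm (h x))\<^sup>2)"
    using h(2) by (simp add: square_integrable_def set_integrable_Ioo_Icc)
  have w'_le: "norm (w' x) \<le> norm (h x)" if "x \<in> {a..b}" for x
  proof -
    have "w' x = (h x \<bullet> v x) / norm (v x)"
      unfolding w'_def norm_eq_sqrt_inner[symmetric] inner_commute[of "v x" "h x"]
      using v0[OF that] by (simp add: field_simps)
    then have "norm (w' x) = \<bar>h x \<bullet> v x\<bar> / norm (v x)"
      by simp
    also have "\<dots> \<le> norm (h x)"
      using Cauchy_Schwarz_ineq2[of "h x" "v x"] v0[OF that] by (simp add: field_simps)
    finally show ?thesis .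
  qed
  have "continuous_on {a..b} (\<lambda>x. inverse (w x))"
    by (rule primitive_on_continuous[OF r])
  then have "bounded ((\<lambda>x. inverse (w x)) ` {a..b})"
    by (intro compact_imp_bounded compact_continuous_image compact_Icc)
  then obtain C where C': "\<forall>y\<in>(\<lambda>x. inverse (w x)) ` {a..b}. norm y \<le> C"
    unfolding bounded_iff by blast
  have C: "inverse (w x) \<le> C" if "x \<in> {a..b}" for x
    using bspec[OF C' imageI[OF that]] abs_ge_self[of "inverse (w x)"] unfolding real_norm_def by linarith
  have \<tau>_le: "norm (\<tau> x) \<le> (2 * C) * norm (h x)" if "x \<in> {a..b}" for x
  proof -
    have "norm (\<tau> x) \<le> norm (r' x *\<^sub>R v x) + norm (inverse (w x) *\<^sub>R h x)"
      unfolding \<tau>_def by (rule norm_triangle_ineq)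
    also have "norm (r' x *\<^sub>R v x) = inverse (w x) * norm (w' x)"
      using w0[OF that] by (simp add: r'_def w_def abs_mult)
    also have "norm (inverse (w x) *\<^sub>R h x) = inverse (w x) * norm (h x)"
      using w0[OF that] by simp
    also have "inverse (w x) * norm (w' x) + inverse (w x) * norm (h x) \<le> C * norm (h x) + C * norm (h x)"
    proof -
      have "0 \<le> inverse (w x)" using w0[OF that] by simp
      with C[OF that] have "0 \<le> C" by linarith
      then show ?thesis
        using C[OF that] w'_le[OF that] by (intro add_mono mult_mono) auto
    qed
    finally show ?thesis by simp
  qed
  have "framed_curve a b \<gamma> w w' T \<tau>"
    unfolding framed_curve_def
  proof (intro conjI ballI \<open>a < b\<close> w0 T1 w T)
    show "set_integrable lborel {a..b} (\<lambda>x. (norm (w' x))\<^sup>2)"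
      by (rule set_integrable_norm_square_bound[OF set_integrable_imp_measurable[OF primitive_on_integrable[OF w]] h2, of 1])
         (use w'_le in auto)
    show "set_integrable lborel {a..b} (\<lambda>x. (norm (\<tau> x))\<^sup>2)"
      by (rule set_integrable_norm_square_bound[OF set_integrable_imp_measurable[OF primitive_on_integrable[OF T]] h2 \<tau>_le])
    show "primitive_on a b \<gamma> (\<lambda>x. w x *\<^sub>R T x)"
      by (rule primitive_on_cong[OF \<gamma>v]) (simp_all add: T_def less_imp_neq[OF w0, symmetric])
  qed
  then show ?thesis by (rule that)
qed

locale framed =
  fixes a b :: real and \<gamma> :: "real \<Rightarrow> 'a::euclidean_space" and w w' T \<tau>
  assumes framed: "framed_curve a b \<gamma> w w' T \<tau>"
begin

lemma a_less_b: "a < b"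
  and speed_pos: "x \<in> {a..b} \<Longrightarrow> w x > 0"
  and norm_T: "x \<in> {a..b} \<Longrightarrow> norm (T x) = 1"
  and primitive_w: "primitive_on a b w w'"
  and primitive_T: "primitive_on a b T \<tau>"
  and primitive_\<gamma>: "primitive_on a b \<gamma> (\<lambda>x. w x *\<^sub>R T x)"
  and integrable_w'_square: "set_integrable lborel {a..b} (\<lambda>x. (norm (w' x))\<^sup>2)"
  and integrable_\<tau>_square: "set_integrable lborel {a..b} (\<lambda>x. (norm (\<tau> x))\<^sup>2)"
  using framed by (auto simp: framed_curve_def)

lemma continuous_w: "continuous_on {a..b} w"
  and continuous_T: "continuous_on {a..b} T"
  and continuous_velocity: "continuous_on {a..b} (\<lambda>x. w x *\<^sub>R T x)"
  by (intro continuous_intros primitive_on_continuous[OF primitive_w] primitive_on_continuous[OF primitive_T])+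

lemma continuous_inverse_w: "continuous_on {a..b} (\<lambda>x. inverse (w x))"
  using speed_pos by (intro continuous_on_inverse continuous_w) force

lemma velocity: "x \<in> {a..b} \<Longrightarrow> velocity a b \<gamma> x = w x *\<^sub>R T x"
  by (rule velocity_eq[OF primitive_\<gamma> continuous_velocity a_less_b])

lemma norm_velocity: "x \<in> {a..b} \<Longrightarrow> norm (velocity a b \<gamma> x) = w x"
  using speed_pos[of x] norm_T[of x] by (simp add: velocity)

lemma arclength_eq: "x \<le> b \<Longrightarrow> arclength a b \<gamma> x = (LBINT t:{a..x}. w t)"
  unfolding arclength_def by (intro set_lebesgue_integral_cong) (auto simp: norm_velocity)

lemma curve_length_eq: "curve_length a b \<gamma> = (LBINT t:{a..b}. w t)"
  by (simp add: curve_length_def arclength_eq)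

lemma AE_orthogonal: "AE x\<in>{a..b} in lborel. \<tau> x \<bullet> T x = 0"
  by (rule unit_primitive_orthogonal[OF primitive_T norm_T])

lemma has_weak_derivative_\<gamma>: "has_weak_derivative a b \<gamma> (\<lambda>x. w x *\<^sub>R T x)"
  by (rule primitive_on_imp_has_weak_derivative[OF primitive_\<gamma>])

lemma tangent_AE: "AE x\<in>{a<..<b} in lborel. tangent a b \<gamma> x = T x"
  using weak_derivative_AE(2)[OF has_weak_derivative_\<gamma>]
  by eventually_elim (auto simp: tangent_def arclength_derivative_def norm_velocity speed_pos less_imp_neq[OF speed_pos, symmetric])

text \<open>An arbitrary choice of \<open>weak_derivative\<close> is harmless: the local
  integrability built into \<open>has_weak_derivative\<close> makes every choice measurable on
  \<open>(a,b)\<close>.\<close>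

lemma measurable_arclength_derivative:
  fixes f :: "real \<Rightarrow> 'a"
  assumes "has_weak_derivative a b f g"
  shows "set_borel_measurable lborel {a<..<b} (arclength_derivative a b \<gamma> f)"
proof -
  have "locally_integrable a b (weak_derivative a b f)"
    using weak_derivative_AE(1)[OF assms] by (simp add: has_weak_derivative_def)
  then have 1: "set_borel_measurable lborel {a<..<b} (weak_derivative a b f)"
    by (rule locally_integrable_imp_measurable)
  have 2: "set_borel_measurable lborel {a<..<b} (\<lambda>x. inverse (w x))"
    by (rule set_borel_measurable_subset[OF set_borel_measurable_continuous[OF continuous_inverse_w]]) auto
  show ?thesis
    by (rule set_borel_measurable_cong_set[OF set_borel_measurable_bilinear[OF bounded_bilinear_scaleR 2 1]])
       (auto simp: arclength_derivative_def norm_velocity)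
qed

lemma has_weak_derivative_tangent: "has_weak_derivative a b (tangent a b \<gamma>) \<tau>"
proof (rule has_weak_derivative_cong_AE[OF primitive_on_imp_has_weak_derivative[OF primitive_T]])
  show "set_borel_measurable lborel {a<..<b} (tangent a b \<gamma>)"
    unfolding tangent_def by (rule measurable_arclength_derivative[OF has_weak_derivative_\<gamma>])
  show "AE x\<in>{a<..<b} in lborel. T x = tangent a b \<gamma> x"
    using tangent_AE by eventually_elim auto
qed

lemma curvature_AE: "AE x\<in>{a<..<b} in lborel. curvature a b \<gamma> x = \<tau> x /\<^sub>R w x"
  using weak_derivative_AE(2)[OF has_weak_derivative_tangent]
  by eventually_elim (auto simp: curvature_def arclength_derivative_def norm_velocity)

lemma signed_curvature_AE:
  "AE x\<in>{a<..<b} in lborel. signed_curvature a b \<gamma> e1 e2 x =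
     (\<tau> x /\<^sub>R w x) \<bullet> ((T x \<bullet> e1) *\<^sub>R e2 - (T x \<bullet> e2) *\<^sub>R e1)"
  using tangent_AE curvature_AE by eventually_elim (auto simp: signed_curvature_def Let_def)

lemma energy_integrable: "set_integrable lborel {a..b} (\<lambda>x. (norm (\<tau> x))\<^sup>2 / w x)"
  using set_integrable_bilinear_continuous[OF bounded_bilinear_mult integrable_\<tau>_square continuous_inverse_w]
  by (simp add: divide_inverse)

text \<open>With \<open>\<kappa> = \<tau> / w\<close>, the density
  \<open>|\<kappa>|\<^sup>2 ds\<close> becomes \<open>|\<tau>|\<^sup>2 / w\<close> in the given
  parameter.\<close>

lemma bending_energy_eq: "bending_energy a b \<gamma> = (LBINT x:{a..b}. (norm (\<tau> x))\<^sup>2 / w x)"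
proof -
  have "bending_energy a b \<gamma> = (LBINT x:{a<..<b}. (norm (\<tau> x))\<^sup>2 / w x)"
    unfolding bending_energy_def set_lebesgue_integral_def
  proof (rule integral_cong_AE)
    have "set_borel_measurable lborel {a<..<b} (curvature a b \<gamma>)"
      unfolding curvature_def by (rule measurable_arclength_derivative[OF has_weak_derivative_tangent])
    moreover have "set_borel_measurable lborel {a<..<b} w"
      by (rule set_borel_measurable_subset[OF set_borel_measurable_continuous[OF continuous_w]]) auto
    ultimately have "set_borel_measurable lborel {a<..<b} (\<lambda>x. (norm (curvature a b \<gamma> x))\<^sup>2 * w x)"
      by (intro set_borel_measurable_bilinear[OF bounded_bilinear_mult] set_borel_measurable_norm_square)
    then have "set_borel_measurable lborel {a<..<b} (\<lambda>x. (norm (curvature a b \<gamma> x))\<^sup>2 * norm (velocity a b \<gamma> x))"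
      by (rule set_borel_measurable_cong_set) (auto simp: norm_velocity)
    then show "(\<lambda>x. indicat_real {a<..<b} x *\<^sub>R ((norm (curvature a b \<gamma> x))\<^sup>2 * norm (velocity a b \<gamma> x)))
        \<in> borel_measurable lborel"
      by (simp add: set_borel_measurable_def)
    show "(\<lambda>x. indicat_real {a<..<b} x *\<^sub>R ((norm (\<tau> x))\<^sup>2 / w x)) \<in> borel_measurable lborel"
      using energy_integrable unfolding set_integrable_Ioo_Icc[symmetric] by (simp add: set_integrable_def)
    show "AE x in lborel. indicat_real {a<..<b} x *\<^sub>R ((norm (curvature a b \<gamma> x))\<^sup>2 * norm (velocity a b \<gamma> x)) =
       indicat_real {a<..<b} x *\<^sub>R ((norm (\<tau> x))\<^sup>2 / w x)"
      using curvature_AE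
    proof eventually_elim
      case (elim x)
      show ?case
      proof (cases "x \<in> {a<..<b}")
        case True
        with elim speed_pos[of x] norm_velocity[of x] show ?thesis
          by (simp add: power_mult_distrib power2_eq_square field_simps)
      qed simp
    qed
  qed
  then show ?thesis by (simp add: set_integral_Ioo_Icc)
qed

text \<open>The converse of \<open>immersed_H2_curve_imp_framed\<close>, used for leaves and for the
  constructed curve. The second derivative \<open>w' T + w \<tau>\<close> is square integrable
  because \<open>T\<close> is a unit vector and \<open>w\<close> is bounded.\<close>

lemma immersed: "immersed_H2_curve a b \<gamma>"
  unfolding immersed_H2_curve_def H2_curve_def W22_def
proof (intro conjI ballI exI a_less_b primitive_on_continuous[OF primitive_\<gamma>])
  let ?h = "\<lambda>x. w' x *\<^sub>R T x + w x *\<^sub>R \<tau> x"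
  have v: "primitive_on a b (\<lambda>x. w x *\<^sub>R T x) ?h"
    by (rule primitive_on_bilinear[OF bounded_bilinear_scaleR primitive_w primitive_T])
  show "square_integrable a b \<gamma>"
    by (rule square_integrable_continuous[OF primitive_on_continuous[OF primitive_\<gamma>]])
  show "has_weak_derivative a b \<gamma> (\<lambda>x. w x *\<^sub>R T x)" by (rule has_weak_derivative_\<gamma>)
  show "square_integrable a b (\<lambda>x. w x *\<^sub>R T x)"
    by (rule square_integrable_continuous[OF continuous_velocity])
  show "has_weak_derivative a b (\<lambda>x. w x *\<^sub>R T x) ?h"
    by (rule primitive_on_imp_has_weak_derivative[OF v])
  have hm: "set_borel_measurable lborel {a..b} ?h"
    by (rule set_integrable_imp_measurable[OF primitive_on_integrable[OF v]])
  have "bounded (w ` {a..b})"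
    by (intro compact_imp_bounded compact_continuous_image compact_Icc continuous_w)
  then obtain C where "\<forall>y\<in>w ` {a..b}. norm y \<le> C"
    unfolding bounded_iff by blast
  then have C: "\<bar>w x\<bar> \<le> C" if "x \<in> {a..b}" for x using that by auto
  have "set_integrable lborel {a..b} (\<lambda>x. (norm (?h x))\<^sup>2)"
  proof (rule set_integrable_bound)
    show "set_integrable lborel {a..b} (\<lambda>x. 2 * (norm (w' x))\<^sup>2 + 2 * C\<^sup>2 * (norm (\<tau> x))\<^sup>2)"
      using integrable_w'_square integrable_\<tau>_square by (intro set_integral_add) auto
    have "(norm (?h x))\<^sup>2 \<le> 2 * (norm (w' x))\<^sup>2 + 2 * C\<^sup>2 * (norm (\<tau> x))\<^sup>2" if x: "x \<in> {a..b}" for x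
    proof -
      have "norm (?h x) \<le> norm (w' x) + \<bar>w x\<bar> * norm (\<tau> x)"
        by (rule norm_triangle_le) (simp add: norm_T[OF x])
      also have "\<dots> \<le> norm (w' x) + C * norm (\<tau> x)"
        using C[OF x] by (intro add_left_mono mult_right_mono) auto
      finally have "(norm (?h x))\<^sup>2 \<le> (norm (w' x) + C * norm (\<tau> x))\<^sup>2"
        by (rule power_mono) simp
      also have "\<dots> \<le> 2 * (norm (w' x))\<^sup>2 + 2 * C\<^sup>2 * (norm (\<tau> x))\<^sup>2"
        using zero_le_power2[of "norm (w' x) - C * norm (\<tau> x)"]
        by (simp add: power2_eq_square algebra_simps)
      finally show ?thesis .
    qed
    then show "AE x in lborel. x \<in> {a..b} \<longrightarrow> norm ((norm (?h x))\<^sup>2) \<le>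
        norm (2 * (norm (w' x))\<^sup>2 + 2 * C\<^sup>2 * (norm (\<tau> x))\<^sup>2)"
      by auto
  qed (rule set_borel_measurable_norm_square[OF hm])
  then show "square_integrable a b ?h"
    unfolding square_integrable_def set_integrable_Ioo_Icc
    by (intro conjI set_borel_measurable_subset[OF hm]) auto
  show "velocity a b \<gamma> x \<noteq> 0" if "x \<in> {a..b}" for x
    using norm_velocity[OF that] speed_pos[OF that] by auto
qed

lemma subinterval:
  assumes "a \<le> c" "c < d" "d \<le> b"
  shows "framed_curve c d \<gamma> w w' T \<tau>"
proof -
  have sub: "{c..d} \<subseteq> {a..b}" using assms by auto
  have "set_integrable lborel {c..d} (\<lambda>x. (norm (w' x))\<^sup>2)" "set_integrable lborel {c..d} (\<lambda>x. (norm (\<tau> x))\<^sup>2)"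
    using set_integrable_subset[OF integrable_w'_square _ sub] set_integrable_subset[OF integrable_\<tau>_square _ sub]
    by auto
  then show ?thesis
    unfolding framed_curve_def
    using speed_pos norm_T assms primitive_on_subinterval[OF primitive_w assms(1,3)]
      primitive_on_subinterval[OF primitive_T assms(1,3)] primitive_on_subinterval[OF primitive_\<gamma> assms(1,3)]
    by (intro conjI ballI) auto
qed

lemma w_integrable: "a \<le> c \<Longrightarrow> d \<le> b \<Longrightarrow> set_integrable lborel {c..d} w"
  by (rule borel_integrable_atLeastAtMost'[OF continuous_on_subset[OF continuous_w]]) auto

lemma w_integral_pos:
  assumes "a \<le> c" "c < d" "d \<le> b"
  shows "(LBINT t:{c..d}. w t) > 0"
proof -
  have "continuous_on {c..d} w" using assms by (intro continuous_on_subset[OF continuous_w]) auto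
  then have "integral {c..d} (\<lambda>_. 0) < integral {c..d} w"
    using assms speed_pos by (intro integral_less_real) (auto intro: integrable_continuous_real)
  with w_integrable[OF assms(1,3)] show ?thesis by (simp add: set_borel_integral_eq_integral)
qed

end

section \<open>Elliptic integrals\<close>

lemma interval_integral_has_derivative:
  fixes f :: "real \<Rightarrow> real"
  assumes "continuous_on UNIV f"
  shows "((\<lambda>u. LBINT y=ereal 0..ereal u. f y) has_real_derivative f x) (at x)"
proof -
  define M where "M = \<bar>x\<bar> + 1"
  have "((\<lambda>u. LBINT y=ereal 0..ereal u. f y) has_vector_derivative f x) (at x within {-M..M})"
    by (rule interval_integral_FTC2) (auto simp: M_def intro: continuous_on_subset[OF assms])
  then have "((\<lambda>u. LBINT y=ereal 0..ereal u. f y) has_vector_derivative f x) (at x within {-M<..<M})"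
    by (rule has_vector_derivative_within_subset) auto
  moreover have "x \<in> {-M<..<M}" by (auto simp: M_def)
  ultimately show ?thesis
    unfolding has_real_derivative_iff_has_vector_derivative
    using at_within_open[of x "{-M<..<M}"] by (simp del: greaterThanLessThan_iff)
qed

lemma interval_integral_eq_Icc:
  fixes f :: "real \<Rightarrow> real"
  assumes "continuous_on {0..u} f" "0 \<le> u"
  shows "(LBINT y=ereal 0..ereal u. f y) = integral {0..u} f"
  using interval_integral_Icc[OF assms(2), of f]
    set_borel_integral_eq_integral(2)[OF borel_integrable_atLeastAtMost'[OF assms(1)]]
  by simp

text \<open>Legendre's Delta; at \<open>\<theta> = jacobi_am u m\<close> it is the Jacobi function
  dn.\<close>

definition ell_delta :: "real \<Rightarrow> real \<Rightarrow> real" where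
  "ell_delta m \<theta> = sqrt (1 - m * (sin \<theta>)\<^sup>2)"

lemma ell_delta_arg_pos: "(m::real) < 1 \<Longrightarrow> 0 < 1 - m * (sin \<theta>)\<^sup>2"
proof -
  assume m: "m < 1"
  have s: "(sin \<theta>)\<^sup>2 \<le> 1" by (simp add: abs_square_le_1)
  have s': "0 \<le> (sin \<theta>)\<^sup>2" by simp
  show ?thesis
  proof (cases "m \<le> 0")
    case True
    then show ?thesis using mult_nonpos_nonneg[OF True s'] by linarith
  next
    case False
    then show ?thesis using mult_left_mono[OF s, of m] m by linarith
  qed
qed

lemma ell_delta_pos: "m < 1 \<Longrightarrow> 0 < ell_delta m \<theta>"
  using ell_delta_arg_pos[of m \<theta>] by (simp add: ell_delta_def)

lemma ell_delta_square: "m < 1 \<Longrightarrow> (ell_delta m \<theta>)\<^sup>2 = 1 - m * (sin \<theta>)\<^sup>2"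
  using ell_delta_arg_pos[of m \<theta>] by (simp add: ell_delta_def)

lemma ell_delta_nz: "m < 1 \<Longrightarrow> ell_delta m \<theta> \<noteq> 0"
  using ell_delta_pos[of m \<theta>] by simp

lemma ell_delta_le_1: "0 \<le> m \<Longrightarrow> ell_delta m \<theta> \<le> 1"
  by (simp add: ell_delta_def)

lemma continuous_ell_delta [continuous_intros]: "continuous_on S (ell_delta m)"
  unfolding ell_delta_def by (intro continuous_intros)

lemma ell_delta_minus [simp]: "ell_delta m (- \<theta>) = ell_delta m \<theta>"
  by (simp add: ell_delta_def)

lemma ell_delta_has_derivative:
  assumes "m < 1"
  shows "(ell_delta m has_real_derivative - m * sin \<theta> * cos \<theta> / ell_delta m \<theta>) (at \<theta>)"
  unfolding ell_delta_def
  using ell_delta_arg_pos[OF assms, of \<theta>]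
  by (auto intro!: derivative_eq_intros simp: field_simps)

lemma continuous_inverse_ell_delta: "m < 1 \<Longrightarrow> continuous_on S (\<lambda>\<theta>. 1 / ell_delta m \<theta>)"
  by (intro continuous_intros) (simp add: ell_delta_nz)

lemma ellF_has_derivative:
  assumes "m < 1"
  shows "((\<lambda>x. ellF x m) has_real_derivative 1 / ell_delta m x) (at x)"
  unfolding ellF_def ell_delta_def[symmetric]
  by (rule interval_integral_has_derivative[OF continuous_inverse_ell_delta[OF assms]])

lemma ellF_0 [simp]: "ellF 0 m = 0"
  by (simp add: ellF_def)

lemma ellF_strict_mono: "m < 1 \<Longrightarrow> x < y \<Longrightarrow> ellF x m < ellF y m"
  by (rule DERIV_pos_imp_increasing[of x y "\<lambda>x. ellF x m"])
     (auto intro!: exI[of _ "1 / ell_delta m _"] ellF_has_derivative ell_delta_pos)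

lemma odd_if_even_derivative:
  fixes I f :: "real \<Rightarrow> real"
  assumes I: "\<And>x. (I has_real_derivative f x) (at x)" and f: "\<And>x. f (- x) = f x" and "I 0 = 0"
  shows "I (- x) = - I x"
proof -
  have "\<forall>x. DERIV (\<lambda>x. I (- x) + I x) x :> 0"
  proof
    fix x
    have "DERIV (\<lambda>x. I (- x)) x :> f (- x) * (- 1)"
      by (rule DERIV_chain2[OF I]) (auto intro!: derivative_eq_intros)
    from DERIV_add[OF this I[of x]] show "DERIV (\<lambda>x. I (- x) + I x) x :> 0" by (simp add: f)
  qed
  from DERIV_isconst_all[OF this, of x 0] \<open>I 0 = 0\<close> show ?thesis by simp
qed

lemma ellF_minus: "m < 1 \<Longrightarrow> ellF (- x) m = - ellF x m"
  by (rule odd_if_even_derivative[OF ellF_has_derivative]) simp_all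

lemma isCont_ellF: "m < 1 \<Longrightarrow> isCont (\<lambda>x. ellF x m) x"
  using ellF_has_derivative DERIV_isCont by blast

text \<open>The integrand is at least 1. The growth makes \<open>ellF\<close> surjective, so that
  the inverse in \<open>jacobi_am\<close> is a true inverse on both sides.\<close>

lemma ellF_ge: "0 \<le> m \<Longrightarrow> m < 1 \<Longrightarrow> 0 \<le> x \<Longrightarrow> x \<le> ellF x m"
proof -
  assume m: "0 \<le> m" "m < 1" and x: "0 \<le> x"
  have "ellF 0 m - 0 \<le> ellF x m - x"
  proof (rule DERIV_nonneg_imp_nondecreasing[OF x, of "\<lambda>x. ellF x m - x"])
    fix y
    have "((\<lambda>x. ellF x m - x) has_real_derivative 1 / ell_delta m y - 1) (at y)"
      by (intro DERIV_diff ellF_has_derivative m DERIV_ident)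
    moreover have "0 \<le> 1 / ell_delta m y - 1"
      using ell_delta_pos[OF m(2), of y] ell_delta_le_1[OF m(1), of y] by (simp add: field_simps)
    ultimately show "\<exists>D. ((\<lambda>x. ellF x m - x) has_real_derivative D) (at y) \<and> 0 \<le> D" by blast
  qed
  then show ?thesis by simp
qed

lemma jacobi_am_ellF: "m < 1 \<Longrightarrow> jacobi_am (ellF x m) m = x"
proof -
  assume m: "m < 1"
  have "inj (\<lambda>y. ellF y m)"
    by (rule injI) (metis ellF_strict_mono[OF m] linorder_neqE_linordered_idom less_irrefl)
  then show ?thesis unfolding jacobi_am_def by (rule inv_f_f)
qed

lemma ellF_jacobi_am: "0 \<le> m \<Longrightarrow> m < 1 \<Longrightarrow> ellF (jacobi_am u m) m = u"
proof -
  assume m: "0 \<le> m" "m < 1"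
  have "ellF (- \<bar>u\<bar>) m \<le> u" "u \<le> ellF \<bar>u\<bar> m"
    using ellF_ge[OF m, of "\<bar>u\<bar>"] by (auto simp: ellF_minus[OF m(2)])
  then obtain x where "ellF x m = u"
    using IVT[of "\<lambda>x. ellF x m" "- \<bar>u\<bar>" u "\<bar>u\<bar>"] isCont_ellF[OF m(2)] by auto
  then show ?thesis using jacobi_am_ellF[OF m(2), of x] by simp
qed

lemma jacobi_am_has_derivative:
  assumes m: "0 \<le> m" "m < 1"
  shows "((\<lambda>u. jacobi_am u m) has_real_derivative ell_delta m (jacobi_am u m)) (at u)"
proof -
  have "isCont (\<lambda>u. jacobi_am u m) (ellF (jacobi_am u m) m)"
    by (rule isCont_inverse_function[of 1]) (auto simp: jacobi_am_ellF m isCont_ellF)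
  then have c: "isCont (\<lambda>u. jacobi_am u m) u" by (simp add: ellF_jacobi_am m)
  have "((\<lambda>u. jacobi_am u m) has_real_derivative inverse (1 / ell_delta m (jacobi_am u m))) (at u)"
    by (rule DERIV_inverse_function[OF ellF_has_derivative[OF m(2)] _ _ _ _ c, of "u - 1" "u + 1"])
       (auto simp: ellF_jacobi_am m ell_delta_nz)
  then show ?thesis by simp
qed

section \<open>Complete integrals and the strict convexity of \<open>ell_W\<close>\<close>

lemma ellK_eq: "m < 1 \<Longrightarrow> ellK m = integral {0..pi / 2} (\<lambda>\<theta>. 1 / ell_delta m \<theta>)"
  unfolding ellK_def ellF_def ell_delta_def[symmetric]
  by (rule interval_integral_eq_Icc) (auto intro: continuous_inverse_ell_delta)

lemma ellE_eq: "ellE m = integral {0..pi / 2} (ell_delta m)"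
  unfolding ellE_def ell_delta_def[symmetric]
  by (rule interval_integral_eq_Icc) (auto intro: continuous_ell_delta)

lemma ellK_pos: "m < 1 \<Longrightarrow> 0 < ellK m"
  using ellF_strict_mono[of m 0 "pi/2"] by (simp add: ellK_def)

text \<open>The junk value \<open>0/0 = 0\<close> extends the integrand continuously to \<open>m = 1\<close>, \<open>cos t = 0\<close>.\<close>

definition ell_Q :: "real \<Rightarrow> real \<Rightarrow> real" where
  "ell_Q m \<psi> = (LBINT t=ereal 0..ereal \<psi>. (cos t)\<^sup>2 / ell_delta m t)"

text \<open>The function \<open>W = E - (1 - m) K\<close> in a form that stays meaningful at
  \<open>m = 1\<close>, where the integral for \<open>K\<close> diverges.\<close>

definition ell_W :: "real \<Rightarrow> real" where
  "ell_W m = m * ell_Q m (pi / 2)"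

lemma ell_delta_1: "ell_delta 1 t = \<bar>cos t\<bar>"
proof -
  have "1 - 1 * (sin t)\<^sup>2 = (cos t)\<^sup>2" using sin_cos_squared_add[of t] by linarith
  then show ?thesis unfolding ell_delta_def by (simp only: real_sqrt_abs)
qed

lemma continuous_Q_integrand: "m \<le> 1 \<Longrightarrow> continuous_on S (\<lambda>t. (cos t)\<^sup>2 / ell_delta m t)"
proof (cases "m = 1")
  case True
  have "(\<lambda>t. (cos t)\<^sup>2 / ell_delta m t) = (\<lambda>t. \<bar>cos t\<bar>)"
  proof
    fix t :: real
    have "(cos t)\<^sup>2 = \<bar>cos t\<bar> * \<bar>cos t\<bar>" by (simp only: power2_eq_square abs_mult_self_eq)
    then show "(cos t)\<^sup>2 / ell_delta m t = \<bar>cos t\<bar>"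
      unfolding True ell_delta_1
      using nonzero_mult_div_cancel_left[of "\<bar>cos t\<bar>" "\<bar>cos t\<bar>"] by (cases "cos t = 0") auto
  qed
  then show ?thesis by (simp only: continuous_on_rabs[OF continuous_on_cos[OF continuous_on_id]])
next
  case False
  assume "m \<le> 1"
  with False show ?thesis by (intro continuous_intros) (simp add: ell_delta_nz)
qed

lemma ell_Q_has_derivative:
  "m \<le> 1 \<Longrightarrow> (ell_Q m has_real_derivative (cos \<psi>)\<^sup>2 / ell_delta m \<psi>) (at \<psi>)"
  unfolding ell_Q_def[abs_def]
  by (rule interval_integral_has_derivative[OF continuous_Q_integrand])

lemma ell_Q_0 [simp]: "ell_Q m 0 = 0"
  by (simp add: ell_Q_def)

lemma ell_Q_minus: "m \<le> 1 \<Longrightarrow> ell_Q m (- x) = - ell_Q m x"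
  by (rule odd_if_even_derivative[OF ell_Q_has_derivative]) simp_all

lemma ell_W_eq_integral:
  "m \<le> 1 \<Longrightarrow> ell_W m = integral {0..pi / 2} (\<lambda>t. m * ((cos t)\<^sup>2 / ell_delta m t))"
  unfolding ell_W_def ell_Q_def integral_mult_right
  by (subst interval_integral_eq_Icc) (auto intro: continuous_Q_integrand)

lemma cos_pos_quarter: "x \<in> {0<..<pi/2} \<Longrightarrow> 0 < cos x"
  by (rule cos_gt_zero) auto

lemma sin_pos_quarter: "x \<in> {0<..<pi/2} \<Longrightarrow> 0 < sin x"
  by (rule sin_gt_zero) (auto simp: pi_half_gt_zero[THEN less_trans])

text \<open>Pointwise, \<open>m (cos t)\<^sup>2\<close> is the square of
  \<open>ell_delta m t\<close> minus \<open>1 - m\<close>; division by \<open>ell_delta m t\<close>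
  gives the integrands of \<open>E\<close> and \<open>K\<close>.\<close>

lemma ell_W_eq: "m < 1 \<Longrightarrow> ell_W m = ellE m - (1 - m) * ellK m"
proof -
  assume m: "m < 1"
  have "ell_W m = integral {0..pi / 2} (\<lambda>t. ell_delta m t - (1 - m) * (1 / ell_delta m t))"
    unfolding ell_W_eq_integral[OF less_imp_le[OF m]]
  proof (rule integral_cong)
    fix t
    have "m * (cos t)\<^sup>2 = (ell_delta m t)\<^sup>2 - (1 - m)"
      by (simp add: ell_delta_square[OF m] cos_squared_eq algebra_simps)
    then show "m * ((cos t)\<^sup>2 / ell_delta m t) = ell_delta m t - (1 - m) * (1 / ell_delta m t)"
      using ell_delta_nz[OF m, of t] by (simp add: field_simps power2_eq_square)
  qed
  also have "\<dots> = integral {0..pi / 2} (ell_delta m) - integral {0..pi / 2} (\<lambda>t. (1 - m) * (1 / ell_delta m t))"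
    by (rule Henstock_Kurzweil_Integration.integral_diff)
       (intro integrable_continuous_real continuous_on_mult continuous_on_const continuous_inverse_ell_delta[OF m] continuous_ell_delta)+
  also have "\<dots> = ellE m - (1 - m) * ellK m"
    unfolding ellE_eq ellK_eq[OF m] integral_mult_right ..
  finally show ?thesis .
qed

text \<open>The derivative of \<open>E - (1 - m) K\<close> with respect to \<open>m\<close> is \<open>K / 2\<close>.\<close>

lemma integral_ell_W_slope:
  assumes m: "m < 1"
  shows "integral {0..pi / 2} (\<lambda>t. (cos t)\<^sup>2 * (1 + (ell_delta m t)\<^sup>2) / (2 * (ell_delta m t) ^ 3)) = ellK m / 2"
proof -
  let ?p = "ell_delta m"
  \<comment> \<open>The integrand on the left of the claim is the m-derivative of
    \<open>m (cos t)\<^sup>2 / ell_delta m t\<close>. It differs from half the integrand of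
    \<open>K\<close> by half the derivative of this function, which vanishes at 0 and
    \<open>pi / 2\<close>.\<close>
  have der: "((\<lambda>t. sin t * cos t / ?p t) has_real_derivative
      ((cos t)\<^sup>2 * (1 + (?p t)\<^sup>2) - (?p t)\<^sup>2) / (?p t) ^ 3) (at t)" for t
  proof -
    have "((\<lambda>t. sin t * cos t / ?p t) has_real_derivative
      ((cos t * cos t + sin t * (- sin t)) * ?p t - (sin t * cos t) * (- m * sin t * cos t / ?p t)) / (?p t * ?p t)) (at t)"
      by (rule DERIV_divide[OF _ ell_delta_has_derivative[OF m] ell_delta_nz[OF m]])
         (auto intro!: derivative_eq_intros)
    moreover have "((cos t * cos t + sin t * (- sin t)) * ?p t - (sin t * cos t) * (- m * sin t * cos t / ?p t)) / (?p t * ?p t)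
       = ((cos t)\<^sup>2 * (1 + (?p t)\<^sup>2) - (?p t)\<^sup>2) / (?p t) ^ 3"
    proof -
      define p s c where "p = ?p t" and "s = sin t" and "c = cos t"
      have p: "p \<noteq> 0" "p\<^sup>2 = 1 - m * s\<^sup>2" and sc: "c\<^sup>2 = 1 - s\<^sup>2"
        using ell_delta_nz[OF m] ell_delta_square[OF m] by (auto simp: p_def s_def c_def cos_squared_eq)
      have "((c * c + s * (- s)) * p - (s * c) * (- m * s * c / p)) / (p * p) = ((c\<^sup>2 - s\<^sup>2) * p\<^sup>2 + m * s\<^sup>2 * c\<^sup>2) / p ^ 3"
        using p(1) by (simp add: field_simps power2_eq_square power3_eq_cube)
      also have "(c\<^sup>2 - s\<^sup>2) * p\<^sup>2 + m * s\<^sup>2 * c\<^sup>2 = c\<^sup>2 * (1 + p\<^sup>2) - p\<^sup>2"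
        unfolding p(2) sc by (simp add: algebra_simps power2_eq_square)
      finally show ?thesis unfolding p_def s_def c_def .
    qed
    ultimately show ?thesis by simp
  qed
  have "((\<lambda>t. ((cos t)\<^sup>2 * (1 + (?p t)\<^sup>2) - (?p t)\<^sup>2) / (?p t) ^ 3) has_integral
      sin (pi/2) * cos (pi/2) / ?p (pi/2) - sin 0 * cos 0 / ?p 0) {0..pi / 2}"
    by (rule fundamental_theorem_of_calculus)
       (auto intro!: has_field_derivative_at_within[OF der] simp flip: has_real_derivative_iff_has_vector_derivative)
  then have 1: "integral {0..pi/2} (\<lambda>t. ((cos t)\<^sup>2 * (1 + (?p t)\<^sup>2) - (?p t)\<^sup>2) / (?p t) ^ 3) = 0"
    by (simp add: integral_unique)
  have "integral {0..pi / 2} (\<lambda>t. (cos t)\<^sup>2 * (1 + (?p t)\<^sup>2) / (2 * (?p t) ^ 3)) =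
    integral {0..pi / 2} (\<lambda>t. (1/2) * (((cos t)\<^sup>2 * (1 + (?p t)\<^sup>2) - (?p t)\<^sup>2) / (?p t) ^ 3) + (1/2) * (1 / ?p t))"
  proof (rule integral_cong)
    fix t
    have "?p t \<noteq> 0" by (rule ell_delta_nz[OF m])
    then show "(cos t)\<^sup>2 * (1 + (?p t)\<^sup>2) / (2 * (?p t) ^ 3) =
      (1/2) * (((cos t)\<^sup>2 * (1 + (?p t)\<^sup>2) - (?p t)\<^sup>2) / (?p t) ^ 3) + (1/2) * (1 / ?p t)"
      by (simp add: field_simps power2_eq_square power3_eq_cube)
  qed
  also have "\<dots> = integral {0..pi / 2} (\<lambda>t. (1/2) * (((cos t)\<^sup>2 * (1 + (?p t)\<^sup>2) - (?p t)\<^sup>2) / (?p t) ^ 3))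
      + integral {0..pi / 2} (\<lambda>t. (1/2) * (1 / ?p t))"
    by (rule Henstock_Kurzweil_Integration.integral_add)
       (intro integrable_continuous_real continuous_intros; simp add: ell_delta_nz[OF m])+
  also have "\<dots> = ellK m / 2"
    unfolding integral_mult_right 1 by (simp add: ellK_eq[OF m])
  finally show ?thesis .
qed

text \<open>For fixed \<open>t\<close> the integrand of \<open>ell_W\<close> is strictly convex in
  \<open>m\<close> and thus lies above its tangent at \<open>n\<close>. The proof is an explicit
  factorisation of the gap and covers \<open>m = 1\<close>, since \<open>cos t > 0\<close> inside
  the interval.\<close>

lemma ell_W_integrand_tangent:
  assumes m: "0 \<le> m" "m \<le> 1" and n: "0 < n" "n < 1" and "m \<noteq> n" and t: "t \<in> {0<..<pi/2}"
  shows "n * ((cos t)\<^sup>2 / ell_delta n t) + (m - n) * ((cos t)\<^sup>2 * (1 + (ell_delta n t)\<^sup>2) / (2 * (ell_delta n t) ^ 3))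
      < m * ((cos t)\<^sup>2 / ell_delta m t)"
proof -
  define s c p q where "s = (sin t)\<^sup>2" and "c = (cos t)\<^sup>2" and "p = ell_delta m t" and "q = ell_delta n t"
  have s: "0 < s" and c: "0 < c" and sc: "s + c = 1"
    using sin_pos_quarter[OF t] cos_pos_quarter[OF t] by (auto simp: s_def c_def)
  have "s < 1" using c sc by linarith
  have ms: "0 < 1 - m * s" using m s \<open>s < 1\<close> mult_right_mono[of m 1 s] by linarith
  have q: "0 < q" "q\<^sup>2 = 1 - n * s"
    using ell_delta_pos[OF n(2)] ell_delta_square[OF n(2)] by (auto simp: q_def s_def)
  have p: "0 < p" "p\<^sup>2 = 1 - m * s"
    using ms by (auto simp: p_def s_def ell_delta_def)
  have "p \<noteq> q" using p(2) q(2) \<open>m \<noteq> n\<close> s by auto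
  \<comment> \<open>Substituting \<open>m * s = 1 - p\<^sup>2\<close> and
    \<open>n * s = 1 - q\<^sup>2\<close> leaves a polynomial in \<open>p\<close> and
    \<open>q\<close> with the double root \<open>p = q\<close>; the other factor is
    positive.\<close>
  have "m / p - n / q - (m - n) * ((1 + q\<^sup>2) / (2 * q ^ 3)) = (q - p)\<^sup>2 * (2 * q + p + q\<^sup>2 * p) / (2 * q ^ 3 * p * s)"
  proof -
    let ?D = "m / p - n / q - (m - n) * ((1 + q\<^sup>2) / (2 * q ^ 3))"
    have "?D * (2 * q ^ 3 * p * s) = 2 * q ^ 3 * (m * s) - 2 * q\<^sup>2 * p * (n * s) - p * (m * s - n * s) * (1 + q\<^sup>2)"
      using p(1) q(1) by (simp add: field_simps power2_eq_square power3_eq_cube)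
    also have "m * s = 1 - p\<^sup>2" using p(2) by simp
    also have "n * s = 1 - q\<^sup>2" using q(2) by simp
    also have "2 * q ^ 3 * (1 - p\<^sup>2) - 2 * q\<^sup>2 * p * (1 - q\<^sup>2) - p * (1 - p\<^sup>2 - (1 - q\<^sup>2)) * (1 + q\<^sup>2)
        = (q - p)\<^sup>2 * (2 * q + p + q\<^sup>2 * p)"
      by (simp add: algebra_simps power2_eq_square power3_eq_cube)
    finally show ?thesis using p(1) q(1) s by (simp add: eq_divide_eq)
  qed
  moreover have "0 < (q - p)\<^sup>2 * (2 * q + p + q\<^sup>2 * p) / (2 * q ^ 3 * p * s)"
    using p(1) q(1) s \<open>p \<noteq> q\<close> by (intro divide_pos_pos mult_pos_pos add_pos_pos) auto
  ultimately have "0 < c * (m / p - n / q - (m - n) * ((1 + q\<^sup>2) / (2 * q ^ 3)))"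
    using c by (simp only: mult_pos_pos)
  then have "n * (c / q) + (m - n) * (c * (1 + q\<^sup>2) / (2 * q ^ 3)) < m * (c / p)"
    by (simp add: algebra_simps)
  then show ?thesis by (simp add: p_def q_def c_def)
qed

text \<open>The tangent inequality for the integrands is integrated, with slope
  \<open>K(n) / 2\<close> from \<open>integral_ell_W_slope\<close>; there is no differentiation
  under the integral, and \<open>m = 1\<close> stays included.\<close>

lemma ell_W_tangent:
  assumes m: "0 \<le> m" "m \<le> 1" and n: "0 < n" "n < 1" and "m \<noteq> n"
  shows "ell_W n + (m - n) * (ellK n / 2) < ell_W m"
proof -
  let ?A = "\<lambda>t. n * ((cos t)\<^sup>2 / ell_delta n t)"
  let ?B = "\<lambda>t. (m - n) * ((cos t)\<^sup>2 * (1 + (ell_delta n t)\<^sup>2) / (2 * (ell_delta n t) ^ 3))"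
  have cA: "continuous_on {0..pi/2} ?A" and cB: "continuous_on {0..pi/2} ?B"
    by (intro continuous_intros; simp add: ell_delta_nz[OF n(2)])+
  have "ell_W n + (m - n) * (ellK n / 2) = integral {0..pi/2} ?A + integral {0..pi/2} ?B"
    unfolding integral_mult_right integral_ell_W_slope[OF n(2)]
    using n by (simp only: ell_W_eq_integral[OF less_imp_le[OF n(2)]] integral_mult_right)
  also have "\<dots> = integral {0..pi/2} (\<lambda>t. ?A t + ?B t)"
    by (rule Henstock_Kurzweil_Integration.integral_add[symmetric])
       (rule integrable_continuous_real cA cB)+
  also have "\<dots> < integral {0..pi/2} (\<lambda>t. m * ((cos t)\<^sup>2 / ell_delta m t))"
  proof (rule integral_less_real)
    show "continuous_on {0..pi/2} (\<lambda>t. ?A t + ?B t)" by (rule continuous_on_add[OF cA cB])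
    show "continuous_on {0..pi/2} (\<lambda>t. m * ((cos t)\<^sup>2 / ell_delta m t))"
      by (rule continuous_on_mult[OF continuous_on_const continuous_Q_integrand[OF m(2)]])
    show "{0<..<pi/2} \<noteq> {}" using pi_gt_zero by (simp add: not_le)
  qed (rule ell_W_integrand_tangent[OF assms])
  also have "\<dots> = ell_W m" using m by (simp add: ell_W_eq_integral)
  finally show ?thesis .
qed

lemma ell_W_pos: "0 < m \<Longrightarrow> m < 1 \<Longrightarrow> 0 < ell_W m"
proof -
  assume m: "0 < m" "m < 1"
  have "integral {0..pi/2} (\<lambda>_. 0) < integral {0..pi/2} (\<lambda>t. m * ((cos t)\<^sup>2 / ell_delta m t))"
  proof (rule integral_less_real)
    show "continuous_on {0..pi/2} (\<lambda>t. m * ((cos t)\<^sup>2 / ell_delta m t))"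
      using m by (intro continuous_on_mult continuous_on_const continuous_Q_integrand) auto
    show "{0<..<pi/2} \<noteq> {}" using pi_gt_zero by (simp add: not_le)
    show "0 < m * ((cos t)\<^sup>2 / ell_delta m t)" if "t \<in> {0<..<pi/2}" for t
      using m ell_delta_pos[OF m(2)] cos_pos_quarter[OF that] by simp
  qed simp
  then show ?thesis using m by (simp add: ell_W_eq_integral)
qed

section \<open>Monotonicity in the parameter and the number \<open>m_star\<close>\<close>

lemma ellK_strict_mono: "m < n \<Longrightarrow> n < 1 \<Longrightarrow> ellK m < ellK n"
proof -
  assume mn: "m < n" "n < 1"
  have "integral {0..pi/2} (\<lambda>t. 1 / ell_delta m t) < integral {0..pi/2} (\<lambda>t. 1 / ell_delta n t)"
  proof (rule integral_less_real)
    show "{0<..<pi/2} \<noteq> {}" using pi_gt_zero by (simp add: not_le)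
    fix t :: real assume t: "t \<in> {0<..<pi/2}"
    have "ell_delta n t < ell_delta m t"
      using mn sin_pos_quarter[OF t] by (simp add: ell_delta_def)
    then show "1 / ell_delta m t < 1 / ell_delta n t"
      using ell_delta_pos[of n t] mn by (simp add: frac_less2)
  qed (use mn in \<open>auto intro: continuous_inverse_ell_delta\<close>)
  then show ?thesis using mn by (simp add: ellK_eq)
qed

lemma ellE_mono: "m \<le> n \<Longrightarrow> ellE n \<le> ellE m"
  unfolding ellE_eq
  by (rule integral_le)
     (auto intro!: integrable_continuous_real continuous_ell_delta mult_right_mono simp: ell_delta_def)

text \<open>A parameter with \<open>K > 2 E\<close> is wanted, and \<open>2 E \<le> pi\<close>
  always holds there. Near 1, \<open>K\<close> grows logarithmically: with \<open>e = 1/100\<close>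
  one has \<open>ell_delta m t \<le> pi/2 + e - t\<close>, so \<open>K\<close> is at least
  \<open>ln ((pi/2 + e) / e)\<close>, and \<open>exp pi < exp 4 \<le> 81\<close> lies below that
  quotient.\<close>

lemma ellK_large: "pi < ellK (1 - (1/100)\<^sup>2)"
proof -
  define e :: real where "e = 1/100"
  have e: "0 < e" "e < 1" by (auto simp: e_def)
  define m where "m = 1 - e\<^sup>2"
  have m: "m < 1" using e by (simp add: m_def)
  have le: "1 / (pi/2 + e - t) \<le> 1 / ell_delta m t" if t: "t \<in> {0..pi/2}" for t
  proof (rule divide_left_mono)
    have "1 - m * (sin t)\<^sup>2 = (cos t)\<^sup>2 + e\<^sup>2 * (sin t)\<^sup>2"
      by (simp add: m_def cos_squared_eq algebra_simps)
    also have "\<dots> \<le> (pi/2 - t)\<^sup>2 + e\<^sup>2 * 1"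
    proof (intro add_mono mult_left_mono power_mono)
      show "cos t \<le> pi/2 - t" using sin_x_le_x[of "pi/2 - t"] t by (simp add: sin_diff)
      show "0 \<le> cos t" using t by (intro cos_ge_zero) auto
      show "(sin t)\<^sup>2 \<le> 1" by (simp add: abs_square_le_1)
    qed (use e in auto)
    also have "\<dots> \<le> (pi/2 + e - t)\<^sup>2"
      using t e mult_nonneg_nonneg[of e "pi/2 - t"] by (simp add: power2_eq_square algebra_simps)
    finally show "ell_delta m t \<le> pi/2 + e - t"
      unfolding ell_delta_def using t e by (intro real_le_lsqrt) auto
    show "0 < (pi/2 + e - t) * ell_delta m t"
      using ell_delta_pos[OF m] t e by auto
  qed simp
  have int: "((\<lambda>t. 1 / (pi/2 + e - t)) has_integral (- ln (pi/2 + e - pi/2)) - (- ln (pi/2 + e - 0))) {0..pi/2}"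
    by (rule fundamental_theorem_of_calculus)
       (use e in \<open>auto intro!: derivative_eq_intros simp flip: has_real_derivative_iff_has_vector_derivative\<close>)
  have "exp pi < exp (4::real)" using pi_less_4 by simp
  also have "exp (4::real) = exp 1 ^ 4" by (simp add: exp_of_nat_mult[symmetric])
  also have "\<dots> \<le> 3 ^ 4" using exp_le by (intro power_mono) auto
  also have "\<dots> < (pi/2 + e) / e" using pi_gt3 by (simp add: e_def)
  finally have "ln (exp pi) < ln ((pi/2 + e) / e)" using e pi_gt_zero by (subst ln_less_cancel_iff) (auto intro!: divide_pos_pos add_pos_pos)
  also have "ln ((pi/2 + e) / e) = (- ln (pi/2 + e - pi/2)) - (- ln (pi/2 + e - 0))"
    using e add_pos_pos[OF pi_half_gt_zero e(1)] by (simp add: ln_div)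
  also have "\<dots> = integral {0..pi/2} (\<lambda>t. 1 / (pi/2 + e - t))"
    using int by (rule integral_unique[symmetric])
  also have "\<dots> \<le> integral {0..pi/2} (\<lambda>t. 1 / ell_delta m t)"
    using int le
    by (intro integral_le has_integral_integrable[OF int] integrable_continuous_real
        continuous_inverse_ell_delta[OF m]) auto
  finally show ?thesis using ellK_eq[OF m] by (simp only: m_def e_def ln_exp)
qed

text \<open>\<open>K - 2 E\<close> equals \<open>- pi / 2\<close> at 0 and is positive at
  \<open>n\<close>, while \<open>K\<close> increases strictly and \<open>E\<close> does not
  increase. Stopping at \<open>n < 1\<close> keeps the integrand of \<open>K\<close> jointly
  continuous on a compact set.\<close>

lemma m_star_unique_existence: "\<exists>!m. 0 < m \<and> m < 1 \<and> ellK m = 2 * ellE m"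
proof (rule ex_ex1I)
  define n :: real where "n = 1 - (1/100)\<^sup>2"
  have n: "0 < n" "n < 1" by (auto simp: n_def power2_eq_square)
  have cont: "continuous_on ({0..n} \<times> cbox 0 (pi/2)) (\<lambda>(m, t). ell_delta m t)"
    unfolding ell_delta_def split_beta by (intro continuous_intros)
  have cK: "continuous_on {0..n} (\<lambda>m. integral (cbox 0 (pi/2)) (\<lambda>t. 1 / ell_delta m t))"
  proof (rule integral_continuous_on_param)
    have "continuous_on ({0..n} \<times> cbox 0 (pi/2)) (\<lambda>x. 1 / (case x of (m, t) \<Rightarrow> ell_delta m t))"
      using n by (intro continuous_on_divide continuous_on_const cont) (auto simp: ell_delta_nz)
    then show "continuous_on ({0..n} \<times> cbox 0 (pi/2)) (\<lambda>(m, t). 1 / ell_delta m t)"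
      by (simp add: split_beta)
  qed
  have cE: "continuous_on {0..n} (\<lambda>m. integral (cbox 0 (pi/2)) (ell_delta m))"
    by (rule integral_continuous_on_param[OF cont])
  have c: "continuous_on {0..n} (\<lambda>m. ellK m - 2 * ellE m)"
  proof (rule continuous_on_eq)
    show "continuous_on {0..n} (\<lambda>m. integral (cbox 0 (pi/2)) (\<lambda>t. 1 / ell_delta m t) - 2 * integral (cbox 0 (pi/2)) (ell_delta m))"
      by (intro continuous_intros cK cE)
    show "integral (cbox 0 (pi/2)) (\<lambda>t. 1 / ell_delta m t) - 2 * integral (cbox 0 (pi/2)) (ell_delta m) = ellK m - 2 * ellE m"
      if "m \<in> {0..n}" for m
      using that n by (simp add: ellK_eq ellE_eq)
  qed
  have d0: "ell_delta 0 = (\<lambda>_. 1)" by (simp add: ell_delta_def fun_eq_iff)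
  have E0: "ellE 0 = pi / 2" using pi_ge_zero by (simp add: ellE_eq d0)
  have K0: "ellK 0 = pi / 2" using pi_ge_zero by (simp add: ellK_eq d0)
  have "ellE n \<le> ellE 0" using n by (intro ellE_mono) auto
  then have "0 < ellK n - 2 * ellE n" using ellK_large E0 by (simp add: n_def)
  moreover have "ellK 0 - 2 * ellE 0 < 0" unfolding E0 K0 using pi_gt_zero by simp
  ultimately obtain m where m: "0 \<le> m" "m \<le> n" "ellK m - 2 * ellE m = 0"
    using IVT'[of "\<lambda>m. ellK m - 2 * ellE m" 0 0 n] c n by auto
  moreover have "m \<noteq> 0" using m(3) \<open>ellK 0 - 2 * ellE 0 < 0\<close> by (cases "m = 0") auto
  ultimately show "\<exists>m. 0 < m \<and> m < 1 \<and> ellK m = 2 * ellE m"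
    using n by (intro exI[of _ m]) auto
next
  fix m n :: real
  assume *: "0 < m \<and> m < 1 \<and> ellK m = 2 * ellE m" "0 < n \<and> n < 1 \<and> ellK n = 2 * ellE n"
  show "m = n"
    using ellK_strict_mono[of m n] ellK_strict_mono[of n m] ellE_mono[of m n] ellE_mono[of n m] *
    by (cases m n rule: linorder_cases) auto
qed

lemma m_star: "0 < m_star" "m_star < 1" "ellK m_star = 2 * ellE m_star"
  using theI'[OF m_star_unique_existence] unfolding m_star_def by auto

lemma ell_W_m_star: "ell_W m_star = ellE m_star * (2 * m_star - 1)"
  using ell_W_eq[OF m_star(2)] m_star(3) by (simp add: algebra_simps)

text \<open>At scale \<open>\<Lambda> = 1\<close> a leaf has length \<open>2 K\<close> and bending
  energy \<open>8 W\<close>, and this is their product. The form also shows positivity at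
  once.\<close>

lemma varpi_star_eq: "varpi_star = 16 * ellK m_star * ell_W m_star"
  by (simp add: varpi_star_def ell_W_m_star m_star(3) power2_eq_square)

lemma varpi_star_pos: "0 < varpi_star"
  using ellK_pos[OF m_star(2)] ell_W_pos[OF m_star(1,2)] by (simp add: varpi_star_eq)

section \<open>The sharp inequality on half a leaf\<close>

text \<open>\<open>s\<close> is the last point with \<open>y \<le> 0\<close> and \<open>t\<close>
  the first point of \<open>[s,b]\<close> with \<open>m \<le> y\<close>. Compactness provides them,
  and the intermediate value theorem turns these inequalities into equalities.\<close>

lemma continuous_crossing:
  fixes y :: "real \<Rightarrow> real"
  assumes y: "continuous_on {a..b} y" and "a \<le> b" "y a \<le> 0" "m \<le> y b" "0 < m"
  obtains s t where "a \<le> s" "s < t" "t \<le> b" "y s = 0" "y t = m"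
    "\<forall>x\<in>{s<..<t}. 0 < y x \<and> y x < m"
proof -
  define Z where "Z = {x \<in> {a..b}. y x \<le> 0}"
  have "closed Z" unfolding Z_def
    by (intro continuous_on_closed_Collect_le y continuous_on_const closed_atLeastAtMost)
  moreover have "bounded Z" unfolding Z_def by (rule bounded_subset[OF bounded_closed_interval[of a b]]) auto
  moreover have "a \<in> Z" using assms by (auto simp: Z_def)
  ultimately obtain s where s: "s \<in> Z" "\<And>x. x \<in> Z \<Longrightarrow> x \<le> s"
    using compact_attains_sup[of Z] compact_eq_bounded_closed by blast
  have sab: "a \<le> s" "s \<le> b" "y s \<le> 0" using s(1) by (auto simp: Z_def)
  define Z' where "Z' = {x \<in> {s..b}. m \<le> y x}"
  have ysb: "continuous_on {s..b} y"
    using sab by (intro continuous_on_subset[OF y]) auto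
  then have "closed Z'" unfolding Z'_def
    by (intro continuous_on_closed_Collect_le continuous_on_const closed_atLeastAtMost)
  moreover have "bounded Z'" unfolding Z'_def by (rule bounded_subset[OF bounded_closed_interval[of s b]]) auto
  moreover have "b \<in> Z'" using assms sab by (auto simp: Z'_def)
  ultimately obtain t where t: "t \<in> Z'" "\<And>x. x \<in> Z' \<Longrightarrow> t \<le> x"
    using compact_attains_inf[of Z'] compact_eq_bounded_closed by blast
  have tsb: "s \<le> t" "t \<le> b" "m \<le> y t" using t(1) by (auto simp: Z'_def)
  have "s \<noteq> t" using sab tsb \<open>0 < m\<close> by auto
  obtain z where "s \<le> z" "z \<le> b" "y z = 0"
    using IVT'[of y s 0 b] ysb sab assms by auto
  with s(2)[of z] sab have ys: "y s = 0" by (auto simp: Z_def)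
  have "continuous_on {s..t} y" using tsb by (intro continuous_on_subset[OF ysb]) auto
  then obtain z where "s \<le> z" "z \<le> t" "y z = m"
    using IVT'[of y s m t] sab tsb assms by auto
  with t(2)[of z] tsb have yt: "y t = m" by (auto simp: Z'_def)
  show ?thesis
  proof (rule that[of s t])
    show "\<forall>x\<in>{s<..<t}. 0 < y x \<and> y x < m"
    proof
      fix x assume x: "x \<in> {s<..<t}"
      then have "x \<notin> Z" "x \<notin> Z'" using s(2)[of x] t(2)[of x] by auto
      then show "0 < y x \<and> y x < m" using x sab tsb by (auto simp: Z_def Z'_def)
    qed
  qed (use sab tsb ys yt \<open>s \<noteq> t\<close> in auto)
qed

text \<open>At points with \<open>y = 0\<close> or \<open>y = m\<close> the functions
  \<open>half_Psi\<close> and \<open>half_Theta\<close> have singular derivatives, so the chain rule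
  is available only in the interior; continuity carries the estimates to the ends.\<close>

lemma mono_on_closed_interval:
  fixes D :: "real \<Rightarrow> real"
  assumes D: "continuous_on {s..t} D"
    and mono: "\<And>q r. s < q \<Longrightarrow> q \<le> r \<Longrightarrow> r < t \<Longrightarrow> D q \<le> D r"
    and qr: "s \<le> q" "q \<le> r" "r \<le> t"
  shows "D q \<le> D r"
proof (cases "q = r")
  case False
  with qr have "q < r" by simp
  define d where "d = (r - q) / 2"
  have d: "d > 0" using \<open>q < r\<close> by (simp add: d_def)
  have lim: "(\<lambda>n. d * inverse (real (Suc n))) \<longlonglongrightarrow> 0"
    using tendsto_mult[OF tendsto_const LIMSEQ_inverse_real_of_nat, of d] by simp
  have step: "0 < d * inverse (real (Suc n))" "d * inverse (real (Suc n)) \<le> d" for n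
    using d by (auto simp: field_simps)
  define u v where "u n = q + d * inverse (real (Suc n))" and "v n = r - d * inverse (real (Suc n))" for n
  have uv: "q < u n" "u n \<le> v n" "v n < r" for n
    using step[of n] by (auto simp: u_def v_def d_def)
  have "u \<longlonglongrightarrow> q" "v \<longlonglongrightarrow> r"
    unfolding u_def v_def
    using tendsto_add[OF tendsto_const lim, of q] tendsto_diff[OF tendsto_const lim, of r] by simp_all
  moreover have "u n \<in> {s..t}" "v n \<in> {s..t}" for n using uv[of n] qr by auto
  ultimately have "(\<lambda>n. D (u n)) \<longlonglongrightarrow> D q" "(\<lambda>n. D (v n)) \<longlonglongrightarrow> D r"
    using qr by (auto intro!: continuous_on_tendsto_compose[OF D])
  moreover have "D (u n) \<le> D (v n)" for n
    using uv[of n] qr by (intro mono) auto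
  ultimately show ?thesis by (intro LIMSEQ_le) auto
qed simp

lemma set_integral_AE_zero_imp:
  fixes f :: "real \<Rightarrow> real"
  assumes f: "set_integrable lborel A f" and nonneg: "\<And>x. x \<in> A \<Longrightarrow> 0 \<le> f x"
    and zero: "(LBINT x:A. f x) = 0"
  shows "AE x\<in>A in lborel. f x = 0"
proof -
  have "AE x in lborel. indicator A x *\<^sub>R f x = 0"
    using integral_nonneg_eq_0_iff_AE[of lborel "\<lambda>x. indicator A x *\<^sub>R f x"] f nonneg zero
    by (auto simp: set_integrable_def set_lebesgue_integral_def indicator_def)
  then show ?thesis by eventually_elim (auto simp: indicator_def)
qed

lemma set_integral_nonneg':
  fixes f :: "real \<Rightarrow> real"
  assumes "\<And>x. x \<in> A \<Longrightarrow> 0 \<le> f x"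
  shows "0 \<le> (LBINT x:A. f x)"
  unfolding set_lebesgue_integral_def
  by (intro Bochner_Integration.integral_nonneg) (use assms in \<open>auto simp: indicator_def\<close>)

text \<open>Closed forms, by the substitution \<open>t = m (sin \<psi>)\<^sup>2\<close>, of the integrals from \<open>0\<close> to \<open>z\<close> of
  \<open>sqrt ((m - t) / (t (1 - t)))\<close> and of \<open>1 / (2 sqrt (t (1 - t) (m - t)))\<close>.\<close>

definition half_Psi :: "real \<Rightarrow> real \<Rightarrow> real" where
  "half_Psi m z = 2 * m * ell_Q m (arcsin (sqrt (z / m)))"

definition half_Theta :: "real \<Rightarrow> real \<Rightarrow> real" where
  "half_Theta m z = ellF (arcsin (sqrt (z / m))) m"

lemma arcsin_sqrt_has_derivative:
  assumes "0 < m" "m \<le> 1" "0 < z" "z < m"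
  shows "((\<lambda>z. arcsin (sqrt (z / m))) has_real_derivative 1 / (2 * sqrt z * sqrt (m - z))) (at z)"
proof -
  have q: "0 < z / m" "z / m < 1" using assms by auto
  have 1: "((\<lambda>z. sqrt (z / m)) has_real_derivative inverse (sqrt (z / m)) / 2 * (1 / m)) (at z)"
    by (rule DERIV_chain2[OF DERIV_real_sqrt]) (use q assms in \<open>auto intro!: derivative_eq_intros\<close>)
  have s: "0 < sqrt (z / m)" "sqrt (z / m) < 1" using q by auto
  have "((\<lambda>z. arcsin (sqrt (z / m))) has_real_derivative
      inverse (sqrt (1 - (sqrt (z / m))\<^sup>2)) * (inverse (sqrt (z / m)) / 2 * (1 / m))) (at z)"
    by (rule DERIV_chain2[OF DERIV_arcsin 1]) (use s in linarith)+
  also have "inverse (sqrt (1 - (sqrt (z / m))\<^sup>2)) * (inverse (sqrt (z / m)) / 2 * (1 / m)) =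
      1 / (2 * sqrt z * sqrt (m - z))"
  proof -
    have e: "1 - (sqrt (z / m))\<^sup>2 = (m - z) / m" using q assms by (simp add: field_simps)
    define A B C where "A = sqrt z" and "B = sqrt (m - z)" and "C = sqrt m"
    have ABC: "A > 0" "B > 0" "C > 0" "C * C = m" using assms by (auto simp: A_def B_def C_def)
    have s1: "sqrt (1 - (sqrt (z / m))\<^sup>2) = B / C"
      unfolding e by (simp add: real_sqrt_divide B_def C_def)
    have s2: "sqrt (z / m) = A / C" by (simp add: real_sqrt_divide A_def C_def)
    have "inverse (sqrt (1 - (sqrt (z / m))\<^sup>2)) * (inverse (sqrt (z / m)) / 2 * (1 / m)) =
      inverse (B / C) * (inverse (A / C) / 2 * (1 / (C * C)))"
      unfolding s1 unfolding s2 ABC(4) ..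
    also have "\<dots> = 1 / (2 * A * B)" using ABC(1-3) by (simp add: field_simps)
    finally show ?thesis by (simp add: A_def B_def)
  qed
  finally show ?thesis .
qed

lemma sin_arcsin_sqrt: "0 < m \<Longrightarrow> 0 \<le> z \<Longrightarrow> z \<le> m \<Longrightarrow> (sin (arcsin (sqrt (z / m))))\<^sup>2 = z / m"
proof -
  assume "0 < m" "0 \<le> z" "z \<le> m"
  then have "sin (arcsin (sqrt (z / m))) = sqrt (z / m)"
    by (intro sin_arcsin) (auto simp: real_le_lsqrt intro: order_trans[of "-1" 0])
  then show ?thesis using \<open>0 < m\<close> \<open>0 \<le> z\<close> by simp
qed

lemma continuous_arcsin_sqrt: "0 < m \<Longrightarrow> continuous_on {0..m} (\<lambda>z. arcsin (sqrt (z / m)))"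
  by (intro continuous_intros) (auto intro: order_trans[of "-1" 0])

lemma ell_delta_arcsin_sqrt:
  "0 < m \<Longrightarrow> 0 \<le> z \<Longrightarrow> z \<le> m \<Longrightarrow> ell_delta m (arcsin (sqrt (z / m))) = sqrt (1 - z)"
  by (simp add: ell_delta_def sin_arcsin_sqrt)

lemma half_Psi_has_derivative:
  assumes "0 < m" "m \<le> 1" "0 < z" "z < m"
  shows "(half_Psi m has_real_derivative sqrt ((m - z) / (z * (1 - z)))) (at z)"
proof -
  let ?a = "arcsin (sqrt (z / m))"
  have "((\<lambda>z. ell_Q m (arcsin (sqrt (z / m)))) has_real_derivative
      (cos ?a)\<^sup>2 / ell_delta m ?a * (1 / (2 * sqrt z * sqrt (m - z)))) (at z)"
    by (rule DERIV_chain2[OF ell_Q_has_derivative[OF assms(2)] arcsin_sqrt_has_derivative[OF assms]])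
  then have "(half_Psi m has_real_derivative
      2 * m * ((cos ?a)\<^sup>2 / ell_delta m ?a * (1 / (2 * sqrt z * sqrt (m - z))))) (at z)"
    unfolding half_Psi_def[abs_def] by (rule DERIV_cmult)
  also have "2 * m * ((cos ?a)\<^sup>2 / ell_delta m ?a * (1 / (2 * sqrt z * sqrt (m - z)))) = sqrt ((m - z) / (z * (1 - z)))"
  proof -
    define A B C where "A = sqrt z" and "B = sqrt (m - z)" and "C = sqrt (1 - z)"
    have ABC: "A > 0" "B > 0" "C > 0" "B * B = m - z" using assms by (auto simp: A_def B_def C_def)
    have "m * (cos ?a)\<^sup>2 = B * B"
      using assms by (simp add: cos_squared_eq sin_arcsin_sqrt ABC(4) field_simps)
    then have "2 * m * ((cos ?a)\<^sup>2 / ell_delta m ?a * (1 / (2 * sqrt z * sqrt (m - z)))) = B * B / (C * A * B)"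
      using assms by (simp add: ell_delta_arcsin_sqrt A_def[symmetric] B_def[symmetric] C_def[symmetric])
    also have "\<dots> = B / (A * C)" using ABC(1-3) by simp
    finally show ?thesis by (simp add: real_sqrt_divide real_sqrt_mult A_def B_def C_def)
  qed
  finally show ?thesis .
qed

lemma continuous_half_Psi: "0 < m \<Longrightarrow> m \<le> 1 \<Longrightarrow> continuous_on {0..m} (half_Psi m)"
proof -
  assume m: "0 < m" "m \<le> 1"
  have "continuous_on UNIV (ell_Q m)"
    using ell_Q_has_derivative[OF m(2)] by (intro continuous_at_imp_continuous_on) (auto intro: DERIV_isCont)
  from continuous_on_compose2[OF this continuous_arcsin_sqrt[OF m(1)]]
  show ?thesis unfolding half_Psi_def by (intro continuous_intros) auto
qed

lemma half_Psi_0 [simp]: "half_Psi m 0 = 0"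
  by (simp add: half_Psi_def)

lemma half_Psi_end: "0 < m \<Longrightarrow> half_Psi m m = 2 * ell_W m"
  by (simp add: half_Psi_def ell_W_def)

lemma half_Theta_has_derivative:
  assumes "0 < m" "m < 1" "0 < z" "z < m"
  shows "(half_Theta m has_real_derivative 1 / (2 * sqrt (z * (1 - z)) * sqrt (m - z))) (at z)"
proof -
  have "(half_Theta m has_real_derivative 1 / ell_delta m (arcsin (sqrt (z / m))) * (1 / (2 * sqrt z * sqrt (m - z)))) (at z)"
    unfolding half_Theta_def[abs_def]
    by (rule DERIV_chain2[OF ellF_has_derivative[OF assms(2)] arcsin_sqrt_has_derivative[OF assms(1) less_imp_le[OF assms(2)] assms(3,4)]])
  then show ?thesis
    by (rule DERIV_cong) (use assms in \<open>simp add: ell_delta_arcsin_sqrt real_sqrt_mult\<close>)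
qed

lemma continuous_half_Theta: "0 < m \<Longrightarrow> m < 1 \<Longrightarrow> continuous_on {0..m} (half_Theta m)"
proof -
  assume m: "0 < m" "m < 1"
  have "continuous_on UNIV (\<lambda>x. ellF x m)"
    using isCont_ellF[OF m(2)] by (intro continuous_at_imp_continuous_on) auto
  from continuous_on_compose2[OF this continuous_arcsin_sqrt[OF m(1)]]
  show ?thesis unfolding half_Theta_def by auto
qed

text \<open>Cosine and sine of the tangent angle \<open>2 arcsin (sqrt m\<^sup>* sin \<psi>)\<close> of the figure-eight elastica.\<close>

definition fig_cos :: "real \<Rightarrow> real" where
  "fig_cos \<psi> = 1 - 2 * m_star * (sin \<psi>)\<^sup>2"

definition fig_sin :: "real \<Rightarrow> real" where
  "fig_sin \<psi> = 2 * sqrt m_star * sin \<psi> * ell_delta m_star \<psi>"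

lemma fig_cos_sin_square: "(fig_cos \<psi>)\<^sup>2 + (fig_sin \<psi>)\<^sup>2 = 1"
  using m_star by (simp add: fig_cos_def fig_sin_def power_mult_distrib ell_delta_square)
    (simp add: power2_eq_square algebra_simps)

text \<open>One half of a leaf, traversed away from the midpoint \<open>p\<close>. Only tangent data
  occur, so reversing the parameter brings the other half into the same form. The last assumption
  says that the half has length \<open>K(m_star) / \<Lambda>\<close>.\<close>

locale half_leaf =
  fixes p b :: real and w :: "real \<Rightarrow> real" and T \<tau> :: "real \<Rightarrow> 'a::euclidean_space" and \<Lambda> :: real
  assumes p_less_b: "p < b"
    and cw: "continuous_on {p..b} w" and w_pos: "\<And>x. x \<in> {p..b} \<Longrightarrow> 0 < w x"
    and T_unit: "\<And>x. x \<in> {p..b} \<Longrightarrow> norm (T x) = 1"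
    and primT: "primitive_on p b T \<tau>"
    and energy: "set_integrable lborel {p..b} (\<lambda>x. (norm (\<tau> x))\<^sup>2 / w x)"
    and \<Lambda>_pos: "0 < \<Lambda>"
    and \<Lambda>_eq: "\<Lambda> * (LBINT x:{p..b}. w x) = ellK m_star"
begin

section \<open>Geometry of the tangent on the sphere and the lower bound for
  \<open>G\<close>\<close>

lemma orth: "AE x\<in>{p..b} in lborel. \<tau> x \<bullet> T x = 0"
  by (rule unit_primitive_orthogonal[OF primT T_unit])

definition "e = T p"
definition "y x = (1 - T x \<bullet> e) / 2"
definition "J = (LBINT x:{p..b}. (norm (\<tau> x))\<^sup>2 / w x + 2 * \<Lambda>\<^sup>2 * (T x \<bullet> e) * w x)"
definition "Jmin = 8 * \<Lambda> * ell_W m_star + 2 * \<Lambda> * (1 - 2 * m_star) * ellK m_star"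
definition "m = Sup (y ` {p..b})"
text \<open>Up to the factor \<open>4 \<Lambda>\<close>, what the arithmetic-geometric mean
  inequality leaves of the energy density. As \<open>\<tau> = w \<kappa>\<close>, its integral is
  independent of the parametrisation.\<close>

definition "g x = norm (\<tau> x) * sqrt (m - y x)"

lemma norm_e: "norm e = 1"
  using T_unit[of p] p_less_b by (simp add: e_def)

lemma primy: "primitive_on p b y (\<lambda>x. - (\<tau> x \<bullet> e) / 2)"
proof -
  have "primitive_on p b (\<lambda>x. (1 - T x \<bullet> e) / 2) (\<lambda>x. (0 - \<tau> x \<bullet> e) / 2)"
    by (rule primitive_on_bounded_linear[OF primitive_on_diff[OF primitive_on_const
          primitive_on_bounded_linear[OF primT bounded_linear_inner_left]] bounded_linear_divide])
  then show ?thesis by (simp add: y_def[abs_def])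
qed

lemma cy: "continuous_on {p..b} y"
  by (rule primitive_on_continuous[OF primy])

lemma y_p: "y p = 0"
  using norm_e by (simp add: y_def e_def[symmetric] dot_square_norm)

lemma y_bounds: "x \<in> {p..b} \<Longrightarrow> 0 \<le> y x \<and> y x \<le> 1"
  using Cauchy_Schwarz_ineq2[of "T x" e] T_unit[of x] norm_e by (auto simp: y_def)

lemma m_attained: obtains c where "c \<in> {p..b}" "y c = m"
proof -
  obtain c where c: "c \<in> {p..b}" "\<And>x. x \<in> {p..b} \<Longrightarrow> y x \<le> y c"
    using continuous_attains_sup[OF compact_Icc _ cy] p_less_b by force
  have "m = y c" unfolding m_def
    using c by (intro cSup_eq_maximum) auto
  then show ?thesis by (intro that[OF c(1)]) simp
qed

lemma y_le_m: "x \<in> {p..b} \<Longrightarrow> y x \<le> m"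
proof -
  assume x: "x \<in> {p..b}"
  have "bdd_above (y ` {p..b})" using y_bounds by (intro bdd_aboveI[of _ 1]) auto
  then show ?thesis unfolding m_def using x by (intro cSup_upper) auto
qed

lemma m_bounds: "0 \<le> m" "m \<le> 1"
proof -
  obtain c where "c \<in> {p..b}" "y c = m" by (rule m_attained)
  with y_bounds[of c] show "0 \<le> m" "m \<le> 1" by auto
qed

text \<open>Both sides are the sine of the angle between \<open>T\<close> and \<open>e\<close>,
  since \<open>T \<bullet> e = 1 - 2 y\<close>.\<close>

lemma sphere_norm: "x \<in> {p..b} \<Longrightarrow> norm (e - (T x \<bullet> e) *\<^sub>R T x) = 2 * sqrt (y x * (1 - y x))"
proof -
  assume x: "x \<in> {p..b}"
  have "(norm (e - (T x \<bullet> e) *\<^sub>R T x))\<^sup>2 = 1 - (T x \<bullet> e)\<^sup>2"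
  proof -
    have i: "T x \<bullet> T x = 1" "e \<bullet> e = 1" using T_unit[OF x] norm_e by (simp_all add: dot_square_norm)
    show ?thesis
      unfolding power2_norm_eq_inner
      by (simp add: inner_diff_left inner_diff_right inner_commute[of e "T x"] i power2_eq_square)
  qed
  also have "\<dots> = 4 * (y x * (1 - y x))"
    by (simp add: y_def field_simps power2_eq_square)
  finally have "norm (e - (T x \<bullet> e) *\<^sub>R T x) = sqrt (4 * (y x * (1 - y x)))"
    by (metis norm_ge_zero real_sqrt_unique)
  then show ?thesis by (simp add: real_sqrt_mult)
qed

text \<open>Because \<open>\<tau>\<close> is orthogonal to \<open>T\<close>, only the part of
  \<open>e\<close> tangential to the sphere at \<open>T\<close> contributes, and Cauchy-Schwarz
  applies to it. Equality means that \<open>T\<close> moves along a great circle through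
  \<open>e\<close>.\<close>

lemma AE_dy_le: "AE x\<in>{p..b} in lborel. \<bar>- (\<tau> x \<bullet> e) / 2\<bar> \<le> norm (\<tau> x) * sqrt (y x * (1 - y x))"
  using orth
proof eventually_elim
  case (elim x)
  show ?case
  proof
    assume x: "x \<in> {p..b}"
    with elim have "\<tau> x \<bullet> e = \<tau> x \<bullet> (e - (T x \<bullet> e) *\<^sub>R T x)"
      by (simp add: inner_diff_right)
    then have "\<bar>\<tau> x \<bullet> e\<bar> \<le> norm (\<tau> x) * (2 * sqrt (y x * (1 - y x)))"
      using Cauchy_Schwarz_ineq2[of "\<tau> x" "e - (T x \<bullet> e) *\<^sub>R T x"] sphere_norm[OF x] by simp
    then show "\<bar>- (\<tau> x \<bullet> e) / 2\<bar> \<le> norm (\<tau> x) * sqrt (y x * (1 - y x))" by simp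
  qed
qed

lemma int_\<tau>: "set_integrable lborel {p..b} \<tau>"
  by (rule primitive_on_integrable[OF primT])

lemma int_g: "set_integrable lborel {p..b} g"
  unfolding g_def[abs_def]
  by (rule set_integrable_bilinear_continuous[OF bounded_bilinear_mult set_integrable_norm[OF int_\<tau>]])
     (intro continuous_intros cy)

lemma g_nonneg: "x \<in> {p..b} \<Longrightarrow> 0 \<le> g x"
  using y_le_m by (simp add: g_def)

lemma int_g_sub: "p \<le> q \<Longrightarrow> r \<le> b \<Longrightarrow> set_integrable lborel {q..r} g"
  by (rule set_integrable_subset[OF int_g]) auto

definition "G x = (LBINT t:{p..x}. g t)"

lemma primG: "primitive_on p b G g"
proof (rule primitive_onI[OF int_g])
  have "G p = 0" using set_integral_split[OF int_g, of p] p_less_b by (simp add: G_def)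
  then show "(LBINT t:{p..x}. g t) = G x - G p" for x by (simp add: G_def)
qed

lemma G_mono: "p \<le> q \<Longrightarrow> q \<le> r \<Longrightarrow> r \<le> b \<Longrightarrow> G q \<le> G r"
  using primitive_on_integral[OF primG, of q r] set_integral_nonneg'[of "{q..r}" g] g_nonneg by force

lemma primPsi:
  assumes q: "p \<le> q" "q \<le> r" "r \<le> b" and m0: "0 < m"
    and y: "\<forall>x\<in>{q..r}. 0 < y x \<and> y x < m"
  shows "primitive_on q r (\<lambda>x. half_Psi m (y x)) (\<lambda>x. sqrt ((m - y x) / (y x * (1 - y x))) * (- (\<tau> x \<bullet> e) / 2))"
proof (rule primitive_on_chain[OF primitive_on_subinterval[OF primy q(1,3)], where S = "{0<..<m}"
      and \<Phi> = "half_Psi m" and \<Phi>' = "\<lambda>z. sqrt ((m - z) / (z * (1 - z)))"])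
  show "y ` {q..r} \<subseteq> {0<..<m}" using y by auto
  show "(half_Psi m has_real_derivative sqrt ((m - z) / (z * (1 - z)))) (at z within {0<..<m})"
    if "z \<in> {0<..<m}" for z
    using that m_bounds m0 by (intro has_field_derivative_at_within[OF half_Psi_has_derivative]) auto
  show "continuous_on {0<..<m} (\<lambda>z. sqrt ((m - z) / (z * (1 - z))))"
    using m_bounds by (intro continuous_intros) auto
qed

text \<open>The derivative of \<open>half_Psi m\<close> is chosen so that, after
  \<open>AE_dy_le\<close>, the factor \<open>sqrt (y (1 - y))\<close> cancels and exactly
  \<open>g\<close> remains; monotonicity of \<open>y\<close> does not enter.\<close>

lemma Psi_le_G:
  assumes q: "p \<le> s" "s < t" "t \<le> b" and m0: "0 < m"
    and y: "\<forall>x\<in>{s<..<t}. 0 < y x \<and> y x < m"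
    and qr: "s \<le> q" "q \<le> r" "r \<le> t"
  shows "half_Psi m (y r) - half_Psi m (y q) \<le> G r - G q"
proof -
  have "G q - half_Psi m (y q) \<le> G r - half_Psi m (y r)"
  proof (rule mono_on_closed_interval[OF _ _ qr])
    have "continuous_on {p..b} (\<lambda>x. half_Psi m (y x))"
      using y_bounds y_le_m
      by (intro continuous_on_compose2[OF continuous_half_Psi[OF m0 m_bounds(2)] cy]) auto
    then have "continuous_on {p..b} (\<lambda>x. G x - half_Psi m (y x))"
      by (intro continuous_intros primitive_on_continuous[OF primG])
    then show "continuous_on {s..t} (\<lambda>x. G x - half_Psi m (y x))"
      using q by (elim continuous_on_subset) auto
    fix q' r' assume qr': "s < q'" "q' \<le> r'" "r' < t"
    have sub: "p \<le> q'" "q' \<le> r'" "r' \<le> b" using q qr' by auto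
    have y': "\<forall>x\<in>{q'..r'}. 0 < y x \<and> y x < m" using y qr' by auto
    note P = primPsi[OF sub m0 y']
    have "half_Psi m (y r') - half_Psi m (y q') =
        (LBINT x:{q'..r'}. sqrt ((m - y x) / (y x * (1 - y x))) * (- (\<tau> x \<bullet> e) / 2))"
      using primitive_on_integral[OF P, of q' r'] qr' by simp
    also have "\<dots> \<le> (LBINT x:{q'..r'}. g x)"
    proof (rule set_integral_mono_AE[OF primitive_on_integrable[OF P] int_g_sub[OF sub(1,3)]])
      show "AE x\<in>{q'..r'} in lborel. sqrt ((m - y x) / (y x * (1 - y x))) * (- (\<tau> x \<bullet> e) / 2) \<le> g x"
        using AE_dy_le
      proof eventually_elim
        case (elim x)
        show ?case
        proof
          assume x: "x \<in> {q'..r'}"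
          define A B where "A = sqrt (m - y x)" and "B = sqrt (y x * (1 - y x))"
          have AB: "0 < A" "0 < B" using bspec[OF y' x] m_bounds by (auto simp: A_def B_def)
          have "- (\<tau> x \<bullet> e) / 2 \<le> norm (\<tau> x) * B"
            using elim x sub by (auto simp: B_def)
          then have "A / B * (- (\<tau> x \<bullet> e) / 2) \<le> A / B * (norm (\<tau> x) * B)"
            using AB by (intro mult_left_mono) auto
          also have "\<dots> = g x" using AB by (simp add: g_def A_def)
          finally show "sqrt ((m - y x) / (y x * (1 - y x))) * (- (\<tau> x \<bullet> e) / 2) \<le> g x"
            by (simp add: A_def B_def real_sqrt_divide)
        qed
      qed
    qed
    also have "\<dots> = G r' - G q'" using primitive_on_integral[OF primG, of q' r'] sub by simp
    finally show "G q' - half_Psi m (y q') \<le> G r' - half_Psi m (y r')" by simp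
  qed
  then show ?thesis by simp
qed

lemma m_crossing:
  assumes "0 < m"
  obtains s t where "p \<le> s" "s < t" "t \<le> b" "y s = 0" "y t = m"
    "\<forall>x\<in>{s<..<t}. 0 < y x \<and> y x < m"
proof -
  obtain c where c: "c \<in> {p..b}" "y c = m" by (rule m_attained)
  have "continuous_on {p..c} y" using c by (intro continuous_on_subset[OF cy]) auto
  then obtain s t where st: "p \<le> s" "s < t" "t \<le> c" "y s = 0" "y t = m"
    "\<forall>x\<in>{s<..<t}. 0 < y x \<and> y x < m"
    by (rule continuous_crossing[of p c y m]) (use c y_p assms in auto)
  show ?thesis by (rule that[OF st(1,2) _ st(4,5,6)]) (use c st(3) in auto)
qed

lemma G_p: "G p = 0"
  using set_integral_split[OF int_g, of p] p_less_b by (simp add: G_def)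

text \<open>Along one crossing from 0 to \<open>m\<close>, \<open>half_Psi m\<close> grows from 0 to
  \<open>2 * ell_W m\<close>, and outside the crossing \<open>g\<close> is nonnegative. For
  \<open>m = 0\<close> the left side is 0.\<close>

lemma W_le_G: "2 * ell_W m \<le> G b"
proof (cases "0 < m")
  case True
  obtain s t where st: "p \<le> s" "s < t" "t \<le> b" "y s = 0" "y t = m"
    "\<forall>x\<in>{s<..<t}. 0 < y x \<and> y x < m"
    by (rule m_crossing[OF True])
  have "half_Psi m (y t) - half_Psi m (y s) \<le> G t - G s"
    using st by (intro Psi_le_G[OF st(1,2,3) True st(6)]) auto
  moreover have "G p \<le> G s" "G t \<le> G b" using st by (auto intro: G_mono)
  ultimately show ?thesis using half_Psi_end[OF True] st by (simp add: G_p)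
next
  case False
  then have "m = 0" using m_bounds by simp
  then show ?thesis using G_mono[of p b] p_less_b by (simp add: ell_W_def G_p)
qed

lemma int_w: "p \<le> q \<Longrightarrow> r \<le> b \<Longrightarrow> set_integrable lborel {q..r} w"
  by (rule borel_integrable_atLeastAtMost'[OF continuous_on_subset[OF cw]]) auto

text \<open>The deficit in the arithmetic-geometric mean inequality.\<close>

definition "defect x = (norm (\<tau> x) - 2 * \<Lambda> * sqrt (m - y x) * w x)\<^sup>2 / w x"

text \<open>The completed square contains \<open>4 \<Lambda>\<^sup>2 (m - y) w\<close>, and the tilt
  is \<open>2 \<Lambda>\<^sup>2 (1 - 2 y) w\<close>; their difference no longer contains
  \<open>y\<close>.\<close>

lemma integrand_split:
  assumes x: "x \<in> {p..b}"
  shows "(norm (\<tau> x))\<^sup>2 / w x + 2 * \<Lambda>\<^sup>2 * (T x \<bullet> e) * w x =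
    (defect x + 4 * \<Lambda> * g x) + 2 * \<Lambda>\<^sup>2 * (1 - 2 * m) * w x"
proof -
  define A where "A = sqrt (m - y x)"
  have A: "A * A = m - y x" using y_le_m[OF x] by (simp add: A_def)
  have T: "T x \<bullet> e = 1 - 2 * (m - A * A)" unfolding A by (simp add: y_def field_simps)
  show ?thesis
    unfolding defect_def g_def A_def[symmetric] T using w_pos[OF x]
    by (simp add: field_simps power2_eq_square)
qed

lemma int_defect: "set_integrable lborel {p..b} defect"
proof -
  have "set_integrable lborel {p..b} (\<lambda>x. (norm (\<tau> x))\<^sup>2 / w x + (4 * \<Lambda>\<^sup>2 * (m - y x) * w x - 4 * \<Lambda> * g x))"
    by (intro set_integral_add set_integral_diff energy set_integrable_mult_right int_g
        borel_integrable_atLeastAtMost' continuous_on_mult continuous_on_diff continuous_on_const cy cw)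
  moreover have "(norm (\<tau> x))\<^sup>2 / w x + (4 * \<Lambda>\<^sup>2 * (m - y x) * w x - 4 * \<Lambda> * g x) = defect x" if x: "x \<in> {p..b}" for x
  proof -
    have "T x \<bullet> e = 1 - 2 * y x" by (simp add: y_def field_simps)
    with integrand_split[OF x] show ?thesis by (simp add: algebra_simps)
  qed
  ultimately show ?thesis
    using set_integrable_cong[OF refl, of "{p..b}" "{p..b}" _ defect lborel] by (metis (no_types, lifting))
qed

lemma defect_nonneg: "x \<in> {p..b} \<Longrightarrow> 0 \<le> defect x"
  using w_pos[of x] by (simp add: defect_def)

lemma J_eq: "J = (LBINT x:{p..b}. defect x) + 4 * \<Lambda> * G b + 2 * \<Lambda> * (1 - 2 * m) * ellK m_star"
proof -
  have "J = (LBINT x:{p..b}. (defect x + 4 * \<Lambda> * g x) + 2 * \<Lambda>\<^sup>2 * (1 - 2 * m) * w x)"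
    unfolding J_def by (intro set_lebesgue_integral_cong) (auto simp: integrand_split)
  also have "\<dots> = (LBINT x:{p..b}. defect x) + 4 * \<Lambda> * (LBINT x:{p..b}. g x) + 2 * \<Lambda>\<^sup>2 * (1 - 2 * m) * (LBINT x:{p..b}. w x)"
    using int_defect int_g int_w[of p b] by simp
  also have "2 * \<Lambda>\<^sup>2 * (1 - 2 * m) * (LBINT x:{p..b}. w x) = 2 * \<Lambda> * (1 - 2 * m) * ellK m_star"
    by (simp add: \<Lambda>_eq[symmetric] power2_eq_square)
  finally show ?thesis by (simp add: G_def)
qed

text \<open>Around \<open>m_star\<close> the tangent of \<open>8 \<Lambda> ell_W\<close> rises by
  \<open>4 \<Lambda> (m - m_star) K(m_star)\<close>, which is exactly what the second term loses.
  What remains is the gap of strict convexity.\<close>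

lemma W_le: "8 * \<Lambda> * ell_W m_star + 2 * \<Lambda> * (1 - 2 * m_star) * ellK m_star
    \<le> 8 * \<Lambda> * ell_W m + 2 * \<Lambda> * (1 - 2 * m) * ellK m_star"
  and W_less: "m \<noteq> m_star \<Longrightarrow> 8 * \<Lambda> * ell_W m_star + 2 * \<Lambda> * (1 - 2 * m_star) * ellK m_star
    < 8 * \<Lambda> * ell_W m + 2 * \<Lambda> * (1 - 2 * m) * ellK m_star"
proof -
  show *: "8 * \<Lambda> * ell_W m_star + 2 * \<Lambda> * (1 - 2 * m_star) * ellK m_star
    < 8 * \<Lambda> * ell_W m + 2 * \<Lambda> * (1 - 2 * m) * ellK m_star" if "m \<noteq> m_star"
  proof -
    have "8 * \<Lambda> * (ell_W m_star + (m - m_star) * (ellK m_star / 2)) < 8 * \<Lambda> * ell_W m"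
      using \<Lambda>_pos by (intro mult_strict_left_mono ell_W_tangent m_bounds m_star that) auto
    then show ?thesis by (simp add: field_simps)
  qed
  show "8 * \<Lambda> * ell_W m_star + 2 * \<Lambda> * (1 - 2 * m_star) * ellK m_star
    \<le> 8 * \<Lambda> * ell_W m + 2 * \<Lambda> * (1 - 2 * m) * ellK m_star"
    using * by (cases "m = m_star") auto
qed

section \<open>The sharp bound for a half leaf and its case of equality\<close>

lemma defect_integral_nonneg: "0 \<le> (LBINT x:{p..b}. defect x)"
  by (rule set_integral_nonneg') (rule defect_nonneg)

lemma Jmin_le_J: "Jmin \<le> J"
proof -
  have "8 * \<Lambda> * ell_W m \<le> 4 * \<Lambda> * G b"
    using mult_left_mono[OF W_le_G, of "4 * \<Lambda>"] \<Lambda>_pos by simp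
  then show ?thesis
    using W_le defect_integral_nonneg unfolding J_eq Jmin_def by linarith
qed

text \<open>\<open>J - Jmin\<close> is a sum of three nonnegative gaps: the convexity gap of
  \<open>W\<close>, the gap in \<open>W_le_G\<close>, and the integral of \<open>defect\<close>.
  Each has to vanish.\<close>

lemma equality:
  assumes eq: "J = Jmin"
  shows "m = m_star" "G b = 2 * ell_W m" "AE x\<in>{p..b} in lborel. norm (\<tau> x) = 2 * \<Lambda> * sqrt (m - y x) * w x"
proof -
  note d = defect_integral_nonneg
  have W: "8 * \<Lambda> * ell_W m \<le> 4 * \<Lambda> * G b"
    using mult_left_mono[OF W_le_G, of "4 * \<Lambda>"] \<Lambda>_pos by simp
  show m: "m = m_star"
  proof (rule ccontr)
    assume "m \<noteq> m_star"
    from W_less[OF this] W d eq show False unfolding J_eq Jmin_def by linarith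
  qed
  have "4 * \<Lambda> * G b \<le> 8 * \<Lambda> * ell_W m" and d0: "(LBINT x:{p..b}. defect x) = 0"
    using W_le W d eq unfolding J_eq Jmin_def by linarith+
  with W have "4 * \<Lambda> * G b = 4 * \<Lambda> * (2 * ell_W m)" by simp
  then show "G b = 2 * ell_W m" using \<Lambda>_pos by simp
  have "AE x\<in>{p..b} in lborel. defect x = 0"
    by (rule set_integral_AE_zero_imp[OF int_defect _ d0]) (rule defect_nonneg)
  then show "AE x\<in>{p..b} in lborel. norm (\<tau> x) = 2 * \<Lambda> * sqrt (m - y x) * w x"
  proof eventually_elim
    case (elim x)
    show ?case
    proof
      assume x: "x \<in> {p..b}"
      with elim w_pos[OF x] show "norm (\<tau> x) = 2 * \<Lambda> * sqrt (m - y x) * w x"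
        by (simp add: defect_def)
    qed
  qed
qed

text \<open>The crossing \<open>[s,t]\<close> of \<open>y\<close> from 0 to \<open>m\<close>
  accounts for all of \<open>G b\<close>, which forces equality in the differential inequality for
  \<open>y\<close> there. The two remaining pieces are excluded differently: \<open>[p,s]\<close>
  would contribute to \<open>G\<close>, while \<open>[t,b]\<close> would exceed the prescribed
  length.\<close>

lemma equality_full_range:
  assumes eq: "J = Jmin"
  shows "y b = m" "\<forall>x\<in>{p<..<b}. 0 < y x \<and> y x < m"
    "AE x\<in>{p..b} in lborel. - (\<tau> x \<bullet> e) / 2 = 2 * \<Lambda> * w x * sqrt (m - y x) * sqrt (y x * (1 - y x))"
    "\<forall>x\<in>{p..b}. half_Theta m (y x) = \<Lambda> * (LBINT t:{p..x}. w t)"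
proof -
  note m = equality(1)[OF eq] and Gb = equality(2)[OF eq] and speed = equality(3)[OF eq]
  have m01: "0 < m" "m < 1" using m_star by (simp_all add: m)
  obtain s t where st: "p \<le> s" "s < t" "t \<le> b" "y s = 0" "y t = m"
    "\<forall>x\<in>{s<..<t}. 0 < y x \<and> y x < m"
    by (rule m_crossing[OF m01(1)])
  note PG = Psi_le_G[OF st(1,2,3) m01(1) st(6)]
  have "2 * ell_W m \<le> G t - G s"
    using PG[of s t] st half_Psi_end[OF m01(1)] by simp
  moreover have "0 \<le> G s" "G t \<le> G b"
    using G_mono[of p s] G_mono[of t b] st by (auto simp: G_p)
  ultimately have Gs: "G s = 0" and Gt: "G t = 2 * ell_W m" using Gb by auto
  \<comment> \<open>The inequalities on \<open>[s,q]\<close>, \<open>[q,r]\<close> and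
    \<open>[r,t]\<close> add up to an equality, so each is an equality.\<close>
  have PsiG: "half_Psi m (y r) - half_Psi m (y q) = G r - G q" if "s \<le> q" "q \<le> r" "r \<le> t" for q r
    using PG[of s q] PG[of q r] PG[of r t] that st half_Psi_end[OF m01(1)] Gs Gt by simp
  have g_eq: "AE x\<in>{p..b} in lborel. g x = 2 * \<Lambda> * (m - y x) * w x"
    using speed
  proof eventually_elim
    case (elim x)
    show ?case
    proof
      assume x: "x \<in> {p..b}"
      define A where "A = sqrt (m - y x)"
      have A: "A * A = m - y x" using y_le_m[OF x] by (simp add: A_def)
      have "g x = 2 * \<Lambda> * (A * A) * w x" using elim x by (simp add: g_def A_def[symmetric])
      then show "g x = 2 * \<Lambda> * (m - y x) * w x" by (simp only: A)
    qed
  qed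
  have G2: "primitive_on p b G (\<lambda>x. 2 * \<Lambda> * (m - y x) * w x)"
    by (rule primitive_on_cong_AE[OF primG set_borel_measurable_continuous g_eq])
       (intro continuous_intros cy cw)
  \<comment> \<open>On \<open>[p,s]\<close> the integral of \<open>g\<close> is 0, although
    \<open>g = 2 \<Lambda> (m - y) w\<close> almost everywhere and the right side is positive near
    \<open>p\<close>, where \<open>y\<close> vanishes.\<close>
  have "s = p"
  proof (rule ccontr)
    assume "s \<noteq> p"
    with st have "p < s" by simp
    have c: "continuous_on {p..s} (\<lambda>x. 2 * \<Lambda> * (m - y x) * w x)"
      using st by (intro continuous_intros continuous_on_subset[OF cy] continuous_on_subset[OF cw]) auto
    have "(LBINT x:{p..s}. 2 * \<Lambda> * (m - y x) * w x) = 0"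
      using primitive_on_integral[OF G2, of p s] st by (simp add: Gs G_p)
    then have "integral {p..s} (\<lambda>x. 2 * \<Lambda> * (m - y x) * w x) = 0"
      using set_borel_integral_eq_integral(2)[OF borel_integrable_atLeastAtMost'[OF c]] by simp
    moreover have "0 \<le> 2 * \<Lambda> * (m - y x) * w x" if "x \<in> {p..s}" for x
    proof -
      have "x \<in> {p..b}" using that st by auto
      from y_le_m[OF this] w_pos[OF this] show ?thesis using \<Lambda>_pos by simp
    qed
    ultimately have "\<forall>x\<in>{p..s}. 2 * \<Lambda> * (m - y x) * w x = 0"
      using integral_eq_0_iff[OF c \<open>p < s\<close>] by blast
    then have "2 * \<Lambda> * (m - y p) * w p = 0" using \<open>p < s\<close> by auto
    then show False using \<Lambda>_pos m01 w_pos[of p] p_less_b by (simp add: y_p)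
  qed
  \<comment> \<open>\<open>half_Psi m (y x)\<close> and \<open>G\<close> now have the same
    increments, hence the same derivative almost everywhere; the factor \<open>A / B\<close> is then
    removed and \<open>norm (\<tau> x)\<close> replaced by its known value.\<close>
  have dy: "AE x\<in>{q..r} in lborel. - (\<tau> x \<bullet> e) / 2 = 2 * \<Lambda> * w x * sqrt (m - y x) * sqrt (y x * (1 - y x))"
    if qr: "s < q" "q \<le> r" "r < t" for q r
  proof -
    have sub: "p \<le> q" "q \<le> r" "r \<le> b" using st qr by auto
    have y': "\<forall>x\<in>{q..r}. 0 < y x \<and> y x < m" using st(6) qr by auto
    note P = primPsi[OF sub m01(1) y']
    have "primitive_on q r (\<lambda>x. half_Psi m (y x)) g"
      unfolding primitive_on_def
    proof (intro conjI allI impI)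
      show "set_integrable lborel {q..r} g" by (rule int_g_sub[OF sub(1,3)])
      fix u v assume "q \<le> u" "u \<le> v" "v \<le> r"
      then show "(LBINT x:{u..v}. g x) = half_Psi m (y v) - half_Psi m (y u)"
        using PsiG[of u v] primitive_on_integral[OF primG, of u v] qr sub by simp
    qed
    from primitive_on_unique_AE[OF P this] speed show ?thesis
    proof eventually_elim
      case (elim x)
      show ?case
      proof
        assume x: "x \<in> {q..r}"
        define A B where "A = sqrt (m - y x)" and "B = sqrt (y x * (1 - y x))"
        have AB: "0 < A" "0 < B" using bspec[OF y' x] m01 by (auto simp: A_def B_def)
        have 1: "A / B * (- (\<tau> x \<bullet> e) / 2) = norm (\<tau> x) * A"
          using elim(1) x by (simp add: A_def B_def real_sqrt_divide g_def)
        have "- (\<tau> x \<bullet> e) / 2 = B / A * (A / B * (- (\<tau> x \<bullet> e) / 2))" using AB by simp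
        also have "\<dots> = norm (\<tau> x) * B" unfolding 1 using AB by simp
        also have "norm (\<tau> x) = 2 * \<Lambda> * A * w x" using elim(2) x sub by (simp add: A_def)
        finally show "- (\<tau> x \<bullet> e) / 2 = 2 * \<Lambda> * w x * sqrt (m - y x) * sqrt (y x * (1 - y x))"
          by (simp add: A_def B_def)
      qed
    qed
  qed
  \<comment> \<open>Separation of variables in \<open>dy\<close>: dividing by
    \<open>2 sqrt (m - y) sqrt (y (1 - y))\<close> makes the left side the derivative of
    \<open>half_Theta m (y x)\<close> and the right side \<open>\<Lambda> w\<close>. Hence
    \<open>H\<close> is constant on \<open>[s,t]\<close>.\<close>
  define H where "H x = \<Lambda> * (LBINT t:{p..x}. w t) - half_Theta m (y x)" for x
  have primw: "primitive_on p b (\<lambda>x. LBINT t:{p..x}. w t) w"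
  proof (rule primitive_onI[OF int_w])
    show "(LBINT t:{p..x}. w t) = (LBINT t:{p..x}. w t) - (LBINT t:{p..p}. w t)" for x
      using set_integral_split[OF int_w[of p b], of p] p_less_b by simp
  qed auto
  have cH: "continuous_on {s..t} H"
  proof -
    have "continuous_on {p..b} (\<lambda>x. half_Theta m (y x))"
      using y_bounds y_le_m
      by (intro continuous_on_compose2[OF continuous_half_Theta[OF m01] cy]) auto
    then have "continuous_on {p..b} H"
      unfolding H_def by (intro continuous_intros primitive_on_continuous[OF primw])
    then show ?thesis by (rule continuous_on_subset) (use st in auto)
  qed
  have H_const: "H q = H r" if qr: "s < q" "q \<le> r" "r < t" for q r
  proof -
    have sub: "p \<le> q" "q \<le> r" "r \<le> b" using st qr by auto
    have y': "\<forall>x\<in>{q..r}. 0 < y x \<and> y x < m" using st(6) qr by auto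
    have P: "primitive_on q r (\<lambda>x. half_Theta m (y x)) (\<lambda>x. 1 / (2 * sqrt (y x * (1 - y x)) * sqrt (m - y x)) * (- (\<tau> x \<bullet> e) / 2))"
    proof (rule primitive_on_chain[OF primitive_on_subinterval[OF primy sub(1,3)], where S = "{0<..<m}"
          and \<Phi> = "half_Theta m" and \<Phi>' = "\<lambda>z. 1 / (2 * sqrt (z * (1 - z)) * sqrt (m - z))"])
      show "y ` {q..r} \<subseteq> {0<..<m}" using y' by auto
      show "(half_Theta m has_real_derivative 1 / (2 * sqrt (z * (1 - z)) * sqrt (m - z))) (at z within {0<..<m})"
        if "z \<in> {0<..<m}" for z
        using that m01 by (intro has_field_derivative_at_within[OF half_Theta_has_derivative]) auto
      show "continuous_on {0<..<m} (\<lambda>z. 1 / (2 * sqrt (z * (1 - z)) * sqrt (m - z)))"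
        using m01 by (intro continuous_intros) auto
    qed
    have c\<Lambda>: "continuous_on {q..r} (\<lambda>x. \<Lambda> * w x)"
      using sub by (intro continuous_on_mult continuous_on_const continuous_on_subset[OF cw]) auto
    have ae: "AE x\<in>{q..r} in lborel. 1 / (2 * sqrt (y x * (1 - y x)) * sqrt (m - y x)) * (- (\<tau> x \<bullet> e) / 2) = \<Lambda> * w x"
      using dy[OF qr]
    proof eventually_elim
      case (elim x)
      show ?case
      proof
        assume x: "x \<in> {q..r}"
        define A B where "A = sqrt (m - y x)" and "B = sqrt (y x * (1 - y x))"
        have AB: "0 < A" "0 < B" using bspec[OF y' x] m01 by (auto simp: A_def B_def)
        have "- (\<tau> x \<bullet> e) / 2 = 2 * \<Lambda> * w x * A * B" using elim x by (simp add: A_def B_def)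
        then show "1 / (2 * sqrt (y x * (1 - y x)) * sqrt (m - y x)) * (- (\<tau> x \<bullet> e) / 2) = \<Lambda> * w x"
          using AB unfolding A_def[symmetric] B_def[symmetric] by (simp add: field_simps)
      qed
    qed
    have "primitive_on q r (\<lambda>x. half_Theta m (y x)) (\<lambda>x. \<Lambda> * w x)"
      by (rule primitive_on_cong_AE[OF P set_borel_measurable_continuous[OF c\<Lambda>] ae])
    from primitive_on_integral[OF this, of q r] primitive_on_integral[OF primw, of q r] sub
    show ?thesis by (simp add: H_def algebra_simps)
  qed
  have H_eq: "H q = H r" if "s \<le> q" "q \<le> r" "r \<le> t" for q r
  proof (rule antisym)
    show "H q \<le> H r" by (rule mono_on_closed_interval[OF cH _ that]) (simp add: H_const)
    have "- H q \<le> - H r"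
      by (rule mono_on_closed_interval[OF continuous_on_minus[OF cH] _ that]) (simp add: H_const)
    then show "H r \<le> H q" by simp
  qed
  have "H s = 0"
    using set_integral_split[OF int_w[of p b], of p] p_less_b
    by (simp add: H_def \<open>s = p\<close> y_p half_Theta_def)
  then have H0: "H x = 0" if "x \<in> {s..t}" for x using H_eq[of s x] that by simp
  \<comment> \<open>Since \<open>half_Theta m m = K(m_star)\<close>, the arc from \<open>p\<close>
    to \<open>t\<close> already has the full length \<open>K(m_star) / \<Lambda>\<close> of the
    half.\<close>
  have "t = b"
  proof (rule ccontr)
    assume "t \<noteq> b"
    with st have "t < b" by simp
    have "half_Theta m m = ellK m_star" using m01 by (simp add: half_Theta_def m ellK_def)
    then have "\<Lambda> * (LBINT x:{p..t}. w x) = \<Lambda> * (LBINT x:{p..b}. w x)"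
      using H0[of t] st by (simp add: H_def \<Lambda>_eq)
    then have "(LBINT x:{p..t}. w x) = (LBINT x:{p..b}. w x)" using \<Lambda>_pos by simp
    then have z: "(LBINT x:{t..b}. w x) = 0"
      using set_integral_split[OF int_w[of p b], of t] st by simp
    have c: "continuous_on {t..b} w" using st by (intro continuous_on_subset[OF cw]) auto
    have "integral {t..b} w = 0"
      using z set_borel_integral_eq_integral(2)[OF borel_integrable_atLeastAtMost'[OF c]] by simp
    moreover have "0 \<le> w x" if "x \<in> {t..b}" for x
      using w_pos[of x] that st by auto
    ultimately have "\<forall>x\<in>{t..b}. w x = 0"
      using integral_eq_0_iff[OF c \<open>t < b\<close>] by blast
    then have "w t = 0" using \<open>t < b\<close> by simp
    then show False using w_pos[of t] st by auto
  qed
  show "y b = m" using st(5) \<open>t = b\<close> by simp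
  show "\<forall>x\<in>{p<..<b}. 0 < y x \<and> y x < m" using st(6) \<open>s = p\<close> \<open>t = b\<close> by simp
  show "AE x\<in>{p..b} in lborel. - (\<tau> x \<bullet> e) / 2 = 2 * \<Lambda> * w x * sqrt (m - y x) * sqrt (y x * (1 - y x))"
    unfolding AE_Ioo_Icc[of p b, symmetric]
  proof (rule AE_Ioo_if_AE_Icc)
    fix c d assume "p < c" "d < b"
    show "AE x\<in>{c..d} in lborel. - (\<tau> x \<bullet> e) / 2 = 2 * \<Lambda> * w x * sqrt (m - y x) * sqrt (y x * (1 - y x))"
    proof (cases "c \<le> d")
      case True
      then show ?thesis using dy[of c d] \<open>p < c\<close> \<open>d < b\<close> \<open>s = p\<close> \<open>t = b\<close> by simp
    qed auto
  qed
  show "\<forall>x\<in>{p..b}. half_Theta m (y x) = \<Lambda> * (LBINT t:{p..x}. w t)"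
    using H0 \<open>s = p\<close> \<open>t = b\<close> by (simp add: H_def)
qed

end

text \<open>Here \<open>T'\<close> is the tangent, \<open>t\<close> its derivative, and
  \<open>c\<close>, \<open>2 * s\<close> are the cosine and sine of its angle to \<open>e\<close>.
  The left side is the derivative of the unit vector \<open>(T' - c e) / (2 s)\<close>, the
  direction in which \<open>T'\<close> departs from \<open>e\<close>. Equality in Cauchy-Schwarz
  makes \<open>t\<close> a multiple of \<open>e - c T'\<close>, so motion along the great circle
  leaves this direction fixed.\<close>

lemma normal_derivative_zero:
  fixes t T' e :: "'a::euclidean_space" and s c :: real
  assumes s: "0 < s" and c: "1 - c\<^sup>2 = 4 * s\<^sup>2" and u: "norm (e - c *\<^sub>R T') = 2 * s"
    and t: "t \<bullet> T' = 0" "- (t \<bullet> e) / 2 = norm t * s"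
  shows "(- c / (4 * s ^ 3) * (- (t \<bullet> e) / 2)) *\<^sub>R (T' - c *\<^sub>R e) + (1 / (2 * s)) *\<^sub>R (t - (t \<bullet> e) *\<^sub>R e) = 0"
proof -
  define k where "k = - norm t / (2 * s)"
  have te: "t \<bullet> e = - 2 * norm t * s" using t(2) by simp
  define v where "v = - (e - c *\<^sub>R T')"
  have v: "norm v = 2 * s" unfolding v_def norm_minus_cancel by (rule u)
  \<comment> \<open>The equality case of Cauchy-Schwarz. The minus sign in \<open>v\<close> reflects
    that the angle to \<open>e\<close> increases, so \<open>t\<close> points away from
    \<open>e\<close>.\<close>
  have "t \<bullet> v = norm t * norm v"
    unfolding v using t(1) te by (simp add: v_def inner_diff_right)
  then have "norm t *\<^sub>R v = norm v *\<^sub>R t"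
    unfolding norm_cauchy_schwarz_eq .
  then have "(2 * s) *\<^sub>R t = norm t *\<^sub>R v" by (simp only: v)
  then have "(2 * s) *\<^sub>R t = - norm t *\<^sub>R (e - c *\<^sub>R T')"
    by (simp only: v_def scaleR_minus_right scaleR_minus_left)
  then have "(1 / (2 * s)) *\<^sub>R ((2 * s) *\<^sub>R t) = (1 / (2 * s)) *\<^sub>R (- norm t *\<^sub>R (e - c *\<^sub>R T'))"
    by simp
  then have tk: "t = k *\<^sub>R (e - c *\<^sub>R T')"
    using s by (simp add: k_def)
  define \<alpha> \<beta> te' where "\<alpha> = - c / (4 * s ^ 3) * (norm t * s)" and "\<beta> = 1 / (2 * s)" and "te' = t \<bullet> e"
  have "\<alpha> *\<^sub>R (T' - c *\<^sub>R e) + \<beta> *\<^sub>R (t - te' *\<^sub>R e) = \<alpha> *\<^sub>R (T' - c *\<^sub>R e) + \<beta> *\<^sub>R (k *\<^sub>R (e - c *\<^sub>R T') - te' *\<^sub>R e)"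
    using tk by simp
  also have "\<dots> = (\<alpha> - \<beta> * k * c) *\<^sub>R T' + (\<beta> * k - \<alpha> * c - \<beta> * te') *\<^sub>R e"
    by (simp add: algebra_simps)
  also have "\<alpha> - \<beta> * k * c = 0"
    using s by (simp add: \<alpha>_def \<beta>_def k_def field_simps power3_eq_cube)
  also have "\<beta> * k - \<alpha> * c - \<beta> * te' = norm t / (4 * s\<^sup>2) * (4 * s\<^sup>2 - (1 - c\<^sup>2))"
    using s by (simp add: \<alpha>_def \<beta>_def k_def te'_def te field_simps power3_eq_cube power2_eq_square)
  also have "\<dots> = 0" by (simp add: c)
  finally show ?thesis unfolding \<alpha>_def \<beta>_def te'_def t(2) by simp
qed

lemma half_normal_has_derivative:
  assumes "0 < z" "z < 1"
  shows "((\<lambda>z. 1 / (2 * sqrt (z * (1 - z)))) has_real_derivative - (1 - 2 * z) / (4 * (sqrt (z * (1 - z))) ^ 3)) (at z)"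
proof -
  have pos: "0 < z * (1 - z)" using assms by simp
  have "((\<lambda>z. z * (1 - z)) has_real_derivative 1 - 2 * z) (at z)"
    by (auto intro!: derivative_eq_intros)
  from DERIV_chain2[OF DERIV_real_sqrt[OF pos] this]
  have "((\<lambda>z. sqrt (z * (1 - z))) has_real_derivative inverse (sqrt (z * (1 - z))) / 2 * (1 - 2 * z)) (at z)" .
  moreover have "2 * sqrt (z * (1 - z)) \<noteq> 0" using assms by simp
  ultimately
  have d: "((\<lambda>z. 1 / (2 * sqrt (z * (1 - z)))) has_real_derivative
     (0 * (2 * sqrt (z * (1 - z))) - 1 * (2 * (inverse (sqrt (z * (1 - z))) / 2 * (1 - 2 * z)))) /
       (2 * sqrt (z * (1 - z)) * (2 * sqrt (z * (1 - z))))) (at z)"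
    by (intro DERIV_divide DERIV_const DERIV_cmult)
  have "(0 * (2 * s) - 1 * (2 * (inverse s / 2 * (1 - 2 * z)))) / (2 * s * (2 * s)) =
     - (1 - 2 * z) / (4 * s ^ 3)" if "s > 0" for s :: real
    using that by (simp add: field_simps power3_eq_cube)
  from DERIV_cong[OF d this] pos show ?thesis by simp
qed

context half_leaf
begin

text \<open>The departure direction \<open>N x\<close> has derivative 0 by
  \<open>normal_derivative_zero\<close>, which keeps \<open>T\<close> in the plane of
  \<open>e\<close> and \<open>N\<close>. Its position is read off from
  \<open>half_Theta m (y x) = \<Lambda> s\<close>, \<open>s\<close> being the arclength from
  \<open>p\<close>: the angle \<open>\<psi>\<close> with \<open>y = m (sin \<psi>)\<^sup>2\<close>
  is the amplitude of \<open>\<Lambda> s\<close>.\<close>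

lemma equality_shape:
  assumes eq: "J = Jmin"
  obtains N where "norm N = 1" "N \<bullet> e = 0"
    "\<And>x. x \<in> {p..b} \<Longrightarrow> T x = fig_cos (jacobi_am (\<Lambda> * (LBINT t:{p..x}. w t)) m_star) *\<^sub>R e +
      fig_sin (jacobi_am (\<Lambda> * (LBINT t:{p..x}. w t)) m_star) *\<^sub>R N"
proof -
  note m = equality(1)[OF eq] and speed = equality(3)[OF eq]
  note yi = equality_full_range(2)[OF eq] and dy = equality_full_range(3)[OF eq]
    and Theta = equality_full_range(4)[OF eq]
  have m01: "0 < m" "m < 1" using m_star by (simp_all add: m)
  have c_eq: "T x \<bullet> e = 1 - 2 * y x" for x by (simp add: y_def field_simps)
  define S where "S x = sqrt (y x * (1 - y x))" for x
  have S_pos: "0 < S x" if "x \<in> {p<..<b}" for x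
  proof -
    have "0 < y x" "0 < 1 - y x" using bspec[OF yi that] m01 by auto
    then show ?thesis unfolding S_def by simp
  qed
  have S_sq: "1 - (T x \<bullet> e)\<^sup>2 = 4 * (S x)\<^sup>2" if "x \<in> {p..b}" for x
  proof -
    have "(S x)\<^sup>2 = y x * (1 - y x)"
      unfolding S_def using y_bounds[OF that] by (intro real_sqrt_pow2) simp
    then show ?thesis unfolding c_eq by (simp add: power2_eq_square algebra_simps)
  qed
  define N where "N x = (1 / (2 * S x)) *\<^sub>R (T x - (T x \<bullet> e) *\<^sub>R e)" for x
  have primP: "primitive_on p b (\<lambda>x. T x - (T x \<bullet> e) *\<^sub>R e) (\<lambda>x. \<tau> x - (\<tau> x \<bullet> e) *\<^sub>R e)"
    by (intro primitive_on_diff primT primitive_on_bounded_linear[OF primT]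
        bounded_linear_compose[OF bounded_linear_scaleR_left bounded_linear_inner_left])
  have N_const: "N q = N r" if qr: "p < q" "q \<le> r" "r < b" for q r
  proof -
    have R: "primitive_on q r (\<lambda>x. 1 / (2 * sqrt (y x * (1 - y x))))
       (\<lambda>x. - (1 - 2 * y x) / (4 * (sqrt (y x * (1 - y x))) ^ 3) * (- (\<tau> x \<bullet> e) / 2))"
    proof (rule primitive_on_chain[OF primitive_on_subinterval[OF primy, of q r], where S = "{0<..<1}"
        and \<Phi> = "\<lambda>z. 1 / (2 * sqrt (z * (1 - z)))" and \<Phi>' = "\<lambda>z. - (1 - 2 * z) / (4 * (sqrt (z * (1 - z))) ^ 3)"])
      show "y ` {q..r} \<subseteq> {0<..<1}"
      proof (rule image_subsetI)
        fix x assume "x \<in> {q..r}"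
        then have "x \<in> {p<..<b}" using qr by auto
        from bspec[OF yi this] m01 show "y x \<in> {0<..<1}" by auto
      qed
      show "((\<lambda>z. 1 / (2 * sqrt (z * (1 - z)))) has_real_derivative - (1 - 2 * z) / (4 * (sqrt (z * (1 - z))) ^ 3)) (at z within {0<..<1})"
        if "z \<in> {0<..<1}" for z
        by (rule has_field_derivative_at_within[OF half_normal_has_derivative]) (use that in auto)
      show "continuous_on {0<..<1} (\<lambda>z::real. - (1 - 2 * z) / (4 * (sqrt (z * (1 - z))) ^ 3))"
        by (intro continuous_intros) auto
    qed (use qr in auto)
    have P: "primitive_on q r N (\<lambda>x. (- (1 - 2 * y x) / (4 * (sqrt (y x * (1 - y x))) ^ 3) * (- (\<tau> x \<bullet> e) / 2)) *\<^sub>R (T x - (T x \<bullet> e) *\<^sub>R e)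
        + (1 / (2 * sqrt (y x * (1 - y x)))) *\<^sub>R (\<tau> x - (\<tau> x \<bullet> e) *\<^sub>R e))"
      using primitive_on_bilinear[OF bounded_bilinear_scaleR R primitive_on_subinterval[OF primP, of q r]] qr
      unfolding N_def[abs_def] S_def by simp
    have "AE x\<in>{q..r} in lborel. (- (1 - 2 * y x) / (4 * (sqrt (y x * (1 - y x))) ^ 3) * (- (\<tau> x \<bullet> e) / 2)) *\<^sub>R (T x - (T x \<bullet> e) *\<^sub>R e)
        + (1 / (2 * sqrt (y x * (1 - y x)))) *\<^sub>R (\<tau> x - (\<tau> x \<bullet> e) *\<^sub>R e) = 0"
      using orth speed dy
    proof eventually_elim
      case (elim x)
      show ?case
      proof
        assume x: "x \<in> {q..r}"
        then have x': "x \<in> {p<..<b}" "x \<in> {p..b}" using qr by auto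
        have n: "norm (\<tau> x) = 2 * \<Lambda> * sqrt (m - y x) * w x" using elim(2) x'(2) by blast
        have "- (\<tau> x \<bullet> e) / 2 = 2 * \<Lambda> * w x * sqrt (m - y x) * S x"
          using elim(3) x'(2) unfolding S_def by blast
        then have t2: "- (\<tau> x \<bullet> e) / 2 = norm (\<tau> x) * S x"
          by (simp only: n ac_simps)
        have t1: "\<tau> x \<bullet> T x = 0" using elim(1) x' by simp
        have "norm (e - (T x \<bullet> e) *\<^sub>R T x) = 2 * S x" using sphere_norm[OF x'(2)] by (simp add: S_def)
        from normal_derivative_zero[OF S_pos[OF x'(1)] S_sq[OF x'(2)] this t1 t2]
        show "(- (1 - 2 * y x) / (4 * (sqrt (y x * (1 - y x))) ^ 3) * (- (\<tau> x \<bullet> e) / 2)) *\<^sub>R (T x - (T x \<bullet> e) *\<^sub>R e)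
          + (1 / (2 * sqrt (y x * (1 - y x)))) *\<^sub>R (\<tau> x - (\<tau> x \<bullet> e) *\<^sub>R e) = 0"
          unfolding S_def c_eq .
      qed
    qed
    from primitive_on_cong_AE[OF P set_borel_measurable_continuous[OF continuous_on_const] this]
    have "primitive_on q r N (\<lambda>_. 0)" .
    from primitive_on_integral[OF this, of q r] qr show ?thesis
      by (simp add: set_lebesgue_integral_def)
  qed
  define N0 where "N0 = N ((p + b) / 2)"
  have N0: "N x = N0" if "x \<in> {p<..<b}" for x
  proof (cases "x \<le> (p + b) / 2")
    case True
    then show ?thesis unfolding N0_def using that by (intro N_const) auto
  next
    case False
    then show ?thesis unfolding N0_def using that by (intro N_const[symmetric]) auto
  qed
  have T_in: "T x = (1 - 2 * y x) *\<^sub>R e + (2 * S x) *\<^sub>R N0" if x: "x \<in> {p<..<b}" for x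
    using S_pos[OF x] unfolding N0[OF x, symmetric] N_def c_eq[symmetric] by simp
  define c where "c = (p + b) / 2"
  have c: "c \<in> {p<..<b}" "c \<in> {p..b}" using p_less_b by (auto simp: c_def)
  have ee: "e \<bullet> e = 1" using norm_e by (simp add: dot_square_norm)
  have N0e: "N0 \<bullet> e = 0"
    unfolding N0[OF c(1), symmetric] N_def by (simp add: inner_diff_left ee)
  have "norm N0 = 1"
  proof -
    have "1 = T c \<bullet> T c" using T_unit[OF c(2)] by (simp add: dot_square_norm)
    also have "\<dots> = (1 - 2 * y c)\<^sup>2 + 4 * (S c)\<^sup>2 * (N0 \<bullet> N0)"
      unfolding T_in[OF c(1)]
      by (simp add: inner_add_left inner_add_right ee N0e inner_commute[of e N0] power2_eq_square)
    finally have "4 * (S c)\<^sup>2 * (N0 \<bullet> N0) = 4 * (S c)\<^sup>2"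
      using S_sq[OF c(2)] unfolding c_eq by linarith
    then have "N0 \<bullet> N0 = 1" using S_pos[OF c(1)] by simp
    then show ?thesis by (simp add: norm_eq_sqrt_inner)
  qed
  moreover have "T x = fig_cos (jacobi_am (\<Lambda> * (LBINT t:{p..x}. w t)) m_star) *\<^sub>R e +
      fig_sin (jacobi_am (\<Lambda> * (LBINT t:{p..x}. w t)) m_star) *\<^sub>R N0" if x: "x \<in> {p..b}" for x
  proof -
    let ?a = "arcsin (sqrt (y x / m))"
    have yx: "0 \<le> y x" "y x \<le> m" using y_bounds[OF x] y_le_m[OF x] by auto
    have am: "jacobi_am (\<Lambda> * (LBINT t:{p..x}. w t)) m_star = ?a"
    proof -
      have "\<Lambda> * (LBINT t:{p..x}. w t) = ellF ?a m" using Theta x by (simp add: half_Theta_def)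
      then show ?thesis using jacobi_am_ellF[OF m01(2)] by (simp add: m)
    qed
    have fc: "fig_cos ?a = 1 - 2 * y x"
      unfolding fig_cos_def m[symmetric] using sin_arcsin_sqrt[OF m01(1) yx] m01 by simp
    have "sin ?a = sqrt (y x / m)"
      using yx m01 by (intro sin_arcsin) (auto simp: real_le_lsqrt intro: order_trans[of "-1" 0])
    then have fs: "fig_sin ?a = 2 * S x"
      unfolding fig_sin_def m[symmetric] ell_delta_arcsin_sqrt[OF m01(1) yx]
      using m01 by (simp add: S_def real_sqrt_divide real_sqrt_mult)
    \<comment> \<open>The quotient defining \<open>N\<close> breaks down at \<open>p\<close>, where
      \<open>S\<close> vanishes; continuity extends the representation to the closed
      interval.\<close>
    have "T x = (1 - 2 * y x) *\<^sub>R e + (2 * S x) *\<^sub>R N0"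
    proof (rule continuous_AE_eq_imp_eq[of p b T _ x, OF _ _ p_less_b _ x])
      show "continuous_on {p..b} T" by (rule primitive_on_continuous[OF primT])
      show "continuous_on {p..b} (\<lambda>x. (1 - 2 * y x) *\<^sub>R e + (2 * S x) *\<^sub>R N0)"
        unfolding S_def by (intro continuous_intros cy)
    qed (use T_in in auto)
    then show ?thesis unfolding am fc fs .
  qed
  ultimately show ?thesis using N0e by (intro that)
qed

end

section \<open>Figure-eight curves\<close>

lemma jacobi_am_minus: "jacobi_am (- u) m_star = - jacobi_am u m_star"
proof -
  have "ellF (- jacobi_am u m_star) m_star = - u"
    using m_star ellF_jacobi_am[of m_star u] by (simp add: ellF_minus)
  then show ?thesis using jacobi_am_ellF[OF m_star(2), of "- jacobi_am u m_star"] by simp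
qed

lemma jacobi_am_ellK: "jacobi_am (ellK m_star) m_star = pi / 2"
  unfolding ellK_def by (rule jacobi_am_ellF[OF m_star(2)])

lemma jacobi_am_0: "jacobi_am 0 m_star = 0"
  using jacobi_am_ellF[OF m_star(2), of 0] by simp

lemma fig_cos_minus [simp]: "fig_cos (- \<psi>) = fig_cos \<psi>"
  by (simp add: fig_cos_def)

lemma fig_sin_minus [simp]: "fig_sin (- \<psi>) = - fig_sin \<psi>"
  by (simp add: fig_sin_def)

lemma continuous_fig_cos: "continuous_on S fig_cos"
  unfolding fig_cos_def by (intro continuous_intros)

lemma continuous_fig_sin: "continuous_on S fig_sin"
  unfolding fig_sin_def by (intro continuous_intros)

text \<open>The bracketed factor is the \<open>\<psi>\<close>-derivative of the tangent angle
  \<open>2 arcsin (sqrt m_star sin \<psi>)\<close>; the same factor occurs for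
  \<open>fig_sin\<close>.\<close>

lemma fig_cos_has_derivative:
  "(fig_cos has_real_derivative - (2 * sqrt m_star * cos \<psi> / ell_delta m_star \<psi>) * fig_sin \<psi>) (at \<psi>)"
proof -
  have "(fig_cos has_real_derivative - (4 * m_star * sin \<psi> * cos \<psi>)) (at \<psi>)"
    unfolding fig_cos_def[abs_def] by (auto intro!: derivative_eq_intros)
  moreover have "(2 * sqrt m_star * cos \<psi> / ell_delta m_star \<psi>) * fig_sin \<psi> = 4 * (sqrt m_star * sqrt m_star) * sin \<psi> * cos \<psi>"
    using ell_delta_nz[OF m_star(2), of \<psi>] by (simp add: fig_sin_def)
  moreover have "sqrt m_star * sqrt m_star = m_star" using m_star by simp
  ultimately show ?thesis by simp
qed

lemma fig_sin_has_derivative: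
  "(fig_sin has_real_derivative (2 * sqrt m_star * cos \<psi> / ell_delta m_star \<psi>) * fig_cos \<psi>) (at \<psi>)"
proof -
  let ?d = "ell_delta m_star \<psi>"
  have "(fig_sin has_real_derivative 2 * sqrt m_star * (cos \<psi> * ?d + (- m_star * sin \<psi> * cos \<psi> / ?d) * sin \<psi>)) (at \<psi>)"
    unfolding fig_sin_def[abs_def] mult.assoc
    by (intro DERIV_cmult DERIV_mult DERIV_sin ell_delta_has_derivative[OF m_star(2), unfolded mult.assoc])
  moreover have "cos \<psi> * ?d + (- m_star * sin \<psi> * cos \<psi> / ?d) * sin \<psi> = cos \<psi> / ?d * (?d\<^sup>2 - m_star * (sin \<psi>)\<^sup>2)"
    using ell_delta_nz[OF m_star(2), of \<psi>] by (simp add: field_simps power2_eq_square)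
  moreover have "?d\<^sup>2 - m_star * (sin \<psi>)\<^sup>2 = fig_cos \<psi>"
    by (simp add: ell_delta_square[OF m_star(2)] fig_cos_def)
  ultimately show ?thesis by (simp add: mult.assoc)
qed

context framed
begin

definition "\<Lambda> = 2 * ellK m_star / curve_length a b \<gamma>"

text \<open>The amplitude whose cosine is the \<open>jacobi_cn\<close> of the figure-eight
  curvature. The shift by \<open>K\<close> places the midpoint of arclength at 0, so
  \<open>psi\<close> runs from \<open>- pi / 2\<close> to \<open>pi / 2\<close>.\<close>

definition "psi x = jacobi_am (\<Lambda> * (LBINT t:{a..x}. w t) - ellK m_star) m_star"

lemma curve_length_pos: "0 < curve_length a b \<gamma>"
  using w_integral_pos[of a b] a_less_b by (simp add: curve_length_eq)

lemma \<Lambda>_pos: "0 < \<Lambda>"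
  using curve_length_pos ellK_pos[OF m_star(2)] by (simp add: \<Lambda>_def)

lemma \<Lambda>_length: "\<Lambda> * (LBINT t:{a..b}. w t) = 2 * ellK m_star"
  using curve_length_pos by (simp add: \<Lambda>_def curve_length_eq)

lemma w_integral_a: "(LBINT t:{a}. w t) = 0"
  using set_integral_split[OF w_integrable[of a b], of a] a_less_b by simp

lemma primitive_arclength: "primitive_on a b (\<lambda>x. LBINT t:{a..x}. w t) w"
  by (rule primitive_onI[OF w_integrable]) (auto simp: w_integral_a)

lemma psi_a: "psi a = - pi / 2"
  using jacobi_am_minus[of "ellK m_star"] by (simp add: psi_def w_integral_a jacobi_am_ellK)

lemma psi_b: "psi b = pi / 2"
  by (simp add: psi_def \<Lambda>_length jacobi_am_ellK)

lemma psi_has_derivative: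
  assumes "x \<in> {a..b}"
  shows "(psi has_real_derivative \<Lambda> * w x * ell_delta m_star (psi x)) (at x within {a..b})"
proof -
  have "((\<lambda>x. LBINT t:{a..x}. w t) has_real_derivative w x) (at x within {a..b})"
    using primitive_on_has_vector_derivative[OF primitive_arclength continuous_w assms]
    by (simp add: has_real_derivative_iff_has_vector_derivative)
  then have "((\<lambda>x. \<Lambda> * (LBINT t:{a..x}. w t) - ellK m_star) has_real_derivative \<Lambda> * w x) (at x within {a..b})"
    using DERIV_diff[OF DERIV_cmult DERIV_const] by fastforce
  from DERIV_chain2[OF jacobi_am_has_derivative[OF less_imp_le[OF m_star(1)] m_star(2)] this]
  show ?thesis by (simp add: psi_def[abs_def] ac_simps)
qed

lemma continuous_psi: "continuous_on {a..b} psi"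
  using psi_has_derivative by (intro DERIV_continuous_on)

end

text \<open>In the product of the angle derivative with
  \<open>\<psi>' = \<Lambda> w ell_delta\<close> the factor \<open>ell_delta\<close> cancels,
  leaving \<open>w\<close> times the signed curvature
  \<open>2 sqrt m_star \<Lambda> cos \<psi>\<close>.\<close>

lemma fig_primitive:
  fixes e1 e2 :: "'a::euclidean_space"
  assumes psi: "\<And>x. x \<in> {a..b} \<Longrightarrow> (psi has_real_derivative \<Lambda> * w x * ell_delta m_star (psi x)) (at x within {a..b})"
    and w: "continuous_on {a..b} w"
    and T: "\<And>x. x \<in> {a..b} \<Longrightarrow> T x = fig_cos (psi x) *\<^sub>R e1 + fig_sin (psi x) *\<^sub>R e2"
  shows "primitive_on a b T (\<lambda>x. (2 * sqrt m_star * \<Lambda> * w x * cos (psi x)) *\<^sub>R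
     (- fig_sin (psi x) *\<^sub>R e1 + fig_cos (psi x) *\<^sub>R e2))"
proof -
  have cpsi: "continuous_on {a..b} psi" using psi by (intro DERIV_continuous_on)
  have "primitive_on a b (\<lambda>x. fig_cos (psi x) *\<^sub>R e1 + fig_sin (psi x) *\<^sub>R e2)
    (\<lambda>x. (2 * sqrt m_star * \<Lambda> * w x * cos (psi x)) *\<^sub>R (- fig_sin (psi x) *\<^sub>R e1 + fig_cos (psi x) *\<^sub>R e2))"
  proof (rule primitive_on_FTC)
    fix x assume "a \<le> x" "x \<le> b"
    then have x: "x \<in> {a..b}" by simp
    define k where "k = 2 * sqrt m_star * \<Lambda> * w x * cos (psi x)"
    have nz: "ell_delta m_star (psi x) \<noteq> 0" by (rule ell_delta_nz[OF m_star(2)])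
    have "((\<lambda>x. fig_cos (psi x)) has_real_derivative - k * fig_sin (psi x)) (at x within {a..b})"
      by (rule DERIV_cong[OF DERIV_chain2[OF fig_cos_has_derivative psi[OF x]]])
         (use nz in \<open>simp add: k_def\<close>)
    moreover have "((\<lambda>x. fig_sin (psi x)) has_real_derivative k * fig_cos (psi x)) (at x within {a..b})"
      by (rule DERIV_cong[OF DERIV_chain2[OF fig_sin_has_derivative psi[OF x]]])
         (use nz in \<open>simp add: k_def\<close>)
    ultimately have "((\<lambda>x. fig_cos (psi x) *\<^sub>R e1 + fig_sin (psi x) *\<^sub>R e2) has_vector_derivative
        (- k * fig_sin (psi x)) *\<^sub>R e1 + (k * fig_cos (psi x)) *\<^sub>R e2) (at x within {a..b})"
      unfolding has_real_derivative_iff_has_vector_derivative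
      using has_vector_derivative_add[OF
          bounded_linear.has_vector_derivative[OF bounded_linear_scaleR_left]
          bounded_linear.has_vector_derivative[OF bounded_linear_scaleR_left]] by blast
    then show "((\<lambda>x. fig_cos (psi x) *\<^sub>R e1 + fig_sin (psi x) *\<^sub>R e2) has_vector_derivative
        (2 * sqrt m_star * \<Lambda> * w x * cos (psi x)) *\<^sub>R (- fig_sin (psi x) *\<^sub>R e1 + fig_cos (psi x) *\<^sub>R e2)) (at x within {a..b})"
      unfolding k_def[symmetric] by (simp add: scaleR_add_right scaleR_minus_right scaleR_diff_right)
  next
    show "continuous_on {a..b} (\<lambda>x. (2 * sqrt m_star * \<Lambda> * w x * cos (psi x)) *\<^sub>R
        (- fig_sin (psi x) *\<^sub>R e1 + fig_cos (psi x) *\<^sub>R e2))"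
      by (intro continuous_intros w cpsi continuous_on_compose2[OF continuous_fig_cos[of UNIV] cpsi]
          continuous_on_compose2[OF continuous_fig_sin[of UNIV] cpsi]) auto
  qed
  then show ?thesis by (rule primitive_on_cong) (simp_all add: T)
qed

context framed
begin

lemma figure_eight_curvature_eq:
  "figure_eight_curvature (curve_length a b \<gamma>) (LBINT t:{a..x}. w t) = 2 * sqrt m_star * \<Lambda> * cos (psi x)"
  by (simp add: figure_eight_curvature_def Let_def \<Lambda>_def psi_def jacobi_cn_def)

lemma fig_imp_half_fold:
  assumes e: "norm e1 = 1" "norm e2 = 1" "e1 \<bullet> e2 = 0"
    and T: "\<And>x. x \<in> {a..b} \<Longrightarrow> T x = fig_cos (psi x) *\<^sub>R e1 + fig_sin (psi x) *\<^sub>R e2"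
  shows "half_fold_figure_eight_elastica a b \<gamma>"
  unfolding half_fold_figure_eight_elastica_def
proof (rule conjI[OF immersed], rule exI[of _ "\<gamma> a"], rule exI[of _ e1], rule exI[of _ e2],
    rule exI[of _ 1], intro conjI ballI e)
  have ee: "e1 \<bullet> e1 = 1" "e2 \<bullet> e2 = 1" "e2 \<bullet> e1 = 0"
    using e by (simp_all add: dot_square_norm inner_commute)
  show "\<gamma> x - \<gamma> a \<in> span {e1, e2}" if x: "x \<in> {a..b}" for x
  proof -
    have i: "set_integrable lborel {a..x} (\<lambda>t. w t * fig_cos (psi t))" "set_integrable lborel {a..x} (\<lambda>t. w t * fig_sin (psi t))"
      using x by (auto intro!: borel_integrable_atLeastAtMost' continuous_on_mult continuous_on_subset[OF continuous_w]
          continuous_on_compose2[OF continuous_fig_cos[of UNIV] continuous_on_subset[OF continuous_psi]]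
          continuous_on_compose2[OF continuous_fig_sin[of UNIV] continuous_on_subset[OF continuous_psi]])
    have "\<gamma> x - \<gamma> a = (LBINT t:{a..x}. w t *\<^sub>R T t)"
      using primitive_on_integral[OF primitive_\<gamma>, of a x] x by simp
    also have "\<dots> = (LBINT t:{a..x}. (w t * fig_cos (psi t)) *\<^sub>R e1 + (w t * fig_sin (psi t)) *\<^sub>R e2)"
      using x by (intro set_lebesgue_integral_cong) (auto simp: T scaleR_add_right)
    also have "\<dots> = (LBINT t:{a..x}. w t * fig_cos (psi t)) *\<^sub>R e1 + (LBINT t:{a..x}. w t * fig_sin (psi t)) *\<^sub>R e2"
      using i set_integrable_bounded_linear[OF bounded_linear_scaleR_left i(1), of e1]
        set_integrable_bounded_linear[OF bounded_linear_scaleR_left i(2), of e2]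
        set_integral_bounded_linear[OF bounded_linear_scaleR_left i(1), of e1]
        set_integral_bounded_linear[OF bounded_linear_scaleR_left i(2), of e2]
      by simp
    also have "\<dots> \<in> span {e1, e2}"
      by (intro span_add span_scale span_base) auto
    finally show ?thesis .
  qed
  have P: "primitive_on a b T (\<lambda>x. (2 * sqrt m_star * \<Lambda> * w x * cos (psi x)) *\<^sub>R
     (- fig_sin (psi x) *\<^sub>R e1 + fig_cos (psi x) *\<^sub>R e2))"
    by (rule fig_primitive[OF psi_has_derivative continuous_w T])
  have "AE x\<in>{a<..<b} in lborel. signed_curvature a b \<gamma> e1 e2 x =
      1 * figure_eight_curvature (curve_length a b \<gamma>) (arclength a b \<gamma> x)"
    using signed_curvature_AE[of e1 e2] primitive_on_unique_AE[OF primitive_T P]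
  proof eventually_elim
    case (elim x)
    show ?case
    proof
      assume x: "x \<in> {a<..<b}"
      then have x': "x \<in> {a..b}" by auto
      have Te: "T x \<bullet> e1 = fig_cos (psi x)" "T x \<bullet> e2 = fig_sin (psi x)"
        unfolding T[OF x'] using e(3) by (simp_all add: inner_add_left ee)
      define k where "k = 2 * sqrt m_star * \<Lambda> * cos (psi x)"
      have tw: "\<tau> x /\<^sub>R w x = k *\<^sub>R (- fig_sin (psi x) *\<^sub>R e1 + fig_cos (psi x) *\<^sub>R e2)"
        using elim(2) x' speed_pos[OF x'] by (simp add: k_def)
      have "signed_curvature a b \<gamma> e1 e2 x = (\<tau> x /\<^sub>R w x) \<bullet> ((T x \<bullet> e1) *\<^sub>R e2 - (T x \<bullet> e2) *\<^sub>R e1)"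
        using elim(1) x by blast
      also have "\<dots> = k * ((fig_cos (psi x))\<^sup>2 + (fig_sin (psi x))\<^sup>2)"
        unfolding tw Te using e(3) by (simp add: inner_diff_right inner_add_left ee power2_eq_square algebra_simps)
      finally show "signed_curvature a b \<gamma> e1 e2 x = 1 * figure_eight_curvature (curve_length a b \<gamma>) (arclength a b \<gamma> x)"
        using x' by (simp add: fig_cos_sin_square arclength_eq figure_eight_curvature_eq k_def)
    qed
  qed
  then show "AE x in lborel. x \<in> {a<..<b} \<longrightarrow> signed_curvature a b \<gamma> e1 e2 x =
      1 * figure_eight_curvature (curve_length a b \<gamma>) (arclength a b \<gamma> x)" .
qed simp

text \<open>The curve is not reconstructed from its curvature. Once \<open>\<tau>\<close> is known
  to lie in the plane and to be orthogonal to \<open>T\<close>, the signed curvature determines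
  \<open>norm (\<tau> x)\<close> and hence the energy.\<close>

lemma half_fold_imp_energy:
  assumes "half_fold_figure_eight_elastica a b \<gamma>"
  shows "normalized_bending_energy a b \<gamma> = varpi_star"
proof -
  obtain p e1 e2 \<sigma> where e: "norm e1 = 1" "norm e2 = 1" "e1 \<bullet> e2 = 0"
    and plane: "\<And>x. x \<in> {a..b} \<Longrightarrow> \<gamma> x - p \<in> span {e1, e2}" and \<sigma>: "\<sigma> \<in> {1, -1::real}"
    and curv: "AE x\<in>{a<..<b} in lborel. signed_curvature a b \<gamma> e1 e2 x =
             \<sigma> * figure_eight_curvature (curve_length a b \<gamma>) (arclength a b \<gamma> x)"
    using assms unfolding half_fold_figure_eight_elastica_def by blast
  have ee: "e1 \<bullet> e1 = 1" "e2 \<bullet> e2 = 1" "e2 \<bullet> e1 = 0"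
    using e by (simp_all add: dot_square_norm inner_commute)
  \<comment> \<open>The component orthogonal to the plane. It is constant along
    \<open>\<gamma>\<close>, and since linear maps commute with primitives it vanishes on
    \<open>T\<close> and then on \<open>\<tau>\<close>.\<close>
  define \<pi> where "\<pi> v = v - ((v \<bullet> e1) *\<^sub>R e1 + (v \<bullet> e2) *\<^sub>R e2)" for v
  have bl: "bounded_linear \<pi>"
    unfolding \<pi>_def
    by (intro bounded_linear_sub bounded_linear_ident bounded_linear_add
        bounded_linear_compose[OF bounded_linear_scaleR_left bounded_linear_inner_left])
  then interpret \<pi>: bounded_linear \<pi> .
  have "\<pi> e1 = 0" "\<pi> e2 = 0" using e(3) by (simp_all add: \<pi>_def ee)
  then have "\<pi> v = 0" if "v \<in> span {e1, e2}" for v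
    using linear_eq_0_on_span[of \<pi> "{e1, e2}" v] \<pi>.linear that by auto
  then have \<pi>\<gamma>: "\<pi> (\<gamma> x) = \<pi> p" if "x \<in> {a..b}" for x
    using plane[OF that] \<pi>.diff[of "\<gamma> x" p] by simp
  have "primitive_on a b (\<lambda>x. \<pi> (\<gamma> x)) (\<lambda>_. 0)"
    by (rule primitive_on_cong[OF primitive_on_const[of a b "\<pi> p"]]) (auto simp: \<pi>\<gamma>)
  from primitive_on_unique_AE[OF primitive_on_bounded_linear[OF primitive_\<gamma> bl] this]
  have z: "AE x\<in>{a<..<b} in lborel. \<pi> (w x *\<^sub>R T x) = 0"
    unfolding AE_Ioo_Icc[of a b "\<lambda>x. \<pi> (w x *\<^sub>R T x) = 0"] .
  have \<pi>T: "\<pi> (T x) = 0" if x: "x \<in> {a..b}" for x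
  proof -
    have "\<pi> (w x *\<^sub>R T x) = 0"
      by (rule continuous_AE_eq_imp_eq[OF \<pi>.continuous_on[OF continuous_velocity] continuous_on_const a_less_b z x])
    then show ?thesis using speed_pos[OF x] by (simp add: \<pi>.scaleR)
  qed
  have "primitive_on a b (\<lambda>x. \<pi> (T x)) (\<lambda>_. 0)"
    by (rule primitive_on_cong[OF primitive_on_const[of a b 0]]) (auto simp: \<pi>T)
  from primitive_on_unique_AE[OF primitive_on_bounded_linear[OF primitive_T bl] this]
  have \<pi>\<tau>: "AE x\<in>{a..b} in lborel. \<pi> (\<tau> x) = 0" .
  have energy: "AE x\<in>{a<..<b} in lborel. (norm (\<tau> x))\<^sup>2 / w x = 4 * m_star * \<Lambda>\<^sup>2 * w x * (cos (psi x))\<^sup>2"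
    using curv signed_curvature_AE[of e1 e2] \<pi>\<tau> AE_orthogonal
  proof eventually_elim
    case (elim x)
    show ?case
    proof
      assume x: "x \<in> {a<..<b}"
      then have x': "x \<in> {a..b}" by auto
      define t1 t2 c1 c2 where "t1 = \<tau> x \<bullet> e1" and "t2 = \<tau> x \<bullet> e2" and "c1 = T x \<bullet> e1" and "c2 = T x \<bullet> e2"
      have \<tau>: "\<tau> x = t1 *\<^sub>R e1 + t2 *\<^sub>R e2" using elim(3) x' by (simp add: \<pi>_def t1_def t2_def)
      have T: "T x = c1 *\<^sub>R e1 + c2 *\<^sub>R e2" using \<pi>T[OF x'] by (simp add: \<pi>_def c1_def c2_def)
      have o: "t1 * c1 + t2 * c2 = 0"
        using elim(4) x' e(3) unfolding \<tau> T by (simp add: inner_add_left inner_add_right ee ac_simps)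
      have c: "c1\<^sup>2 + c2\<^sup>2 = 1"
        using norm_T[OF x'] e(3) unfolding T norm_eq_1
        by (simp add: inner_add_left inner_add_right ee power2_eq_square)
      have n: "(norm (\<tau> x))\<^sup>2 = t1\<^sup>2 + t2\<^sup>2"
        unfolding power2_norm_eq_inner using e(3) unfolding \<tau>
        by (simp add: inner_add_left inner_add_right ee power2_eq_square)
      have "signed_curvature a b \<gamma> e1 e2 x = (\<tau> x /\<^sub>R w x) \<bullet> (c1 *\<^sub>R e2 - c2 *\<^sub>R e1)"
        using elim(2) x by (simp add: c1_def c2_def)
      also have "\<dots> = (t2 * c1 - t1 * c2) / w x"
        unfolding \<tau> using e(3) by (simp add: inner_add_left inner_diff_right ee divide_inverse algebra_simps)
      finally have k: "(t2 * c1 - t1 * c2) / w x = \<sigma> * (2 * sqrt m_star * \<Lambda> * cos (psi x))"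
        using elim(1) x x' by (simp add: arclength_eq figure_eight_curvature_eq)
      \<comment> \<open>Lagrange's identity: as \<open>\<tau>\<close> is orthogonal to the unit
        vector \<open>T\<close>, the determinant, which is \<open>w\<close> times the signed
        curvature, has absolute value \<open>norm (\<tau> x)\<close>.\<close>
      have "(t2 * c1 - t1 * c2)\<^sup>2 = (t1\<^sup>2 + t2\<^sup>2) * (c1\<^sup>2 + c2\<^sup>2) - (t1 * c1 + t2 * c2)\<^sup>2"
        by (simp add: power2_eq_square algebra_simps)
      also have "\<dots> = (norm (\<tau> x))\<^sup>2" by (simp add: o c n)
      finally have "(norm (\<tau> x))\<^sup>2 / w x = w x * ((t2 * c1 - t1 * c2) / w x)\<^sup>2"
        using speed_pos[OF x'] by (simp add: power2_eq_square)
      also have "\<dots> = w x * (\<sigma>\<^sup>2 * (4 * (sqrt m_star)\<^sup>2 * \<Lambda>\<^sup>2 * (cos (psi x))\<^sup>2))"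
        unfolding k by (simp add: power_mult_distrib)
      also have "\<sigma>\<^sup>2 = 1" using \<sigma> by auto
      also have "(sqrt m_star)\<^sup>2 = m_star" using m_star by simp
      finally show "(norm (\<tau> x))\<^sup>2 / w x = 4 * m_star * \<Lambda>\<^sup>2 * w x * (cos (psi x))\<^sup>2" by simp
    qed
  qed
  have Q: "primitive_on a b (\<lambda>x. 4 * m_star * \<Lambda> * ell_Q m_star (psi x)) (\<lambda>x. 4 * m_star * \<Lambda>\<^sup>2 * w x * (cos (psi x))\<^sup>2)"
  proof (rule primitive_on_FTC)
    fix x assume "a \<le> x" "x \<le> b"
    then have x: "x \<in> {a..b}" by simp
    from DERIV_cmult[OF DERIV_chain2[OF ell_Q_has_derivative[OF less_imp_le[OF m_star(2)]] psi_has_derivative[OF x]], of "4 * m_star * \<Lambda>"]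
    show "((\<lambda>x. 4 * m_star * \<Lambda> * ell_Q m_star (psi x)) has_vector_derivative 4 * m_star * \<Lambda>\<^sup>2 * w x * (cos (psi x))\<^sup>2) (at x within {a..b})"
      unfolding has_real_derivative_iff_has_vector_derivative[symmetric]
      by (rule DERIV_cong) (simp add: ell_delta_nz[OF m_star(2)] power2_eq_square)
  qed (intro continuous_intros continuous_w continuous_psi)
  have "bending_energy a b \<gamma> = (LBINT x:{a..b}. 4 * m_star * \<Lambda>\<^sup>2 * w x * (cos (psi x))\<^sup>2)"
    unfolding bending_energy_eq set_lebesgue_integral_def
  proof (rule integral_cong_AE)
    show "AE x in lborel. indicator {a..b} x *\<^sub>R ((norm (\<tau> x))\<^sup>2 / w x) =
       indicator {a..b} x *\<^sub>R (4 * m_star * \<Lambda>\<^sup>2 * w x * (cos (psi x))\<^sup>2)"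
      using energy AE_lborel_singleton[of a] AE_lborel_singleton[of b]
      by eventually_elim (auto simp: indicator_def)
  qed (use energy_integrable primitive_on_integrable[OF Q] in \<open>auto simp: set_integrable_def\<close>)
  also have "\<dots> = 4 * m_star * \<Lambda> * ell_Q m_star (pi / 2) - 4 * m_star * \<Lambda> * ell_Q m_star (- pi / 2)"
    using primitive_on_integral[OF Q, of a b] a_less_b by (simp add: psi_a psi_b)
  also have "\<dots> = 8 * \<Lambda> * ell_W m_star"
    using ell_Q_minus[of m_star "pi / 2"] m_star by (simp add: ell_W_def)
  finally show ?thesis
    using curve_length_pos by (simp add: normalized_bending_energy_def \<Lambda>_def varpi_star_eq)
qed

text \<open>\<open>half_leaf\<close> is applied on both sides of the midpoint with the same
  \<open>\<Lambda>\<close> and the same vector \<open>e\<close>; equality for the leaf forces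
  equality on each half, and it remains to fit the two shapes together.\<close>

lemma leaf_inequality_and_equality:
  assumes closed: "\<gamma> a = \<gamma> b"
  shows "varpi_star \<le> normalized_bending_energy a b \<gamma>"
    and "normalized_bending_energy a b \<gamma> = varpi_star \<Longrightarrow> half_fold_figure_eight_elastica a b \<gamma>"
proof -
  let ?s = "\<lambda>x. LBINT t:{a..x}. w t"
  have half: "0 \<le> curve_length a b \<gamma> / 2" "curve_length a b \<gamma> / 2 \<le> curve_length a b \<gamma>"
    using curve_length_pos by auto
  obtain x0 where x0: "a \<le> x0" "x0 \<le> b" "?s x0 = curve_length a b \<gamma> / 2"
    using IVT'[of ?s a "curve_length a b \<gamma> / 2" b] half a_less_b primitive_on_continuous[OF primitive_arclength]
    by (auto simp: w_integral_a curve_length_eq)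
  have "x0 \<noteq> a" "x0 \<noteq> b"
    using x0(3) curve_length_pos by (auto simp: w_integral_a curve_length_eq)
  with x0 have ax: "a < x0" "x0 < b" by auto
  have sx: "?s x0 + (LBINT t:{x0..b}. w t) = curve_length a b \<gamma>"
    using set_integral_split[OF w_integrable[of a b], of x0] x0 by (simp add: curve_length_eq)
  have Lhalf: "\<Lambda> * ?s x0 = ellK m_star" "\<Lambda> * (LBINT t:{x0..b}. w t) = ellK m_star"
  proof -
    have "\<Lambda> * (curve_length a b \<gamma> / 2) = ellK m_star"
      using curve_length_pos by (simp add: \<Lambda>_def)
    moreover have "(LBINT t:{x0..b}. w t) = curve_length a b \<gamma> / 2" using sx x0(3) by linarith
    ultimately show "\<Lambda> * ?s x0 = ellK m_star" "\<Lambda> * (LBINT t:{x0..b}. w t) = ellK m_star"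
      by (simp_all only: x0(3))
  qed
  let ?f = "\<lambda>x. (norm (\<tau> x))\<^sup>2 / w x"
  interpret R: half_leaf x0 b w T \<tau> \<Lambda>
  proof
    show "set_integrable lborel {x0..b} ?f"
      using ax by (intro set_integrable_subset[OF energy_integrable]) auto
    show "continuous_on {x0..b} w"
      using ax by (intro continuous_on_subset[OF continuous_w]) auto
    show "primitive_on x0 b T \<tau>"
      using ax by (intro primitive_on_subinterval[OF primitive_T]) auto
    show "0 < w x" "norm (T x) = 1" if "x \<in> {x0..b}" for x
      using that ax speed_pos[of x] norm_T[of x] by auto
  qed (use ax \<Lambda>_pos Lhalf in simp_all)
  \<comment> \<open>The tangent is reflected without a change of sign, although the reversed curve
    has velocity \<open>- w T\<close>: in this way both halves start from the same
    \<open>e\<close>.\<close>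
  have primTl: "primitive_on (-x0) (-a) (\<lambda>x. T (-x)) (\<lambda>x. - \<tau> (-x))"
    using primitive_on_reflect[OF primitive_on_subinterval[OF primitive_T, of a x0]] ax by simp
  have unitl: "norm (T (-x)) = 1" if "x \<in> {-x0..-a}" for x
    using that ax by (intro norm_T) auto
  interpret L: half_leaf "-x0" "-a" "\<lambda>x. w (-x)" "\<lambda>x. T (-x)" "\<lambda>x. - \<tau> (-x)" \<Lambda>
  proof
    have "set_integrable lborel {a..x0} ?f"
      using ax by (intro set_integrable_subset[OF energy_integrable]) auto
    from set_integrable_reflect[OF this]
    show "set_integrable lborel {-x0..-a} (\<lambda>x. (norm (- \<tau> (-x)))\<^sup>2 / w (-x))" by simp
    show "continuous_on {-x0..-a} (\<lambda>x. w (-x))"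
      using ax by (intro continuous_on_compose2[OF continuous_w] continuous_intros) auto
    show "\<Lambda> * (LBINT x:{-x0..-a}. w (-x)) = ellK m_star"
      unfolding set_integral_reflect_Icc by (rule Lhalf)
    show "0 < w (-x)" if "x \<in> {-x0..-a}" for x
      using that ax by (intro speed_pos) auto
  qed (use ax unitl primTl \<Lambda>_pos in simp_all)
  let ?e = "T x0"
  have Re: "R.e = ?e" and Le: "L.e = ?e" by (simp_all add: R.e_def L.e_def)
  let ?F = "\<lambda>x. ?f x + 2 * \<Lambda>\<^sup>2 * (T x \<bullet> ?e) * w x"
  have cT: "continuous_on {a..b} (\<lambda>x. 2 * \<Lambda>\<^sup>2 * (T x \<bullet> ?e) * w x)"
    by (intro continuous_intros continuous_T continuous_w)
  have iF: "set_integrable lborel {a..b} ?F"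
    by (intro set_integral_add energy_integrable borel_integrable_atLeastAtMost' cT)
  have JR: "R.J = (LBINT x:{x0..b}. ?F x)" by (simp add: R.J_def Re)
  have JL: "L.J = (LBINT x:{a..x0}. ?F x)"
    unfolding L.J_def Le norm_minus_cancel
    using set_integral_reflect_Icc[of x0 a "\<lambda>x. (norm (\<tau> x))\<^sup>2 / w x + 2 * \<Lambda>\<^sup>2 * (T x \<bullet> ?e) * w x"] .
  have "L.J + R.J = (LBINT x:{a..b}. ?F x)"
    unfolding JL JR using set_integral_split[OF iF, of x0] ax by simp
  also have "\<dots> = bending_energy a b \<gamma> + (LBINT x:{a..b}. 2 * \<Lambda>\<^sup>2 * (T x \<bullet> ?e) * w x)"
    using energy_integrable borel_integrable_atLeastAtMost'[OF cT] by (simp add: bending_energy_eq)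
  also have "(LBINT x:{a..b}. 2 * \<Lambda>\<^sup>2 * (T x \<bullet> ?e) * w x) = (LBINT x:{a..b}. 2 * \<Lambda>\<^sup>2 * ((w x *\<^sub>R T x) \<bullet> ?e))"
    by (simp add: ac_simps)
  also have "\<dots> = 2 * \<Lambda>\<^sup>2 * ((LBINT x:{a..b}. w x *\<^sub>R T x) \<bullet> ?e)"
    using set_integral_bounded_linear[OF bounded_linear_inner_left primitive_on_integrable[OF primitive_\<gamma>], of ?e]
    by simp
  also have "(LBINT x:{a..b}. w x *\<^sub>R T x) = 0"
    using primitive_on_integral[OF primitive_\<gamma>, of a b] a_less_b closed by simp
  finally have sumJ: "L.J + R.J = bending_energy a b \<gamma>" by simp
  \<comment> \<open>At \<open>m_star\<close> the relation \<open>K = 2 E\<close> turns the second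
    term of \<open>Jmin\<close> into \<open>- 4 \<Lambda> W\<close>. Each half thus contributes
    \<open>4 \<Lambda> W\<close>, and \<open>8 \<Lambda> W = 16 K W / L\<close>.\<close>
  have Jmin: "L.Jmin + R.Jmin = varpi_star / curve_length a b \<gamma>"
    unfolding L.Jmin_def R.Jmin_def unfolding varpi_star_eq ell_W_m_star \<Lambda>_def m_star(3)
    using curve_length_pos by (simp add: field_simps)
  have "varpi_star / curve_length a b \<gamma> \<le> bending_energy a b \<gamma>"
    using L.Jmin_le_J R.Jmin_le_J sumJ Jmin by linarith
  then show "varpi_star \<le> normalized_bending_energy a b \<gamma>"
    using curve_length_pos by (simp add: normalized_bending_energy_def field_simps)
  show "half_fold_figure_eight_elastica a b \<gamma>" if eq: "normalized_bending_energy a b \<gamma> = varpi_star"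
  proof -
    have "bending_energy a b \<gamma> = varpi_star / curve_length a b \<gamma>"
      using eq curve_length_pos by (simp add: normalized_bending_energy_def field_simps)
    then have "L.J = L.Jmin" "R.J = R.Jmin"
      using L.Jmin_le_J R.Jmin_le_J sumJ Jmin by linarith+
    obtain N where N: "norm N = 1" "N \<bullet> ?e = 0" and TR: "\<And>x. x \<in> {x0..b} \<Longrightarrow>
        T x = fig_cos (jacobi_am (\<Lambda> * (LBINT t:{x0..x}. w t)) m_star) *\<^sub>R ?e +
          fig_sin (jacobi_am (\<Lambda> * (LBINT t:{x0..x}. w t)) m_star) *\<^sub>R N"
      using R.equality_shape[OF \<open>R.J = R.Jmin\<close>] unfolding Re by blast
    obtain M where M: "norm M = 1" "M \<bullet> ?e = 0" and TL: "\<And>x. x \<in> {-x0..-a} \<Longrightarrow>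
        T (-x) = fig_cos (jacobi_am (\<Lambda> * (LBINT t:{-x0..x}. w (-t))) m_star) *\<^sub>R ?e +
          fig_sin (jacobi_am (\<Lambda> * (LBINT t:{-x0..x}. w (-t))) m_star) *\<^sub>R M"
      using L.equality_shape[OF \<open>L.J = L.Jmin\<close>] unfolding Le by blast
    have TR': "T x = fig_cos (psi x) *\<^sub>R ?e + fig_sin (psi x) *\<^sub>R N" if x: "x \<in> {x0..b}" for x
    proof -
      have "set_integrable lborel {a..x} w" using x by (intro w_integrable) auto
      from set_integral_split[OF this, of x0] x ax Lhalf(1)
      have "\<Lambda> * (LBINT t:{x0..x}. w t) = \<Lambda> * ?s x - ellK m_star" by (simp add: algebra_simps)
      with TR[OF x] show ?thesis by (simp add: psi_def)
    qed
    have TL': "T x = fig_cos (psi x) *\<^sub>R ?e + (- fig_sin (psi x)) *\<^sub>R M" if x: "x \<in> {a..x0}" for x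
    proof -
      have "set_integrable lborel {a..x0} w" using ax by (intro w_integrable) auto
      from set_integral_split[OF this, of x] x Lhalf(1)
      have "\<Lambda> * (LBINT t:{x..x0}. w t) = - (\<Lambda> * ?s x - ellK m_star)" by (simp add: algebra_simps)
      then have "\<Lambda> * (LBINT t:{-x0..-x}. w (-t)) = - (\<Lambda> * ?s x - ellK m_star)"
        unfolding set_integral_reflect_Icc .
      then have am: "jacobi_am (\<Lambda> * (LBINT t:{-x0..-x}. w (-t))) m_star = - psi x"
        by (simp only: jacobi_am_minus psi_def)
      have "-x \<in> {-x0..-a}" using x by auto
      from TL[OF this] show ?thesis unfolding am by simp
    qed
    have psi0: "psi x0 = 0" by (simp add: psi_def Lhalf jacobi_am_0)
    \<comment> \<open>The displacement of half a figure-eight leaf orthogonal to \<open>e\<close>: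
      \<open>- k cos psi\<close> is a primitive of \<open>w * fig_sin psi\<close>.\<close>
    define k where "k = 2 * sqrt m_star / \<Lambda>"
    have k: "k > 0" using m_star \<Lambda>_pos by (simp add: k_def)
    have P: "primitive_on a b (\<lambda>x. - k * cos (psi x)) (\<lambda>x. w x * fig_sin (psi x))"
    proof (rule primitive_on_FTC)
      fix x assume "a \<le> x" "x \<le> b"
      then have x: "x \<in> {a..b}" by simp
      from DERIV_cmult[OF DERIV_chain2[OF DERIV_cos psi_has_derivative[OF x]], of "- k"]
      show "((\<lambda>x. - k * cos (psi x)) has_vector_derivative w x * fig_sin (psi x)) (at x within {a..b})"
        unfolding has_real_derivative_iff_has_vector_derivative[symmetric]
        by (rule DERIV_cong) (use \<Lambda>_pos in \<open>simp add: k_def fig_sin_def\<close>)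
    next
      show "continuous_on {a..b} (\<lambda>x. w x * fig_sin (psi x))"
        by (intro continuous_intros continuous_w continuous_on_compose2[OF continuous_fig_sin[of UNIV] continuous_psi]) auto
    qed
    have PT: "set_integrable lborel {c..d} (\<lambda>x. w x *\<^sub>R T x)" if "a \<le> c" "d \<le> b" for c d
      using that by (intro set_integrable_subset[OF primitive_on_integrable[OF primitive_\<gamma>]]) auto
    have comp: "(LBINT x:{c..d}. w x *\<^sub>R T x) - ((LBINT x:{c..d}. w x *\<^sub>R T x) \<bullet> ?e) *\<^sub>R ?e
        = (\<sigma> * (- k * cos (psi d) + k * cos (psi c))) *\<^sub>R V"
      if cd: "a \<le> c" "c \<le> d" "d \<le> b" and V: "V \<bullet> ?e = 0" and TV: "\<And>x. x \<in> {c..d} \<Longrightarrow> T x = fig_cos (psi x) *\<^sub>R ?e + (\<sigma> * fig_sin (psi x)) *\<^sub>R V"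
      for c d \<sigma> V
    proof -
      define \<pi> where "\<pi> v = v - (v \<bullet> ?e) *\<^sub>R ?e" for v
      have bl: "bounded_linear \<pi>"
        unfolding \<pi>_def by (intro bounded_linear_sub bounded_linear_ident
            bounded_linear_compose[OF bounded_linear_scaleR_left bounded_linear_inner_left])
      have ee: "?e \<bullet> ?e = 1" using norm_T[of x0] ax by (simp add: dot_square_norm)
      have i: "set_integrable lborel {c..d} (\<lambda>x. w x * fig_sin (psi x))"
        using cd by (intro set_integrable_subset[OF primitive_on_integrable[OF P]]) auto
      have "\<pi> (LBINT x:{c..d}. w x *\<^sub>R T x) = (LBINT x:{c..d}. \<pi> (w x *\<^sub>R T x))"
        by (rule set_integral_bounded_linear[OF bl PT[OF cd(1,3)], symmetric])
      also have "\<dots> = (LBINT x:{c..d}. (\<sigma> * (w x * fig_sin (psi x))) *\<^sub>R V)"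
        by (intro set_lebesgue_integral_cong) (auto simp: TV \<pi>_def inner_add_left ee V algebra_simps)
      also have "\<dots> = (LBINT x:{c..d}. \<sigma> * (w x * fig_sin (psi x))) *\<^sub>R V"
        by (rule set_integral_bounded_linear[OF bounded_linear_scaleR_left set_integrable_mult_right[OF i]])
      also have "(LBINT x:{c..d}. \<sigma> * (w x * fig_sin (psi x))) = \<sigma> * (- k * cos (psi d) + k * cos (psi c))"
        using primitive_on_integral[OF P cd] by simp
      finally show ?thesis by (simp add: \<pi>_def)
    qed
    let ?IL = "LBINT x:{a..x0}. w x *\<^sub>R T x" and ?IR = "LBINT x:{x0..b}. w x *\<^sub>R T x"
    have "?IL + ?IR = 0"
      using set_integral_split[OF PT[of a b], of x0] primitive_on_integral[OF primitive_\<gamma>, of a b] a_less_b closed ax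
      by simp
    then have I0: "?IR = - ?IL" by (simp add: eq_neg_iff_add_eq_0 add.commute)
    have "?IL - (?IL \<bullet> ?e) *\<^sub>R ?e = (- 1 * (- k * cos (psi x0) + k * cos (psi a))) *\<^sub>R M"
    proof (rule comp)
      show "T x = fig_cos (psi x) *\<^sub>R ?e + (- 1 * fig_sin (psi x)) *\<^sub>R M" if "x \<in> {a..x0}" for x
        unfolding mult_minus1 by (rule TL'[OF that])
    qed (use ax M in simp_all)
    then have 1: "?IL - (?IL \<bullet> ?e) *\<^sub>R ?e = k *\<^sub>R M" by (simp add: psi0 psi_a)
    have "?IR - (?IR \<bullet> ?e) *\<^sub>R ?e = (1 * (- k * cos (psi b) + k * cos (psi x0))) *\<^sub>R N"
    proof (rule comp)
      show "T x = fig_cos (psi x) *\<^sub>R ?e + (1 * fig_sin (psi x)) *\<^sub>R N" if "x \<in> {x0..b}" for x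
        unfolding mult_1 by (rule TR'[OF that])
    qed (use ax N in simp_all)
    then have 2: "?IR - (?IR \<bullet> ?e) *\<^sub>R ?e = k *\<^sub>R N" by (simp add: psi0 psi_b)
    \<comment> \<open>Orthogonally to \<open>e\<close>, the left half moves by \<open>k M\<close>
      and the right half by \<open>k N\<close>. Since the leaf closes up, these displacements
      cancel.\<close>
    have "k *\<^sub>R N = - (k *\<^sub>R M)"
      unfolding 1[symmetric] 2[symmetric] I0 by simp
    then have NM: "N = - M" using k by (simp flip: scaleR_minus_right)
    show ?thesis
    proof (rule fig_imp_half_fold[of ?e N])
      show "norm ?e = 1" using ax by (intro norm_T) auto
      show "?e \<bullet> N = 0" using N by (simp add: inner_commute)
      show "T x = fig_cos (psi x) *\<^sub>R ?e + fig_sin (psi x) *\<^sub>R N" if "x \<in> {a..b}" for x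
      proof (cases "x \<le> x0")
        case True
        then show ?thesis using TL'[of x] that by (simp add: NM)
      next
        case False
        then show ?thesis using TR'[of x] that by simp
      qed
    qed (rule N)
  qed
qed

end

section \<open>Concatenating leaves\<close>

text \<open>Each \<open>B i\<close> is at least \<open>v / l i\<close>, and the convex function
  \<open>v / l\<close> lies above its tangent at the mean length \<open>m\<close>; the linear terms
  cancel in the sum. Strict convexity gives equal lengths in the case of equality.\<close>

lemma sum_reciprocal_bound:
  fixes l B :: "nat \<Rightarrow> real"
  assumes "0 < n" "0 < v" and l: "\<forall>i<n. 0 < l i" and B: "\<forall>i<n. v \<le> l i * B i"
  shows "v * (real n)\<^sup>2 \<le> (\<Sum>i<n. l i) * (\<Sum>i<n. B i)"
    and "(\<Sum>i<n. l i) * (\<Sum>i<n. B i) = v * (real n)\<^sup>2 \<Longrightarrow> i < n \<Longrightarrow>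
      l i * B i = v \<and> l i = (\<Sum>i<n. l i) / real n"
proof -
  define S where "S = (\<Sum>i<n. l i)"
  have "0 < S" unfolding S_def using assms by (intro sum_pos) auto
  define m where "m = S / real n"
  have m: "0 < m" using \<open>0 < S\<close> \<open>0 < n\<close> by (simp add: m_def)
  \<comment> \<open>The excess of \<open>B i\<close> over the tangent of \<open>v / l\<close> at
    \<open>m\<close>. \<open>D_split\<close> divides it into the excess of \<open>l i * B i\<close>
    over \<open>v\<close> and the gap between \<open>v / l\<close> and its tangent.\<close>
  define D where "D i = B i - v * (2 / m - l i / m\<^sup>2)" for i
  have D_split: "D i = (l i * B i - v) / l i + v * (l i - m)\<^sup>2 / (l i * m\<^sup>2)" if "i < n" for i
    using spec[OF l, of i] that m by (simp add: D_def field_simps power2_eq_square)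
  have D_parts: "0 \<le> (l i * B i - v) / l i" "0 \<le> v * (l i - m)\<^sup>2 / (l i * m\<^sup>2)" if "i < n" for i
    using spec[OF l, of i] spec[OF B, of i] that m \<open>0 < v\<close> by simp_all
  have D: "0 \<le> D i" if "i < n" for i
    unfolding D_split[OF that] by (rule add_nonneg_nonneg[OF D_parts[OF that]])
  have "(\<Sum>i<n. D i) = (\<Sum>i<n. B i) - v * (2 * real n / m - S / m\<^sup>2)"
    by (simp add: D_def sum_subtractf S_def sum_divide_distrib[symmetric] sum_distrib_left[symmetric])
  also have "2 * real n / m - S / m\<^sup>2 = (real n)\<^sup>2 / S"
    using \<open>0 < S\<close> \<open>0 < n\<close> by (simp add: m_def field_simps power2_eq_square)
  finally have sumD: "S * (\<Sum>i<n. D i) = S * (\<Sum>i<n. B i) - v * (real n)\<^sup>2"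
    using \<open>0 < S\<close> by (simp add: field_simps)
  have "0 \<le> (\<Sum>i<n. D i)" using D by (intro sum_nonneg) auto
  then have "0 \<le> S * (\<Sum>i<n. D i)" using \<open>0 < S\<close> by simp
  with sumD show "v * (real n)\<^sup>2 \<le> (\<Sum>i<n. l i) * (\<Sum>i<n. B i)" by (simp add: S_def)
  assume eq: "(\<Sum>i<n. l i) * (\<Sum>i<n. B i) = v * (real n)\<^sup>2" and i: "i < n"
  then have "(\<Sum>i<n. D i) = 0" using sumD \<open>0 < S\<close> by (simp add: S_def)
  then have "D i = 0" using D i by (subst (asm) sum_nonneg_eq_0_iff) auto
  then have "(l i * B i - v) / l i = 0" "v * (l i - m)\<^sup>2 / (l i * m\<^sup>2) = 0"
    using D_split[OF i] D_parts[OF i] by linarith+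
  moreover have "0 < l i" using l i by simp
  ultimately have "l i * B i = v" "l i = m" using m \<open>0 < v\<close> by simp_all
  then show "l i * B i = v \<and> l i = (\<Sum>i<n. l i) / real n" unfolding m_def S_def ..
qed

lemma partition_le:
  fixes t :: "nat \<Rightarrow> real"
  assumes "\<forall>i<n. t i < t (Suc i)" "i \<le> j" "j \<le> n"
  shows "t i \<le> t j"
  using assms(2,3)
proof (induction j rule: dec_induct)
  case (step j)
  moreover have "t j < t (Suc j)" using assms(1) step by simp
  ultimately show ?case by simp
qed simp

lemma set_integral_partition:
  fixes f :: "real \<Rightarrow> real"
  assumes "set_integrable lborel {t 0..t n} f" "\<forall>i<n. t i < t (Suc i)"
  shows "(\<Sum>i<n. LBINT x:{t i..t (Suc i)}. f x) = (LBINT x:{t 0..t n}. f x)"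
  using assms
proof (induction n)
  case 0
  then show ?case using set_integral_split[of "t 0" "t 0" f "t 0"] by simp
next
  case (Suc n)
  have "t 0 \<le> t n" "t n \<le> t (Suc n)"
    using partition_le[OF Suc.prems(2)] by auto
  then have "set_integrable lborel {t 0..t n} f"
    by (intro set_integrable_subset[OF Suc.prems(1)]) auto
  with \<open>t 0 \<le> t n\<close> \<open>t n \<le> t (Suc n)\<close> show ?case
    using Suc.IH Suc.prems(2) set_integral_split[OF Suc.prems(1), of "t n"] by simp
qed

context framed
begin

lemma partition_sums:
  assumes t: "a \<le> t 0" "t n \<le> b" "\<forall>i<n. t i < t (Suc i)"
  shows "i < n \<Longrightarrow> framed (t i) (t (Suc i)) \<gamma> w w' T \<tau>"
    and "(\<Sum>i<n. curve_length (t i) (t (Suc i)) \<gamma>) = (LBINT x:{t 0..t n}. w x)"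
    and "(\<Sum>i<n. bending_energy (t i) (t (Suc i)) \<gamma>) = (LBINT x:{t 0..t n}. (norm (\<tau> x))\<^sup>2 / w x)"
proof -
  have fr: "framed (t i) (t (Suc i)) \<gamma> w w' T \<tau>" if "i < n" for i
    unfolding framed_def
    using that t partition_le[OF t(3), of 0 i] partition_le[OF t(3), of "Suc i" n]
    by (intro subinterval) auto
  then show "i < n \<Longrightarrow> framed (t i) (t (Suc i)) \<gamma> w w' T \<tau>" .
  have "(\<Sum>i<n. curve_length (t i) (t (Suc i)) \<gamma>) = (\<Sum>i<n. LBINT x:{t i..t (Suc i)}. w x)"
    by (intro sum.cong refl framed.curve_length_eq[OF fr]) auto
  also have "\<dots> = (LBINT x:{t 0..t n}. w x)"
    using t by (intro set_integral_partition w_integrable) auto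
  finally show "(\<Sum>i<n. curve_length (t i) (t (Suc i)) \<gamma>) = (LBINT x:{t 0..t n}. w x)" .
  have "(\<Sum>i<n. bending_energy (t i) (t (Suc i)) \<gamma>) = (\<Sum>i<n. LBINT x:{t i..t (Suc i)}. (norm (\<tau> x))\<^sup>2 / w x)"
    by (intro sum.cong refl framed.bending_energy_eq[OF fr]) auto
  also have "\<dots> = (LBINT x:{t 0..t n}. (norm (\<tau> x))\<^sup>2 / w x)"
    using t by (intro set_integral_partition set_integrable_subset[OF energy_integrable]) auto
  finally show "(\<Sum>i<n. bending_energy (t i) (t (Suc i)) \<gamma>) = (LBINT x:{t 0..t n}. (norm (\<tau> x))\<^sup>2 / w x)" .
qed

lemma leafed_imp_energy:
  assumes "leafed_elastica n a b \<gamma>"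
  shows "normalized_bending_energy a b \<gamma> = varpi_star * (real n)\<^sup>2"
proof -
  obtain t where n: "n \<ge> 1" and t: "t 0 = a" "t n = b" "\<forall>i<n. t i < t (Suc i)"
    and hf: "\<And>i. i < n \<Longrightarrow> half_fold_figure_eight_elastica (t i) (t (Suc i)) \<gamma>"
    and len: "\<And>i l. i < n \<Longrightarrow> l < n \<Longrightarrow> curve_length (t i) (t (Suc i)) \<gamma> = curve_length (t l) (t (Suc l)) \<gamma>"
    using assms unfolding leafed_elastica_def by blast
  have t': "a \<le> t 0" "t n \<le> b" using t by auto
  note PS = partition_sums[OF t' t(3)]
  define l where "l = curve_length (t 0) (t (Suc 0)) \<gamma>"
  have li: "curve_length (t i) (t (Suc i)) \<gamma> = l" if "i < n" for i
    unfolding l_def using n that by (intro len) auto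
  have l: "0 < l"
    unfolding l_def using n by (intro framed.curve_length_pos[OF PS(1)]) auto
  have Bi: "bending_energy (t i) (t (Suc i)) \<gamma> = varpi_star / l" if "i < n" for i
    using framed.half_fold_imp_energy[OF PS(1)[OF that] hf[OF that]] l
    by (simp add: normalized_bending_energy_def li[OF that] field_simps)
  have "curve_length a b \<gamma> = real n * l"
    using PS(2) by (simp add: curve_length_eq t li)
  moreover have "bending_energy a b \<gamma> = real n * (varpi_star / l)"
    using PS(3) by (simp add: bending_energy_eq t Bi)
  ultimately show ?thesis
    using l by (simp add: normalized_bending_energy_def power2_eq_square)
qed

text \<open>The \<open>n + 1\<close> preimages of the multiple point bound \<open>n\<close> closed
  arcs, to which the leaf inequality and \<open>sum_reciprocal_bound\<close> apply. The tails before
  the first and after the last preimage are then excluded, because the arcs alone already reach the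
  bound.\<close>

lemma multiplicity_energy_imp_leafed:
  assumes mult: "has_point_of_multiplicity a b \<gamma> (Suc n)" and n: "n \<ge> 1"
    and eq: "normalized_bending_energy a b \<gamma> = varpi_star * (real n)\<^sup>2"
  shows "leafed_elastica n a b \<gamma>"
proof -
  obtain p S where S: "S \<subseteq> {x \<in> {a..b}. \<gamma> x = p}" "finite S" "card S = Suc n"
    using mult unfolding has_point_of_multiplicity_def by blast
  define t where "t i = sorted_list_of_set S ! i" for i
  have len: "length (sorted_list_of_set S) = Suc n" using S by simp
  have tS: "t i \<in> S" if "i \<le> n" for i
    using nth_mem[of i "sorted_list_of_set S"] that len S(2) by (simp add: t_def)
  have t_less: "\<forall>i<n. t i < t (Suc i)"
  proof (intro allI impI)
    fix i assume "i < n"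
    then show "t i < t (Suc i)"
      using sorted_wrt_nth_less[OF strict_sorted_list_of_set[of S], of i "Suc i"] len by (simp add: t_def)
  qed
  have tab: "a \<le> t 0" "t n \<le> b" using tS[of 0] tS[of n] S(1) by auto
  have closed: "\<gamma> (t i) = \<gamma> (t (Suc i))" if "i < n" for i
    using tS[of i] tS[of "Suc i"] S(1) that by auto
  note PS = partition_sums[OF tab t_less]
  define l B where "l i = curve_length (t i) (t (Suc i)) \<gamma>" and "B i = bending_energy (t i) (t (Suc i)) \<gamma>" for i
  have lB: "\<forall>i<n. varpi_star \<le> l i * B i"
    using framed.leaf_inequality_and_equality(1)[OF PS(1) closed]
    by (simp add: l_def B_def normalized_bending_energy_def)
  have lpos: "\<forall>i<n. 0 < l i"
    unfolding l_def using framed.curve_length_pos[OF PS(1)] by blast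
  have "0 < n" using n by simp
  note bound = sum_reciprocal_bound[OF \<open>0 < n\<close> varpi_star_pos lpos lB]
  define Ls Bs where "Ls = (\<Sum>i<n. l i)" and "Bs = (\<Sum>i<n. B i)"
  have t0n: "t 0 \<le> t n" by (rule partition_le[OF t_less]) auto
  have Ls: "curve_length a b \<gamma> = (LBINT x:{a..t 0}. w x) + Ls + (LBINT x:{t n..b}. w x)"
    using PS(2) set_integral_split[OF w_integrable[of a b], of "t n"]
      set_integral_split[OF w_integrable[of a "t n"], of "t 0"] tab t0n
    by (simp add: Ls_def l_def curve_length_eq)
  have nn: "0 \<le> (LBINT x:{a..t 0}. w x)" "0 \<le> (LBINT x:{t n..b}. w x)"
  proof -
    have "0 \<le> w x" if "x \<in> {a..b}" for x using speed_pos[OF that] by simp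
    then show "0 \<le> (LBINT x:{a..t 0}. w x)" "0 \<le> (LBINT x:{t n..b}. w x)"
      using tab t0n by (auto intro!: set_integral_nonneg')
  qed
  have Bs: "Bs \<le> bending_energy a b \<gamma>"
  proof -
    let ?f = "\<lambda>x. (norm (\<tau> x))\<^sup>2 / w x"
    have f: "0 \<le> ?f x" if "x \<in> {a..b}" for x using speed_pos[OF that] by simp
    have i: "set_integrable lborel {a..t n} ?f"
      using tab by (intro set_integrable_subset[OF energy_integrable]) auto
    have "0 \<le> (LBINT x:{a..t 0}. ?f x)" "0 \<le> (LBINT x:{t n..b}. ?f x)"
      using tab t0n by (auto intro!: set_integral_nonneg' f)
    then show ?thesis
      using PS(3) set_integral_split[OF energy_integrable, of "t n"] set_integral_split[OF i, of "t 0"] tab t0n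
      by (simp add: Bs_def B_def bending_energy_eq)
  qed
  have LsBs: "varpi_star * (real n)\<^sup>2 \<le> Ls * Bs"
    unfolding Ls_def Bs_def by (rule bound(1))
  have "0 < Ls" unfolding Ls_def using \<open>0 < n\<close> lpos by (intro sum_pos) auto
  moreover have "0 < varpi_star * (real n)\<^sup>2" using varpi_star_pos \<open>0 < n\<close> by simp
  ultimately have "0 < Bs" using LsBs by (meson less_le_trans zero_less_mult_pos)
  have LB: "curve_length a b \<gamma> * bending_energy a b \<gamma> = varpi_star * (real n)\<^sup>2"
    using eq by (simp add: normalized_bending_energy_def)
  have "Ls \<le> curve_length a b \<gamma>" using Ls nn by simp
  have "curve_length a b \<gamma> * Bs \<le> curve_length a b \<gamma> * bending_energy a b \<gamma>"
    using Bs curve_length_pos by simp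
  \<comment> \<open>The product for the whole curve equals the bound, and that of the arcs is at
    least as large. Dividing by \<open>Bs > 0\<close> leaves no length for the tails.\<close>
  then have "curve_length a b \<gamma> * Bs \<le> Ls * Bs" using LB LsBs by linarith
  then have "curve_length a b \<gamma> \<le> Ls" using \<open>0 < Bs\<close> by simp
  with Ls nn have z: "(LBINT x:{a..t 0}. w x) = 0" "(LBINT x:{t n..b}. w x) = 0" and "curve_length a b \<gamma> = Ls"
    by linarith+
  have "a = t 0" using w_integral_pos[of a "t 0"] z(1) tab t0n by (cases "a < t 0") auto
  have "b = t n" using w_integral_pos[of "t n" b] z(2) tab t0n by (cases "t n < b") auto
  have "Ls * Bs \<le> Ls * bending_energy a b \<gamma>" using Bs \<open>0 < Ls\<close> by simp
  then have "Ls * Bs = varpi_star * (real n)\<^sup>2"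
    using LsBs LB \<open>curve_length a b \<gamma> = Ls\<close> by simp
  then have ends: "l i * B i = varpi_star \<and> l i = (\<Sum>i<n. l i) / real n" if "i < n" for i
    using that unfolding Ls_def Bs_def by (rule bound(2))
  show ?thesis
    unfolding leafed_elastica_def
  proof (intro conjI exI[of _ t] allI impI n immersed)
    show "half_fold_figure_eight_elastica (t i) (t (Suc i)) \<gamma>" if "i < n" for i
    proof (rule framed.leaf_inequality_and_equality(2)[OF PS(1)[OF that] closed[OF that]])
      show "normalized_bending_energy (t i) (t (Suc i)) \<gamma> = varpi_star"
        unfolding normalized_bending_energy_def l_def[symmetric] B_def[symmetric]
        by (rule conjunct1[OF ends[OF that]])
    qed
    show "curve_length (t i) (t (Suc i)) \<gamma> = curve_length (t j) (t (Suc j)) \<gamma>" if "i < n" "j < n" for i j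
      unfolding l_def[symmetric]
      by (rule trans[OF conjunct2[OF ends[OF that(1)]] conjunct2[OF ends[OF that(2)], symmetric]])
  qed (use \<open>a = t 0\<close> \<open>b = t n\<close> t_less in auto)
qed

end

section \<open>Existence\<close>

text \<open>Over each period \<open>I\<close> gains
  \<open>I (pi / 2) - I (- (pi / 2)) = 2 * I (pi / 2)\<close>, starting from
  \<open>- I (pi / 2)\<close> at \<open>n = 0\<close>. This serves the length (\<open>ellF\<close>),
  the energy (\<open>ell_Q\<close>) and the position (\<open>fig_x\<close>).\<close>

lemma odd_periodic_primitive:
  fixes I f :: "real \<Rightarrow> real"
  assumes I: "\<And>x. (I has_real_derivative f x) (at x)" and f: "\<And>x. f (x + pi) = f x"
    and odd: "\<And>x. I (- x) = - I x"
  shows "I (real n * pi - pi / 2) = (2 * real n - 1) * I (pi / 2)"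
proof -
  have "\<forall>x. DERIV (\<lambda>x. I (x + pi) - I x) x :> 0"
  proof
    fix x
    have "((\<lambda>x. x + pi) has_real_derivative 1) (at x)" by (auto intro!: derivative_eq_intros)
    from DERIV_diff[OF DERIV_chain2[OF I this] I[of x]]
    show "DERIV (\<lambda>x. I (x + pi) - I x) x :> 0" by (simp add: f)
  qed
  note const = DERIV_isconst_all[OF this, of _ "- (pi / 2)"]
  have step: "I (x + pi) = I x + 2 * I (pi / 2)" for x
    using const[of x] odd[of "pi / 2"] by simp
  show ?thesis
  proof (induction n)
    case 0
    then show ?case using odd[of "pi / 2"] by simp
  next
    case (Suc n)
    have "real (Suc n) * pi - pi / 2 = (real n * pi - pi / 2) + pi" by (simp add: algebra_simps)
    then show ?case using Suc step[of "real n * pi - pi / 2"] by (simp add: algebra_simps)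
  qed
qed

lemma ell_delta_period: "ell_delta m (x + pi) = ell_delta m x"
  by (simp add: ell_delta_def)

text \<open>The coordinate of the figure-eight elastica along \<open>e1\<close> at scale
  \<open>\<Lambda> = 1\<close>, where the arclength element is
  \<open>d\<psi> / ell_delta\<close>.\<close>

definition fig_x :: "real \<Rightarrow> real" where
  "fig_x \<psi> = (LBINT t=ereal 0..ereal \<psi>. fig_cos t / ell_delta m_star t)"

lemma fig_x_has_derivative: "(fig_x has_real_derivative fig_cos \<psi> / ell_delta m_star \<psi>) (at \<psi>)"
  unfolding fig_x_def[abs_def]
  by (rule interval_integral_has_derivative)
     (intro continuous_intros continuous_fig_cos; simp add: ell_delta_nz m_star)

lemma fig_x_minus: "fig_x (- x) = - fig_x x"
  by (rule odd_if_even_derivative[OF fig_x_has_derivative]) (simp_all add: fig_x_def)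

text \<open>A leaf closes up exactly because \<open>K = 2 E\<close>.\<close>

lemma fig_x_pi_half: "fig_x (pi / 2) = 0"
proof -
  have "fig_x (pi / 2) = integral {0..pi / 2} (\<lambda>t. fig_cos t / ell_delta m_star t)"
    unfolding fig_x_def
  proof (rule interval_integral_eq_Icc)
    show "continuous_on {0..pi / 2} (\<lambda>t. fig_cos t / ell_delta m_star t)"
      by (intro continuous_on_divide continuous_fig_cos continuous_ell_delta) (simp add: ell_delta_nz m_star)
  qed simp
  also have "\<dots> = integral {0..pi / 2} (\<lambda>t. 2 * ell_delta m_star t - 1 / ell_delta m_star t)"
  proof (rule integral_cong)
    fix t
    have "fig_cos t = 2 * (ell_delta m_star t)\<^sup>2 - 1"
      by (simp add: fig_cos_def ell_delta_square m_star)
    then show "fig_cos t / ell_delta m_star t = 2 * ell_delta m_star t - 1 / ell_delta m_star t"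
      using ell_delta_nz[OF m_star(2), of t] by (simp add: field_simps power2_eq_square)
  qed
  also have "\<dots> = integral {0..pi / 2} (\<lambda>t. 2 * ell_delta m_star t) - integral {0..pi / 2} (\<lambda>t. 1 / ell_delta m_star t)"
    by (rule Henstock_Kurzweil_Integration.integral_diff)
       (intro integrable_continuous_real continuous_on_mult continuous_on_const continuous_inverse_ell_delta m_star continuous_ell_delta)+
  also have "\<dots> = 2 * ellE m_star - ellK m_star"
    unfolding ellE_eq ellK_eq[OF m_star(2)] integral_mult_right ..
  finally show ?thesis by (simp add: m_star)
qed

text \<open>With the amplitude, rather than arclength, as an affine function of the parameter,
  speed, tangent and position are all explicit. The formulas simply continue beyond one leaf, so
  smoothness at the junctions is automatic; successive leaves lie on opposite sides of the
  \<open>e1\<close>-axis.\<close>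

lemma figure_eight_exists:
  fixes e1 e2 :: "'a::euclidean_space"
  assumes e: "norm e1 = 1" "norm e2 = 1" "e1 \<bullet> e2 = 0" and n: "n \<ge> 1"
  obtains \<gamma> :: "real \<Rightarrow> 'a" where "immersed_H2_curve 0 1 \<gamma>" "has_point_of_multiplicity 0 1 \<gamma> (Suc n)"
    "normalized_bending_energy 0 1 \<gamma> = varpi_star * (real n)\<^sup>2"
proof -
  \<comment> \<open>Each leaf takes up an amplitude interval of length \<open>pi\<close>, beginning
    at \<open>- pi / 2\<close>.\<close>
  define N where "N = real n * pi"
  have N: "0 < N" using n by (simp add: N_def)
  define ang where "ang x = N * x - pi / 2" for x
  define w where "w x = N / ell_delta m_star (ang x)" for x
  define w' where "w' x = N * (N * m_star * sin (ang x) * cos (ang x) / (ell_delta m_star (ang x)) ^ 3)" for x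
  define T where "T x = fig_cos (ang x) *\<^sub>R e1 + fig_sin (ang x) *\<^sub>R e2" for x
  \<comment> \<open>The factor 1 is the scale \<open>\<Lambda>\<close>, kept so that the term
    matches \<open>fig_primitive\<close>.\<close>
  define \<tau> where "\<tau> x = (2 * sqrt m_star * 1 * w x * cos (ang x)) *\<^sub>R
     (- fig_sin (ang x) *\<^sub>R e1 + fig_cos (ang x) *\<^sub>R e2)" for x
  \<comment> \<open>The second coordinate is explicit because
    \<open>fig_sin \<psi> / ell_delta m_star \<psi>\<close> is just
    \<open>2 sqrt m_star sin \<psi>\<close>.\<close>
  define \<gamma> where "\<gamma> x = fig_x (ang x) *\<^sub>R e1 + (- 2 * sqrt m_star * cos (ang x)) *\<^sub>R e2" for x
  note nz = ell_delta_nz[OF m_star(2)] and pos = ell_delta_pos[OF m_star(2)]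
  have ee: "e1 \<bullet> e1 = 1" "e2 \<bullet> e2 = 1" "e2 \<bullet> e1 = 0"
    using e by (simp_all add: dot_square_norm inner_commute)
  have dang: "(ang has_real_derivative N) (at x within S)" for x S
    unfolding ang_def[abs_def] by (auto intro!: derivative_eq_intros)
  have cang: "continuous_on S ang" for S
    unfolding ang_def by (intro continuous_intros)
  have cd: "continuous_on S (\<lambda>x. ell_delta m_star (ang x))" for S
    by (rule continuous_on_compose2[OF continuous_ell_delta[of UNIV] cang]) auto
  have cfc: "continuous_on S (\<lambda>x. fig_cos (ang x))" and cfs: "continuous_on S (\<lambda>x. fig_sin (ang x))" for S
    by (rule continuous_on_compose2[OF continuous_fig_cos[of UNIV] cang], simp,
        rule continuous_on_compose2[OF continuous_fig_sin[of UNIV] cang], simp)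
  have cw: "continuous_on S w" for S
    unfolding w_def by (intro continuous_intros cd) (simp add: nz)
  have cw': "continuous_on S w'" for S
    unfolding w'_def by (intro continuous_intros cd cang) (simp add: nz)
  have c\<tau>: "continuous_on S \<tau>" for S
    unfolding \<tau>_def by (intro continuous_intros cw cang cfs cfc)
  have primT: "primitive_on 0 1 T \<tau>"
    unfolding \<tau>_def
  proof (rule fig_primitive[OF _ cw])
    show "(ang has_real_derivative 1 * w x * ell_delta m_star (ang x)) (at x within {0..1})" for x
      using dang nz by (simp add: w_def)
  qed (simp add: T_def)
  have primw: "primitive_on 0 1 w w'"
  proof (rule primitive_on_FTC[OF _ cw'])
    fix x
    have "((\<lambda>x. ell_delta m_star (ang x)) has_real_derivative - m_star * sin (ang x) * cos (ang x) / ell_delta m_star (ang x) * N) (at x within {0..1})"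
      by (rule DERIV_chain2[OF ell_delta_has_derivative[OF m_star(2)] dang])
    from DERIV_divide[OF DERIV_const[of N] this nz]
    have "(w has_real_derivative w' x) (at x within {0..1})"
      unfolding w_def[abs_def]
      by (rule DERIV_cong) (use nz in \<open>simp add: w'_def field_simps power3_eq_cube\<close>)
    then show "(w has_vector_derivative w' x) (at x within {0..1})"
      by (simp add: has_real_derivative_iff_has_vector_derivative)
  qed
  have prim\<gamma>: "primitive_on 0 1 \<gamma> (\<lambda>x. w x *\<^sub>R T x)"
  proof (rule primitive_on_FTC)
    fix x :: real
    have "((\<lambda>x. fig_x (ang x)) has_real_derivative fig_cos (ang x) / ell_delta m_star (ang x) * N) (at x within {0..1})"
      by (rule DERIV_chain2[OF fig_x_has_derivative dang])
    then have 1: "((\<lambda>x. fig_x (ang x)) has_vector_derivative w x * fig_cos (ang x)) (at x within {0..1})"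
      by (simp add: w_def has_real_derivative_iff_has_vector_derivative ac_simps)
    have "((\<lambda>x. - 2 * sqrt m_star * cos (ang x)) has_real_derivative - 2 * sqrt m_star * (- sin (ang x) * N)) (at x within {0..1})"
      by (rule DERIV_cmult[OF DERIV_chain2[OF DERIV_cos dang]])
    then have 2: "((\<lambda>x. - 2 * sqrt m_star * cos (ang x)) has_vector_derivative w x * fig_sin (ang x)) (at x within {0..1})"
      unfolding has_real_derivative_iff_has_vector_derivative[symmetric]
      by (rule DERIV_cong) (use nz in \<open>simp add: w_def fig_sin_def\<close>)
    show "(\<gamma> has_vector_derivative w x *\<^sub>R T x) (at x within {0..1})"
      using has_vector_derivative_add[OF
          bounded_linear.has_vector_derivative[OF bounded_linear_scaleR_left 1]
          bounded_linear.has_vector_derivative[OF bounded_linear_scaleR_left 2], of e1 e2]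
      by (simp add: \<gamma>_def[abs_def] T_def scaleR_add_right)
  next
    show "continuous_on {0..1} (\<lambda>x. w x *\<^sub>R T x)"
      by (intro continuous_intros cw primitive_on_continuous[OF primT])
  qed
  have frame: "framed 0 1 \<gamma> w w' T \<tau>"
    unfolding framed_def framed_curve_def
  proof (intro conjI ballI primw primT prim\<gamma>)
    fix x :: real
    show "0 < w x" using pos N by (simp add: w_def)
    have "T x \<bullet> T x = (fig_cos (ang x))\<^sup>2 + (fig_sin (ang x))\<^sup>2"
      unfolding T_def using e(3) by (simp add: inner_add_left inner_add_right ee power2_eq_square)
    then show "norm (T x) = 1" by (simp add: fig_cos_sin_square norm_eq_1)
  next
    show "set_integrable lborel {0..1} (\<lambda>x. (norm (w' x))\<^sup>2)" "set_integrable lborel {0..1} (\<lambda>x. (norm (\<tau> x))\<^sup>2)"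
      by (rule borel_integrable_atLeastAtMost', intro continuous_intros cw' c\<tau>)+
  qed simp
  interpret framed 0 1 \<gamma> w w' T \<tau> by (rule frame)
  have L: "curve_length 0 1 \<gamma> = 2 * real n * ellK m_star"
  proof -
    have "primitive_on 0 1 (\<lambda>x. ellF (ang x) m_star) w"
    proof (rule primitive_on_FTC[OF _ cw])
      fix x
      show "((\<lambda>x. ellF (ang x) m_star) has_vector_derivative w x) (at x within {0..1})"
        unfolding has_real_derivative_iff_has_vector_derivative[symmetric]
        by (rule DERIV_cong[OF DERIV_chain2[OF ellF_has_derivative[OF m_star(2)] dang]]) (simp add: w_def)
    qed
    from primitive_on_integral[OF this, of 0 1]
    have "curve_length 0 1 \<gamma> = ellF (real n * pi - pi / 2) m_star - ellF (- (pi / 2)) m_star"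
      by (simp add: curve_length_eq ang_def N_def)
    also have "ellF (real n * pi - pi / 2) m_star = (2 * real n - 1) * ellF (pi / 2) m_star"
      by (rule odd_periodic_primitive[OF ellF_has_derivative[OF m_star(2)]])
         (simp_all add: ell_delta_period ellF_minus m_star)
    finally show ?thesis by (simp add: ellF_minus m_star ellK_def algebra_simps)
  qed
  have B: "bending_energy 0 1 \<gamma> = 8 * real n * ell_W m_star"
  proof -
    have "primitive_on 0 1 (\<lambda>x. 4 * m_star * ell_Q m_star (ang x)) (\<lambda>x. (norm (\<tau> x))\<^sup>2 / w x)"
    proof (rule primitive_on_FTC)
      fix x
      have "(norm (- fig_sin (ang x) *\<^sub>R e1 + fig_cos (ang x) *\<^sub>R e2))\<^sup>2 = (fig_cos (ang x))\<^sup>2 + (fig_sin (ang x))\<^sup>2"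
        unfolding power2_norm_eq_inner using e(3)
        by (simp add: inner_add_left inner_add_right inner_diff_left inner_diff_right ee power2_eq_square)
      moreover have "(norm (\<tau> x))\<^sup>2 = (2 * sqrt m_star * w x * cos (ang x))\<^sup>2 *
          (norm (- fig_sin (ang x) *\<^sub>R e1 + fig_cos (ang x) *\<^sub>R e2))\<^sup>2"
        unfolding \<tau>_def norm_scaleR by (simp add: power_mult_distrib)
      ultimately have "(norm (\<tau> x))\<^sup>2 = (2 * sqrt m_star * w x * cos (ang x))\<^sup>2"
        by (simp only: fig_cos_sin_square mult_1_right)
      also have "\<dots> = 4 * m_star * (w x)\<^sup>2 * (cos (ang x))\<^sup>2"
        using m_star by (simp add: power_mult_distrib)
      finally have "(norm (\<tau> x))\<^sup>2 / w x = 4 * m_star * ((cos (ang x))\<^sup>2 / ell_delta m_star (ang x) * N)"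
        using pos[of "ang x"] N by (simp add: w_def power2_eq_square)
      then show "((\<lambda>x. 4 * m_star * ell_Q m_star (ang x)) has_vector_derivative (norm (\<tau> x))\<^sup>2 / w x) (at x within {0..1})"
        unfolding has_real_derivative_iff_has_vector_derivative[symmetric]
        using DERIV_cmult[OF DERIV_chain2[OF ell_Q_has_derivative[OF less_imp_le[OF m_star(2)]] dang], of "4 * m_star"]
        by simp
    next
      show "continuous_on {0..1} (\<lambda>x. (norm (\<tau> x))\<^sup>2 / w x)"
        using speed_pos by (intro continuous_intros cw c\<tau>) force
    qed
    from primitive_on_integral[OF this, of 0 1]
    have "bending_energy 0 1 \<gamma> = 4 * m_star * ell_Q m_star (real n * pi - pi / 2) - 4 * m_star * ell_Q m_star (- (pi / 2))"
      by (simp add: bending_energy_eq ang_def N_def)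
    also have "ell_Q m_star (real n * pi - pi / 2) = (2 * real n - 1) * ell_Q m_star (pi / 2)"
      by (rule odd_periodic_primitive[OF ell_Q_has_derivative[OF less_imp_le[OF m_star(2)]]])
         (simp_all add: ell_delta_period ell_Q_minus less_imp_le[OF m_star(2)])
    finally show ?thesis
      by (simp add: ell_Q_minus less_imp_le[OF m_star(2)] ell_W_def algebra_simps)
  qed
  have "has_point_of_multiplicity 0 1 \<gamma> (Suc n)"
    unfolding has_point_of_multiplicity_def
  proof (intro exI conjI)
    \<comment> \<open>At \<open>i / n\<close> the amplitude is \<open>i pi - pi / 2\<close>: its
      cosine vanishes and \<open>fig_x\<close> is a multiple of \<open>fig_x (pi / 2) = 0\<close>,
      so the curve is at the origin.\<close>
    let ?S = "(\<lambda>i. real i / real n) ` {..n}"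
    show "finite ?S" by simp
    have "inj_on (\<lambda>i. real i / real n) {..n}" using n by (auto intro: inj_onI)
    then show "card ?S = Suc n" by (simp add: card_image)
    show "?S \<subseteq> {x \<in> {0..1}. \<gamma> x = 0}"
    proof
      fix x assume "x \<in> ?S"
      then obtain i where i: "i \<le> n" "x = real i / real n" by auto
      have angx: "ang x = real i * pi - pi / 2" using n by (simp add: ang_def N_def i)
      have "fig_x (ang x) = (2 * real i - 1) * fig_x (pi / 2)"
        unfolding angx
        by (rule odd_periodic_primitive[OF fig_x_has_derivative])
           (simp_all add: ell_delta_period fig_x_minus fig_cos_def)
      moreover have "cos (ang x) = 0"
        unfolding angx by (simp add: cos_diff sin_npi)
      ultimately show "x \<in> {x \<in> {0..1}. \<gamma> x = 0}"
        using i n by (simp add: \<gamma>_def fig_x_pi_half)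
    qed
  qed
  moreover have "normalized_bending_energy 0 1 \<gamma> = varpi_star * (real n)\<^sup>2"
    by (simp add: normalized_bending_energy_def L B varpi_star_eq power2_eq_square)
  ultimately show ?thesis by (rule that[OF immersed])
qed

theorem theorem3p16:
  fixes k :: nat
  assumes "CARD('n::finite) \<ge> 2" and "k \<ge> 2"
  shows "(\<exists>\<gamma> :: real \<Rightarrow> real ^ 'n.
            immersed_H2_curve 0 1 \<gamma> \<and> has_point_of_multiplicity 0 1 \<gamma> k \<and>
            normalized_bending_energy 0 1 \<gamma> = varpi_star * (real k - 1)\<^sup>2) \<and>
         (\<forall>\<gamma> :: real \<Rightarrow> real ^ 'n.
            immersed_H2_curve 0 1 \<gamma> \<and> has_point_of_multiplicity 0 1 \<gamma> k \<longrightarrow>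
            (normalized_bending_energy 0 1 \<gamma> = varpi_star * (real k - 1)\<^sup>2 \<longleftrightarrow>
             leafed_elastica (k - 1) 0 1 \<gamma>))"
proof (intro conjI allI impI)
  \<comment> \<open>The number of leaves cut out by \<open>k\<close> preimages; since
    \<open>k \<ge> 2\<close>, the truncated difference agrees with
    \<open>real k - 1\<close>.\<close>
  define n where "n = k - 1"
  have k: "k = Suc n" "n \<ge> 1" and kn: "real k - 1 = real n" using assms(2) by (auto simp: n_def)
  have "\<not> is_singleton (UNIV :: 'n set)"
    using assms(1) by (auto simp: is_singleton_altdef)
  then obtain i j :: 'n where "i \<noteq> j"
    by (metis UNIV_I UNIV_not_empty is_singletonI')
  obtain \<gamma> :: "real \<Rightarrow> real ^ 'n" where "immersed_H2_curve 0 1 \<gamma>" "has_point_of_multiplicity 0 1 \<gamma> (Suc n)"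
    "normalized_bending_energy 0 1 \<gamma> = varpi_star * (real n)\<^sup>2"
    by (rule figure_eight_exists[of "axis i 1 :: real ^ 'n" "axis j 1" n])
       (use \<open>i \<noteq> j\<close> k(2) in \<open>auto simp: norm_axis_1 inner_axis_axis\<close>)
  then show "\<exists>\<gamma> :: real \<Rightarrow> real ^ 'n.
            immersed_H2_curve 0 1 \<gamma> \<and> has_point_of_multiplicity 0 1 \<gamma> k \<and>
            normalized_bending_energy 0 1 \<gamma> = varpi_star * (real k - 1)\<^sup>2"
    unfolding k(1)[symmetric] kn by blast
  fix \<gamma> :: "real \<Rightarrow> real ^ 'n"
  assume "immersed_H2_curve 0 1 \<gamma> \<and> has_point_of_multiplicity 0 1 \<gamma> k"
  then have imm: "immersed_H2_curve 0 1 \<gamma>" and mult: "has_point_of_multiplicity 0 1 \<gamma> (Suc n)"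
    by (auto simp: k(1))
  obtain w w' T \<tau> where "framed_curve 0 1 \<gamma> w w' T \<tau>"
    by (rule immersed_H2_curve_imp_framed[OF imm])
  then interpret framed 0 1 \<gamma> w w' T \<tau> by unfold_locales
  show "normalized_bending_energy 0 1 \<gamma> = varpi_star * (real k - 1)\<^sup>2 \<longleftrightarrow> leafed_elastica (k - 1) 0 1 \<gamma>"
    unfolding kn n_def[symmetric]
    using leafed_imp_energy multiplicity_energy_imp_leafed[OF mult k(2)] by blast
qed

end
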